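(* A pseudovariety $\mathsf V$ of finite abelian groups is decidable if and only if it is completely tame.
   Context: A pseudovariety is a class of finite semigroups closed under taking subsemigroups, homomorphic images and finite direct products; a pseudovariety of finite abelian groups is one all of whose members are abelian groups. It is decidable if there is an algorithm to test membership of a finite semigroup in it. Profinite semigroups. $\mathsf{S}$ is the pseudovariety of all finite semigroups. For a pseudovariety $\mathsf{V}$ and a finite set $A$, $\overline{\Omega}_A\mathsf{V}$ is the free pro-$\mathsf{V}$ semigroup on $A$, and $\psi_{\mathsf V}:\overline{\Omega}_A\mathsf{S}\to\overline{\Omega}_A\mathsf{V}$ is the unique continuous homomorphism restricting to the identity on $A$. Elements of $(\overline{\Omega}_A\mathsf{S})^1$ are called pseudowords. $\mathsf V$ satisfies the pseudoidentity $u=v$ (with $u,v\in\overline{\Omega}_A\mathsf{S}$) if $\psi_{\mathsf V}(u)=\psi_{\mathsf V}(v)$. Each $w\in\overline{\Omega}_A\mathsf{S}$ induces an $A$-ary operation $\varphi\mapsto\hat\varphi(w)$ on every profinite semigroup $S$, where $\hat\varphi:\overline{\Omega}_A\mathsf S\to S$ is the continuous homomorphism extending $\varphi:A\to S$; these are the $A$-ary implicit operations, and in the same way the elements of $\overline{\Omega}_A\mathsf V$ are identified with implicit operations on pro-$\mathsf V$ semigroups. An implicit signature $\sigma$ is a set of implicit operations including multiplication. Every profinite semigroup is naturally a $\sigma$-algebra, and $\Omega_A^\sigma\mathsf{V}$ is the $\sigma$-subalgebra of $\overline{\Omega}_A\mathsf{V}$ generated by $A$. Systems. Let $X$ (variables)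 and $P$ (parameters) be disjoint finite sets and $A$ a finite alphabet. A system consists of finitely many equations $u_i=v_i$ with $u_i,v_i\in\Omega^\sigma_{X\cup P}\mathsf{S}$, rational constraints $L_x\subseteq A^*$ ($x\in X$), and elements $w_p\in\Omega_A^\sigma\mathsf{S}$ ($p\in P$). $Cl(L_x)$ denotes the closure of $L_x$ in $(\overline{\Omega}_A\mathsf{S})^1$ (the adjoined $1$ being isolated). A solution modulo $\mathsf{V}$ is a continuous homomorphism $\delta:\overline{\Omega}_{X\cup P}\mathsf{S}\to\overline{\Omega}_A\mathsf{S}$ with $\delta(x)\in Cl(L_x)$ for $x\in X$, $\delta(p)=w_p$ for $p\in P$, and such that $\mathsf V$ satisfies $\delta(u_i)=\delta(v_i)$ for all $i$. $\mathsf V$ is $\sigma$-reducible for the system if, whenever the system has a solution modulo $\mathsf V$, it has a solution $\delta$ modulo $\mathsf V$ with $\delta(x)\in\Omega_A^\sigma\mathsf{S}$ for all $x\in X$. Tameness. $\Omega_A^\sigma\mathsf{V}$ has decidable word problem if there is an algorithm to decide whether two pseudowords $u,v\in\overline{\Omega}_A\mathsf{S}$ with $\psi_{\mathsf V}(u),\psi_{\mathsf V}(v)\in\Omega_A^\sigma\mathsf V$ represent the same implicit operation in $\Omega_A^\sigma\mathsf V$. $\mathsf V$ is $\sigma$-tame with respect to a class $\mathfrak{C}$ of systems of equations if: $\mathsf V$ is $\sigma$-reducible for every system in $\mathfrak C$; the word problem is decidable in $\Omega_A^\sigma\mathsf{V}$; and $\mathsf V$ is recursively enumerable, in the sense that some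 Turing machine outputs successively representatives of all the isomorphism classes of members of $\mathsf V$. $\mathsf V$ is completely $\sigma$-tame if it is $\sigma$-tame with respect to every class of systems of equations, and completely tame if it is completely $\sigma$-tame for some implicit signature $\sigma$. *)

theory Defs
  imports "HOL-Analysis.Analysis" "HOL-Algebra.Group" "HOL-Library.Nat_Bijection"
begin

(* would clash with the topological closure operator *)
no_notation Congruence.eq_closure_of (\<open>closure'_of\<index>\<close>)

section \<open>Finite semigroups and pseudovarieties\<close>

record 'a semigrp = "'a partial_object" +
  smul :: "'a \<Rightarrow> 'a \<Rightarrow> 'a"

definition is_semigroup :: "'a semigrp \<Rightarrow> bool" where
  "is_semigroup S \<longleftrightarrow>
     (\<forall>x\<in>carrier S. \<forall>y\<in>carrier S. smul S x y \<in> carrier S) \<and>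
     (\<forall>x\<in>carrier S. \<forall>y\<in>carrier S. \<forall>z\<in>carrier S.
        smul S (smul S x y) z = smul S x (smul S y z))"

definition sg_hom :: "'a semigrp \<Rightarrow> 'b semigrp \<Rightarrow> ('a \<Rightarrow> 'b) \<Rightarrow> bool" where
  "sg_hom S T f \<longleftrightarrow> f \<in> carrier S \<rightarrow> carrier T \<and>
     (\<forall>x\<in>carrier S. \<forall>y\<in>carrier S. f (smul S x y) = smul T (f x) (f y))"

definition sg_isomorphic :: "'a semigrp \<Rightarrow> 'b semigrp \<Rightarrow> bool" where
  "sg_isomorphic S T \<longleftrightarrow> (\<exists>f. sg_hom S T f \<and> bij_betw f (carrier S) (carrier T))"

text \<open>
  A class of finite semigroups closed under isomorphism is represented by its members whose
  carrier is a set of natural numbers; \<open>FinS\<close> is the pseudovariety of all finite semigroups.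
  Finite semigroups are nonempty.
\<close>

definition FinS :: "nat semigrp set" where
  "FinS = {S. is_semigroup S \<and> finite (carrier S) \<and> carrier S \<noteq> {}}"

definition direct_product :: "nat \<Rightarrow> (nat \<Rightarrow> 'a semigrp) \<Rightarrow> (nat \<Rightarrow> 'a) semigrp" where
  "direct_product n S =
     \<lparr>carrier = (\<Pi>\<^sub>E i\<in>{..<n}. carrier (S i)),
      smul = (\<lambda>u v. \<lambda>i\<in>{..<n}. smul (S i) (u i) (v i))\<rparr>"

text \<open>
  The product of a family of members is a semigroup of functions, so closure under finite direct
  products refers to its copies with carrier in the natural numbers.  The empty product (\<open>n = 0\<close>)
  puts the trivial semigroup into every pseudovariety.
\<close>

definition pseudovariety :: "nat semigrp set \<Rightarrow> bool" where
  "pseudovariety V \<longleftrightarrow>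
     V \<subseteq> FinS \<and>
     (\<forall>S\<in>V. \<forall>H. H \<subseteq> carrier S \<and> H \<noteq> {} \<and> (\<forall>x\<in>H. \<forall>y\<in>H. smul S x y \<in> H)
        \<longrightarrow> S\<lparr>carrier := H\<rparr> \<in> V) \<and>
     (\<forall>S\<in>V. \<forall>T\<in>FinS. \<forall>f. sg_hom S T f \<and> f ` carrier S = carrier T \<longrightarrow> T \<in> V) \<and>
     (\<forall>n S. (\<forall>i<n. S i \<in> V) \<longrightarrow>
        (\<forall>T\<in>FinS. sg_isomorphic T (direct_product n S) \<longrightarrow> T \<in> V))"

definition is_abelian_group :: "'a semigrp \<Rightarrow> bool" where
  "is_abelian_group S \<longleftrightarrow>
     (\<exists>e. comm_group \<lparr>carrier = carrier S, monoid.mult = smul S, one = e\<rparr>)"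


section \<open>Free profinite semigroups\<close>

fun word_prod :: "'a semigrp \<Rightarrow> 'a list \<Rightarrow> 'a" where
  "word_prod S [] = undefined"
| "word_prod S [x] = x"
| "word_prod S (x # y # zs) = smul S x (word_prod S (y # zs))"

text \<open>
  The free pro-\<open>V\<close> semigroup on a set \<open>A\<close> of letters is realised as the closure of the subsemigroup
  generated by \<open>A\<close> in the product of all \<open>S \<in> V\<close> over all maps \<open>\<phi> : A \<rightarrow> S\<close>, the finite factors
  being discrete and the letter \<open>a\<close> being the tuple with component \<open>\<phi> a\<close> at \<open>(S, \<phi>)\<close>.
  Its universal property is proved below.
\<close>

type_synonym pseudoword = "nat semigrp \<times> (nat \<Rightarrow> nat) \<Rightarrow> nat"

definition interp :: "nat semigrp set \<Rightarrow> nat set \<Rightarrow> (nat semigrp \<times> (nat \<Rightarrow> nat)) set" where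
  "interp V A = (SIGMA S:V. A \<rightarrow>\<^sub>E carrier S)"

definition big_product :: "nat semigrp set \<Rightarrow> nat set \<Rightarrow> pseudoword semigrp" where
  "big_product V A =
     \<lparr>carrier = (\<Pi>\<^sub>E i\<in>interp V A. carrier (fst i)),
      smul = (\<lambda>u v. \<lambda>i\<in>interp V A. smul (fst i) (u i) (v i))\<rparr>"

definition big_top :: "nat semigrp set \<Rightarrow> nat set \<Rightarrow> pseudoword topology" where
  "big_top V A = product_topology (\<lambda>i. discrete_topology (carrier (fst i))) (interp V A)"

definition letter :: "nat semigrp set \<Rightarrow> nat set \<Rightarrow> nat \<Rightarrow> pseudoword" where
  "letter V A a = (\<lambda>i\<in>interp V A. snd i a)"

definition word :: "nat semigrp set \<Rightarrow> nat set \<Rightarrow> nat list \<Rightarrow> pseudoword" where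
  "word V A w = word_prod (big_product V A) (map (letter V A) w)"

definition Omega :: "nat semigrp set \<Rightarrow> nat set \<Rightarrow> pseudoword semigrp" where
  "Omega V A = (big_product V A)
     \<lparr>carrier := big_top V A closure_of {word V A w | w. w \<in> lists A \<and> w \<noteq> []}\<rparr>"

definition Omega_top :: "nat semigrp set \<Rightarrow> nat set \<Rightarrow> pseudoword topology" where
  "Omega_top V A = subtopology (big_top V A) (carrier (Omega V A))"

definition cont_hom ::
  "'a semigrp \<Rightarrow> 'a topology \<Rightarrow> 'b semigrp \<Rightarrow> 'b topology \<Rightarrow> ('a \<Rightarrow> 'b) \<Rightarrow> bool" where
  "cont_hom S X T Y f \<longleftrightarrow> sg_hom S T f \<and> continuous_map X Y f"

text \<open>
  \<open>hat A T Y \<phi>\<close> is the unique continuous homomorphism from the free profinite semigroup on \<open>A\<close> to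
  the profinite semigroup \<open>T\<close> with topology \<open>Y\<close> that extends \<open>\<phi> : A \<rightarrow> T\<close>; it is normalised to be
  \<open>undefined\<close> off the carrier so that it is unique as a HOL function.
\<close>

definition hat ::
  "nat set \<Rightarrow> 'b semigrp \<Rightarrow> 'b topology \<Rightarrow> (nat \<Rightarrow> 'b) \<Rightarrow> pseudoword \<Rightarrow> 'b" where
  "hat A T Y \<phi> = (THE f. f \<in> extensional (carrier (Omega FinS A)) \<and>
      cont_hom (Omega FinS A) (Omega_top FinS A) T Y f \<and>
      (\<forall>a\<in>A. f (letter FinS A a) = \<phi> a))"

definition psi :: "nat semigrp set \<Rightarrow> nat set \<Rightarrow> pseudoword \<Rightarrow> pseudoword" where
  "psi V A = hat A (Omega V A) (Omega_top V A) (letter V A)"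

definition satisfies :: "nat semigrp set \<Rightarrow> nat set \<Rightarrow> pseudoword \<Rightarrow> pseudoword \<Rightarrow> bool" where
  "satisfies V A u v \<longleftrightarrow> psi V A u = psi V A v"


section \<open>Implicit signatures\<close>

text \<open>
  An \<open>n\<close>-ary implicit operation is a pair \<open>(n, w)\<close> with \<open>w\<close> a pseudoword on the letters
  \<open>0, \<dots>, n - 1\<close>; on a profinite semigroup it acts by \<open>\<phi> \<mapsto> hat {..<n} T Y \<phi> w\<close>.  There are
  none for \<open>n = 0\<close>, since the free profinite semigroup on the empty set is empty.
\<close>

type_synonym implicit_op = "nat \<times> pseudoword"

definition implicit_signature :: "implicit_op set \<Rightarrow> bool" where
  "implicit_signature \<sigma> \<longleftrightarrow>
     \<sigma> \<subseteq> (SIGMA n:UNIV. carrier (Omega FinS {..<n})) \<and>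
     (2, word FinS {..<2} [0, 1]) \<in> \<sigma>"

inductive_set sigma_sub :: "implicit_op set \<Rightarrow> nat semigrp set \<Rightarrow> nat set \<Rightarrow> pseudoword set"
  for \<sigma> V A where
  gen: "a \<in> A \<Longrightarrow> letter V A a \<in> sigma_sub \<sigma> V A"
| op: "(n, w) \<in> \<sigma> \<Longrightarrow> (\<forall>i<n. \<phi> i \<in> sigma_sub \<sigma> V A) \<Longrightarrow>
       hat {..<n} (Omega V A) (Omega_top V A) \<phi> w \<in> sigma_sub \<sigma> V A"


section \<open>Systems of equations with rational constraints\<close>

inductive rational :: "nat set \<Rightarrow> nat list set \<Rightarrow> bool" for A where
  empty: "rational A {}"
| epsilon: "rational A {[]}"
| symbol: "a \<in> A \<Longrightarrow> rational A {[a]}"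
| union: "rational A K \<Longrightarrow> rational A L \<Longrightarrow> rational A (K \<union> L)"
| product: "rational A K \<Longrightarrow> rational A L \<Longrightarrow> rational A {u @ v | u v. u \<in> K \<and> v \<in> L}"
| star: "rational A L \<Longrightarrow> rational A {concat us | us. set us \<subseteq> L}"

text \<open>The adjoined identity is \<open>None\<close>, an isolated point.\<close>

definition adjoin_one_top :: "'a topology \<Rightarrow> 'a option topology" where
  "adjoin_one_top X =
     topology (\<lambda>U. U \<subseteq> insert None (Some ` topspace X) \<and> openin X {x. Some x \<in> U})"

definition word1 :: "nat set \<Rightarrow> nat list \<Rightarrow> pseudoword option" where
  "word1 A w = (if w = [] then None else Some (word FinS A w))"

definition Cl :: "nat set \<Rightarrow> nat list set \<Rightarrow> pseudoword option set" where
  "Cl A L = adjoin_one_top (Omega_top FinS A) closure_of (word1 A ` L)"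

text \<open>Variables, parameters and letters are natural numbers; variables and parameters are
  disjoint from each other, but the alphabet is unrelated to both.\<close>

record eq_system =
  variables :: "nat set"
  parameters :: "nat set"
  alphabet :: "nat set"
  equations :: "(pseudoword \<times> pseudoword) set"
  constraint :: "nat \<Rightarrow> nat list set"
  param_value :: "nat \<Rightarrow> pseudoword"

abbreviation unknowns :: "eq_system \<Rightarrow> nat set" where
  "unknowns E \<equiv> variables E \<union> parameters E"

definition is_system :: "implicit_op set \<Rightarrow> eq_system \<Rightarrow> bool" where
  "is_system \<sigma> E \<longleftrightarrow>
     finite (variables E) \<and> finite (parameters E) \<and> variables E \<inter> parameters E = {} \<and>
     finite (alphabet E) \<and>
     finite (equations E) \<and>
     equations E \<subseteq> sigma_sub \<sigma> FinS (unknowns E) \<times> sigma_sub \<sigma> FinS (unknowns E) \<and>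
     (\<forall>x\<in>variables E. rational (alphabet E) (constraint E x)) \<and>
     (\<forall>p\<in>parameters E. param_value E p \<in> sigma_sub \<sigma> FinS (alphabet E))"

definition solution :: "nat semigrp set \<Rightarrow> eq_system \<Rightarrow> (pseudoword \<Rightarrow> pseudoword) \<Rightarrow> bool" where
  "solution V E \<delta> \<longleftrightarrow>
     cont_hom (Omega FinS (unknowns E)) (Omega_top FinS (unknowns E))
              (Omega FinS (alphabet E)) (Omega_top FinS (alphabet E)) \<delta> \<and>
     (\<forall>x\<in>variables E. Some (\<delta> (letter FinS (unknowns E) x)) \<in> Cl (alphabet E) (constraint E x)) \<and>
     (\<forall>p\<in>parameters E. \<delta> (letter FinS (unknowns E) p) = param_value E p) \<and>
     (\<forall>(u, v)\<in>equations E. satisfies V (alphabet E) (\<delta> u) (\<delta> v))"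

definition reducible_for :: "implicit_op set \<Rightarrow> nat semigrp set \<Rightarrow> eq_system \<Rightarrow> bool" where
  "reducible_for \<sigma> V E \<longleftrightarrow>
     (\<exists>\<delta>. solution V E \<delta>) \<longrightarrow>
     (\<exists>\<delta>. solution V E \<delta> \<and>
        (\<forall>x\<in>variables E. \<delta> (letter FinS (unknowns E) x) \<in> sigma_sub \<sigma> FinS (alphabet E)))"


section \<open>Algorithms\<close>

text \<open>
  Algorithms are modelled by the general recursive functions.  \<open>recursive_fun k f\<close> only speaks
  about \<open>f\<close> on argument lists of length \<open>k\<close>.
\<close>

inductive recursive_fun :: "nat \<Rightarrow> (nat list \<Rightarrow> nat) \<Rightarrow> bool" where
  zero: "recursive_fun k (\<lambda>_. 0)"
| succ: "recursive_fun 1 (\<lambda>xs. Suc (xs ! 0))"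
| proj: "i < k \<Longrightarrow> recursive_fun k (\<lambda>xs. xs ! i)"
| comp: "recursive_fun (length gs) f \<Longrightarrow> (\<forall>g\<in>set gs. recursive_fun k g) \<Longrightarrow>
         recursive_fun k (\<lambda>xs. f (map (\<lambda>g. g xs) gs))"
| prim_rec: "recursive_fun k f \<Longrightarrow> recursive_fun (Suc (Suc k)) g \<Longrightarrow>
         recursive_fun (Suc k) (\<lambda>xs. rec_nat (f (tl xs)) (\<lambda>n r. g (n # r # tl xs)) (hd xs))"
| minimize: "recursive_fun (Suc k) f \<Longrightarrow> (\<forall>xs. length xs = k \<longrightarrow> (\<exists>y. f (y # xs) = 0)) \<Longrightarrow>
         recursive_fun k (\<lambda>xs. LEAST y. f (y # xs) = 0)"

text \<open>A finite semigroup is presented to an algorithm by a multiplication table: the code of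
  \<open>(n, xs)\<close> stands for the carrier \<open>{..<n}\<close>, with the rows of the table concatenated in \<open>xs\<close>.\<close>

definition table_sg :: "nat \<Rightarrow> nat semigrp" where
  "table_sg c = (case prod_decode c of (n, t) \<Rightarrow>
     \<lparr>carrier = {..<n}, smul = (\<lambda>i j. list_decode t ! (i * n + j))\<rparr>)"

definition table_code :: "nat \<Rightarrow> bool" where
  "table_code c \<longleftrightarrow> (case prod_decode c of (n, t) \<Rightarrow> length (list_decode t) = n * n) \<and>
     table_sg c \<in> FinS"

definition decidable_pv :: "nat semigrp set \<Rightarrow> bool" where
  "decidable_pv V \<longleftrightarrow> (\<exists>f. recursive_fun 1 f \<and>
     (\<forall>c. table_code c \<longrightarrow> f [c] = (if table_sg c \<in> V then 1 else 0)))"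

definition rec_enumerable_pv :: "nat semigrp set \<Rightarrow> bool" where
  "rec_enumerable_pv V \<longleftrightarrow> (\<exists>f. recursive_fun 1 f \<and>
     (\<forall>n. table_code (f [n]) \<and> table_sg (f [n]) \<in> V) \<and>
     (\<forall>S\<in>V. \<exists>n. sg_isomorphic S (table_sg (f [n]))))"

text \<open>
  Elements of the \<open>\<sigma>\<close>-subalgebra generated by the letters are presented to an algorithm by
  \<open>\<sigma>\<close>-terms, whose operation symbols are the indices in an enumeration \<open>\<nu>\<close> of \<open>\<sigma>\<close> (repetitions
  allowed, so that finite signatures are covered) along which the arity is computable.  For finite
  \<open>\<sigma>\<close> the existence of such a \<open>\<nu>\<close> is no restriction and its choice does not matter.
\<close>

datatype sigma_term = Var nat | App nat "sigma_term list"

fun term_code :: "sigma_term \<Rightarrow> nat" where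
  "term_code (Var x) = sum_encode (Inl x)"
| "term_code (App i ts) = sum_encode (Inr (prod_encode (i, list_encode (map term_code ts))))"

fun wf_term :: "(nat \<Rightarrow> implicit_op) \<Rightarrow> nat set \<Rightarrow> sigma_term \<Rightarrow> bool" where
  "wf_term \<nu> A (Var x) \<longleftrightarrow> x \<in> A"
| "wf_term \<nu> A (App i ts) \<longleftrightarrow> length ts = fst (\<nu> i) \<and> (\<forall>t\<in>set ts. wf_term \<nu> A t)"

fun term_val :: "(nat \<Rightarrow> implicit_op) \<Rightarrow> nat set \<Rightarrow> sigma_term \<Rightarrow> pseudoword" where
  "term_val \<nu> A (Var x) = letter FinS A x"
| "term_val \<nu> A (App i ts) =
     hat {..<fst (\<nu> i)} (Omega FinS A) (Omega_top FinS A)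
         (\<lambda>j. map (term_val \<nu> A) ts ! j) (snd (\<nu> i))"

definition effective_enumeration :: "implicit_op set \<Rightarrow> (nat \<Rightarrow> implicit_op) \<Rightarrow> bool" where
  "effective_enumeration \<sigma> \<nu> \<longleftrightarrow> range \<nu> = \<sigma> \<and>
     (\<exists>f. recursive_fun 1 f \<and> (\<forall>i. f [i] = fst (\<nu> i)))"

definition decidable_word_problem :: "implicit_op set \<Rightarrow> nat semigrp set \<Rightarrow> bool" where
  "decidable_word_problem \<sigma> V \<longleftrightarrow> (\<exists>\<nu>. effective_enumeration \<sigma> \<nu> \<and>
     (\<forall>A. finite A \<longrightarrow> (\<exists>f. recursive_fun 2 f \<and>
        (\<forall>s t. wf_term \<nu> A s \<and> wf_term \<nu> A t \<longrightarrow>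
           f [term_code s, term_code t] =
             (if satisfies V A (term_val \<nu> A s) (term_val \<nu> A t) then 1 else 0)))))"


section \<open>Tameness\<close>

definition sigma_tame :: "implicit_op set \<Rightarrow> nat semigrp set \<Rightarrow> eq_system set \<Rightarrow> bool" where
  "sigma_tame \<sigma> V C \<longleftrightarrow>
     (\<forall>E\<in>C. reducible_for \<sigma> V E) \<and> decidable_word_problem \<sigma> V \<and> rec_enumerable_pv V"

definition completely_sigma_tame :: "implicit_op set \<Rightarrow> nat semigrp set \<Rightarrow> bool" where
  "completely_sigma_tame \<sigma> V \<longleftrightarrow> (\<forall>C. C \<subseteq> {E. is_system \<sigma> E} \<longrightarrow> sigma_tame \<sigma> V C)"

definition completely_tame :: "nat semigrp set \<Rightarrow> bool" where
  "completely_tame V \<longleftrightarrow> (\<exists>\<sigma>. implicit_signature \<sigma> \<and> completely_sigma_tame \<sigma> V)"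


section \<open>Well-definedness of the constructions\<close>

lemma openin_adjoin_one_top:
  "openin (adjoin_one_top X) U \<longleftrightarrow>
     U \<subseteq> insert None (Some ` topspace X) \<and> openin X {x. Some x \<in> U}"
proof -
  have "istopology (\<lambda>U. U \<subseteq> insert None (Some ` topspace X) \<and> openin X {x. Some x \<in> U})"
    unfolding istopology_def
  proof (intro conjI allI impI)
    fix S T assume "S \<subseteq> insert None (Some ` topspace X) \<and> openin X {x. Some x \<in> S}"
      "T \<subseteq> insert None (Some ` topspace X) \<and> openin X {x. Some x \<in> T}"
    moreover have "{x. Some x \<in> S \<inter> T} = {x. Some x \<in> S} \<inter> {x. Some x \<in> T}" by auto
    ultimately show "S \<inter> T \<subseteq> insert None (Some ` topspace X)" "openin X {x. Some x \<in> S \<inter> T}"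
      by auto
  next
    fix K assume *: "\<forall>S\<in>K. S \<subseteq> insert None (Some ` topspace X) \<and> openin X {x. Some x \<in> S}"
    have "{x. Some x \<in> \<Union>K} = (\<Union>S\<in>K. {x. Some x \<in> S})" by auto
    then show "openin X {x. Some x \<in> \<Union>K}" using * by auto
    show "\<Union>K \<subseteq> insert None (Some ` topspace X)" using * by blast
  qed
  then show ?thesis unfolding adjoin_one_top_def by (simp add: topology_inverse')
qed

lemma word_prod_Cons: "w \<noteq> [] \<Longrightarrow> word_prod S (x # w) = smul S x (word_prod S w)"
  by (cases w) auto

lemma word_prod_closed:
  "is_semigroup S \<Longrightarrow> w \<noteq> [] \<Longrightarrow> set w \<subseteq> carrier S \<Longrightarrow> word_prod S w \<in> carrier S"
  by (induction S w rule: word_prod.induct) (auto simp: is_semigroup_def)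

lemma word_prod_append:
  assumes S: "is_semigroup S" and "set u \<subseteq> carrier S" "set v \<subseteq> carrier S" "u \<noteq> []" "v \<noteq> []"
  shows "word_prod S (u @ v) = smul S (word_prod S u) (word_prod S v)"
  using assms(2,4)
proof (induction u)
  case (Cons x u)
  show ?case
  proof (cases "u = []")
    case True
    then show ?thesis using assms by (simp add: word_prod_Cons)
  next
    case False
    then have "word_prod S (u @ v) = smul S (word_prod S u) (word_prod S v)"
      using Cons by auto
    moreover have "word_prod S u \<in> carrier S" "word_prod S v \<in> carrier S"
      using word_prod_closed[OF S] False Cons.prems assms by auto
    ultimately show ?thesis
      using S False Cons.prems by (simp add: word_prod_Cons is_semigroup_def)
  qed
qed simp

lemma word_prod_hom:
  assumes "is_semigroup S" "sg_hom S T f" "w \<noteq> []" "set w \<subseteq> carrier S"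
  shows "f (word_prod S w) = word_prod T (map f w)"
  using assms(3,4)
proof (induction w)
  case (Cons x w)
  then show ?case
    using assms(1,2) word_prod_closed[OF assms(1), of w]
    by (cases "w = []") (auto simp: word_prod_Cons sg_hom_def)
qed simp

context
  fixes V :: "nat semigrp set" and A :: "nat set"
  assumes V: "V \<subseteq> FinS"
begin

lemma interp_FinS: "i \<in> interp V A \<Longrightarrow> fst i \<in> FinS"
  using V by (auto simp: interp_def)

lemma big_product_semigroup: "is_semigroup (big_product V A)"
proof -
  have "is_semigroup (fst i)" if "i \<in> interp V A" for i
    using interp_FinS[OF that] by (simp add: FinS_def)
  then show ?thesis
    unfolding is_semigroup_def big_product_def
    by (fastforce simp: PiE_iff intro!: restrict_ext)
qed

lemma topspace_big_top: "topspace (big_top V A) = carrier (big_product V A)"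
  by (simp add: big_top_def big_product_def)

lemma letter_in_product: "a \<in> A \<Longrightarrow> letter V A a \<in> carrier (big_product V A)"
  by (auto simp: letter_def big_product_def interp_def)

lemma word_in_product: "w \<in> lists A \<Longrightarrow> w \<noteq> [] \<Longrightarrow> word V A w \<in> carrier (big_product V A)"
  unfolding word_def
  by (rule word_prod_closed[OF big_product_semigroup]) (auto intro: letter_in_product)

lemma word_in_Omega: "w \<in> lists A \<Longrightarrow> w \<noteq> [] \<Longrightarrow> word V A w \<in> carrier (Omega V A)"
proof -
  assume "w \<in> lists A" "w \<noteq> []"
  moreover have "{word V A w | w. w \<in> lists A \<and> w \<noteq> []} \<subseteq> topspace (big_top V A)"
    using word_in_product topspace_big_top by auto
  ultimately show ?thesis
    unfolding Omega_def using closure_of_subset by fastforce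
qed

lemma letter_in_Omega: "a \<in> A \<Longrightarrow> letter V A a \<in> carrier (Omega V A)"
  using word_in_Omega[of "[a]"] by (simp add: word_def)

lemma Omega_subset: "carrier (Omega V A) \<subseteq> carrier (big_product V A)"
  unfolding Omega_def using closure_of_subset_topspace topspace_big_top by fastforce

lemma topspace_Omega_top: "topspace (Omega_top V A) = carrier (Omega V A)"
  using Omega_subset topspace_big_top by (auto simp: Omega_top_def)

lemma smul_Omega: "smul (Omega V A) = smul (big_product V A)"
  by (simp add: Omega_def)

lemma word_prod_Omega: "word_prod (Omega V A) zs = word_prod (big_product V A) zs"
proof (induction zs)
  case (Cons z zs)
  then show ?case by (cases zs) (simp_all add: smul_Omega)
qed simp

lemma word_append:
  assumes "u \<in> lists A" "v \<in> lists A" "u \<noteq> []" "v \<noteq> []"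
  shows "word V A (u @ v) = smul (big_product V A) (word V A u) (word V A v)"
  unfolding word_def map_append
  by (rule word_prod_append[OF big_product_semigroup]) (use assms letter_in_product in auto)

lemma smul_continuous:
  "continuous_map (prod_topology (big_top V A) (big_top V A)) (big_top V A)
     (\<lambda>p. smul (big_product V A) (fst p) (snd p))"
proof -
  let ?P = "prod_topology (big_top V A) (big_top V A)"
  have comp: "continuous_map ?P (discrete_topology (carrier (fst i)))
               (\<lambda>p. smul (big_product V A) (fst p) (snd p) i)" if i: "i \<in> interp V A" for i
  proof -
    let ?D = "discrete_topology (carrier (fst i))"
    have pr: "continuous_map (big_top V A) ?D (\<lambda>u. u i)"
      unfolding big_top_def by (rule continuous_map_product_projection[OF i])
    have 1: "continuous_map ?P (prod_topology ?D ?D) (\<lambda>p. (fst p i, snd p i))"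
      by (intro continuous_map_pairedI)
         (use continuous_map_compose[OF continuous_map_fst pr]
              continuous_map_compose[OF continuous_map_snd pr] in \<open>auto simp: o_def\<close>)
    have 2: "continuous_map (prod_topology ?D ?D) ?D (\<lambda>(x, y). smul (fst i) x y)"
      using interp_FinS[OF i]
      by (auto simp: prod_topology_discrete_topology[symmetric] FinS_def is_semigroup_def)
    from continuous_map_compose[OF 1 2] show ?thesis
      using i by (simp add: o_def big_product_def)
  qed
  show ?thesis
    unfolding big_top_def[of V A] continuous_map_componentwise
    using comp by (auto simp: big_product_def big_top_def)
qed

lemma Omega_semigroup: "is_semigroup (Omega V A)"
proof -
  let ?X = "big_top V A" and ?W = "{word V A w | w. w \<in> lists A \<and> w \<noteq> []}"
  let ?m = "\<lambda>p. smul (big_product V A) (fst p) (snd p)"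
  have "?m ` (?W \<times> ?W) \<subseteq> ?W"
  proof
    fix p assume "p \<in> ?m ` (?W \<times> ?W)"
    then obtain u v where uv: "u \<in> lists A" "v \<in> lists A" "u \<noteq> []" "v \<noteq> []"
      and p: "p = smul (big_product V A) (word V A u) (word V A v)" by force
    have "p = word V A (u @ v)" "u @ v \<in> lists A" "u @ v \<noteq> []"
      using uv word_append[OF uv] p by simp_all
    then show "p \<in> ?W" by blast
  qed
  then have "?m ` (prod_topology ?X ?X closure_of (?W \<times> ?W)) \<subseteq> ?X closure_of ?W"
    using continuous_map_image_closure_subset[OF smul_continuous] closure_of_mono by blast
  then have "?m ` (carrier (Omega V A) \<times> carrier (Omega V A)) \<subseteq> carrier (Omega V A)"
    by (simp add: closure_of_Times Omega_def)
  then have "smul (Omega V A) x y \<in> carrier (Omega V A)"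
    if "x \<in> carrier (Omega V A)" "y \<in> carrier (Omega V A)" for x y
    using that by (force simp: smul_Omega)
  moreover have "smul (Omega V A) (smul (Omega V A) x y) z = smul (Omega V A) x (smul (Omega V A) y z)"
    if "x \<in> carrier (Omega V A)" "y \<in> carrier (Omega V A)" "z \<in> carrier (Omega V A)" for x y z
    using that big_product_semigroup Omega_subset unfolding is_semigroup_def smul_Omega by blast
  ultimately show ?thesis unfolding is_semigroup_def by blast
qed

lemma Omega_Hausdorff: "Hausdorff_space (Omega_top V A)"
  unfolding Omega_top_def big_top_def
  by (intro Hausdorff_space_subtopology)
     (simp add: Hausdorff_space_product_topology)

lemma Omega_compact: "compact_space (Omega_top V A)"
proof -
  have "compact_space (big_top V A)"
    unfolding big_top_def using interp_FinS
    by (auto simp: compact_space_product_topology compact_space_discrete_topology FinS_def)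
  moreover have "closedin (big_top V A) (carrier (Omega V A))"
    by (simp add: Omega_def)
  ultimately show ?thesis
    unfolding Omega_top_def using closedin_compact_space compact_space_subtopology by blast
qed

lemma words_dense:
  "Omega_top V A closure_of {word V A w | w. w \<in> lists A \<and> w \<noteq> []} = carrier (Omega V A)"
proof -
  have "carrier (Omega V A) \<inter> {word V A w | w. w \<in> lists A \<and> w \<noteq> []}
      = {word V A w | w. w \<in> lists A \<and> w \<noteq> []}"
    using word_in_Omega by auto
  then show ?thesis
    by (simp add: Omega_top_def closure_of_subtopology) (simp add: Omega_def)
qed

text \<open>Continuous homomorphisms on the free pro-\<open>V\<close> semigroup are determined by the letters.\<close>

lemma cont_hom_unique:
  assumes "cont_hom (Omega V A) (Omega_top V A) T Y f" "cont_hom (Omega V A) (Omega_top V A) T Y g"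
    and Y: "Hausdorff_space Y" and fg: "\<And>a. a \<in> A \<Longrightarrow> f (letter V A a) = g (letter V A a)"
    and x: "x \<in> carrier (Omega V A)"
  shows "f x = g x"
proof (rule forall_in_closure_of_eq[where X = "Omega_top V A" and Y = Y and f = f and g = g])
  show "x \<in> Omega_top V A closure_of {word V A w | w. w \<in> lists A \<and> w \<noteq> []}"
    using x words_dense by simp
  show "continuous_map (Omega_top V A) Y f" "continuous_map (Omega_top V A) Y g"
    using assms by (auto simp: cont_hom_def)
  show "Hausdorff_space Y" by (rule Y)
  fix y assume "y \<in> {word V A w | w. w \<in> lists A \<and> w \<noteq> []}"
  then obtain w where w: "w \<in> lists A" "w \<noteq> []" "y = word V A w" by auto
  have word_eq: "word V A w = word_prod (Omega V A) (map (letter V A) w)"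
    unfolding word_def by (rule word_prod_Omega[symmetric])
  have *: "set (map (letter V A) w) \<subseteq> carrier (Omega V A)" "map (letter V A) w \<noteq> []"
    using w letter_in_Omega by auto
  have "h y = word_prod T (map (\<lambda>a. h (letter V A a)) w)" if "sg_hom (Omega V A) T h" for h
    unfolding w(3) word_eq
    using word_prod_hom[OF Omega_semigroup that *(2,1)] by (simp add: o_def)
  then have "f y = word_prod T (map (\<lambda>a. f (letter V A a)) w)"
    "g y = word_prod T (map (\<lambda>a. g (letter V A a)) w)"
    using assms by (auto simp: cont_hom_def)
  moreover have "map (\<lambda>a. f (letter V A a)) w = map (\<lambda>a. g (letter V A a)) w"
    using w fg by (auto simp: in_lists_conv_set)
  ultimately show "f y = g y" by simp
qed

text \<open>Every map from the letters to a member of \<open>V\<close> extends to a continuous homomorphism, namely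
  the projection to the corresponding factor.\<close>

lemma component_cont_hom:
  assumes "S \<in> V" and \<phi>: "\<phi> \<in> A \<rightarrow> carrier S"
  shows "cont_hom (Omega V A) (Omega_top V A) S (discrete_topology (carrier S))
           (\<lambda>w. w (S, restrict \<phi> A))"
    and "\<And>a. a \<in> A \<Longrightarrow> letter V A a (S, restrict \<phi> A) = \<phi> a"
proof -
  have i: "(S, restrict \<phi> A) \<in> interp V A"
    using assms by (auto simp: interp_def)
  have "continuous_map (Omega_top V A) (discrete_topology (carrier S)) (\<lambda>w. w (S, restrict \<phi> A))"
    unfolding Omega_top_def big_top_def
    using continuous_map_from_subtopology[OF continuous_map_product_projection[OF i,
        of "\<lambda>i. discrete_topology (carrier (fst i))"]] by simp
  moreover have "sg_hom (Omega V A) S (\<lambda>w. w (S, restrict \<phi> A))"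
    using i Omega_subset unfolding sg_hom_def smul_Omega
    by (auto simp: big_product_def PiE_iff subset_iff split_beta) fastforce+
  ultimately show "cont_hom (Omega V A) (Omega_top V A) S (discrete_topology (carrier S))
           (\<lambda>w. w (S, restrict \<phi> A))"
    by (simp add: cont_hom_def)
  show "letter V A a (S, restrict \<phi> A) = \<phi> a" if "a \<in> A" for a
    using i that by (simp add: letter_def)
qed

end

text \<open>Existence of the extensions to free pro-\<open>V\<close> semigroups, with an explicit formula.\<close>

definition subst_hom ::
  "nat set \<Rightarrow> nat semigrp set \<Rightarrow> nat set \<Rightarrow> (nat \<Rightarrow> pseudoword) \<Rightarrow> pseudoword \<Rightarrow> pseudoword" where
  "subst_hom A V B \<phi> w = (\<lambda>i\<in>interp V B. w (fst i, \<lambda>a\<in>A. \<phi> a i))"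

context
  fixes V :: "nat semigrp set" and A B :: "nat set" and \<phi> :: "nat \<Rightarrow> pseudoword"
  assumes V: "V \<subseteq> FinS" and \<phi>: "\<phi> \<in> A \<rightarrow> carrier (Omega V B)"
begin

lemma subst_index:
  assumes i: "i \<in> interp V B"
  shows "(fst i, \<lambda>a\<in>A. \<phi> a i) \<in> interp FinS A"
proof -
  have "\<phi> a i \<in> carrier (fst i)" if "a \<in> A" for a
    using \<phi> that Omega_subset[OF V, of B] i by (fastforce simp: big_product_def PiE_iff)
  then show ?thesis using interp_FinS[OF V i] by (auto simp: interp_def)
qed

lemma subst_big_hom: "sg_hom (big_product FinS A) (big_product V B) (subst_hom A V B \<phi>)"
  unfolding sg_hom_def
proof (intro conjI ballI funcsetI)
  fix x assume "x \<in> carrier (big_product FinS A)"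
  then show "subst_hom A V B \<phi> x \<in> carrier (big_product V B)"
    using subst_index by (fastforce simp: subst_hom_def big_product_def PiE_iff)
next
  fix x y assume "x \<in> carrier (big_product FinS A)" "y \<in> carrier (big_product FinS A)"
  show "subst_hom A V B \<phi> (smul (big_product FinS A) x y) =
        smul (big_product V B) (subst_hom A V B \<phi> x) (subst_hom A V B \<phi> y)"
    using subst_index by (auto simp: subst_hom_def big_product_def fun_eq_iff)
qed

lemma subst_big_cont: "continuous_map (big_top FinS A) (big_top V B) (subst_hom A V B \<phi>)"
proof -
  have "continuous_map (big_top FinS A) (discrete_topology (carrier (fst i)))
         (\<lambda>w. subst_hom A V B \<phi> w i)" if i: "i \<in> interp V B" for i
    using continuous_map_product_projection[OF subst_index[OF i],
        of "\<lambda>i. discrete_topology (carrier (fst i))"] i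
    by (simp add: subst_hom_def big_top_def)
  then show ?thesis
    unfolding big_top_def[of V B] continuous_map_componentwise
    by (auto simp: subst_hom_def)
qed

lemma subst_letter: "a \<in> A \<Longrightarrow> subst_hom A V B \<phi> (letter FinS A a) = \<phi> a"
proof -
  assume a: "a \<in> A"
  then have "\<phi> a \<in> extensional (interp V B)"
    using \<phi> Omega_subset[OF V, of B] by (fastforce simp: big_product_def PiE_iff)
  then show ?thesis
    using a subst_index by (auto simp: subst_hom_def letter_def extensional_def fun_eq_iff)
qed

lemma subst_cont_hom:
  "cont_hom (Omega FinS A) (Omega_top FinS A) (Omega V B) (Omega_top V B) (subst_hom A V B \<phi>)"
proof -
  let ?W = "{word FinS A w | w. w \<in> lists A \<and> w \<noteq> []}" and ?f = "subst_hom A V B \<phi>"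
  have "?f (word FinS A w) \<in> carrier (Omega V B)" if w: "w \<in> lists A" "w \<noteq> []" for w
  proof -
    have "set (map (letter FinS A) w) \<subseteq> carrier (big_product FinS A)" "map (letter FinS A) w \<noteq> []"
      using w letter_in_product[OF order_refl] by auto
    from word_prod_hom[OF big_product_semigroup[OF order_refl] subst_big_hom this(2,1)]
    have "?f (word FinS A w) = word_prod (Omega V B) (map (?f \<circ> letter FinS A) w)"
      by (simp add: word_def word_prod_Omega[OF V])
    also have "map (?f \<circ> letter FinS A) w = map \<phi> w"
      using w(1) subst_letter by auto
    finally show ?thesis
      using word_prod_closed[OF Omega_semigroup[OF V], of "map \<phi> w"] w \<phi> by auto
  qed
  then have "?f ` ?W \<subseteq> carrier (Omega V B)" by blast
  moreover have "?f ` carrier (Omega FinS A) \<subseteq> big_top V B closure_of (?f ` ?W)"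
    unfolding Omega_def using continuous_map_image_closure_subset[OF subst_big_cont] by simp
  moreover have "closedin (big_top V B) (carrier (Omega V B))" by (simp add: Omega_def)
  ultimately have im: "?f ` carrier (Omega FinS A) \<subseteq> carrier (Omega V B)"
    by (meson closure_of_minimal order_trans)
  have "sg_hom (Omega FinS A) (Omega V B) ?f"
    using im subst_big_hom Omega_subset[OF order_refl, of A]
    unfolding sg_hom_def smul_Omega[OF V] smul_Omega[OF order_refl]
    by (auto simp: subset_iff)
  moreover have "continuous_map (Omega_top FinS A) (Omega_top V B) ?f"
    unfolding Omega_top_def
    by (rule continuous_map_into_subtopology[OF continuous_map_from_subtopology[OF subst_big_cont]])
       (use im in auto)
  ultimately show ?thesis by (simp add: cont_hom_def)
qed

lemma hat_eq:
  "hat A (Omega V B) (Omega_top V B) \<phi> = restrict (subst_hom A V B \<phi>) (carrier (Omega FinS A))"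
  (is "_ = ?g")
  unfolding hat_def
proof (rule the_equality)
  have g: "?g x = subst_hom A V B \<phi> x" if "x \<in> carrier (Omega FinS A)" for x
    using that by simp
  have "continuous_map (Omega_top FinS A) (Omega_top V B) ?g"
  proof (rule continuous_map_eq)
    show "continuous_map (Omega_top FinS A) (Omega_top V B) (subst_hom A V B \<phi>)"
      using subst_cont_hom by (simp add: cont_hom_def)
    show "subst_hom A V B \<phi> x = ?g x" if "x \<in> topspace (Omega_top FinS A)" for x
      using that g unfolding topspace_Omega_top[OF order_refl] by simp
  qed
  moreover have "sg_hom (Omega FinS A) (Omega V B) ?g"
    unfolding sg_hom_def
  proof (intro conjI ballI funcsetI)
    have h: "sg_hom (Omega FinS A) (Omega V B) (subst_hom A V B \<phi>)"
      using subst_cont_hom by (simp add: cont_hom_def)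
    fix x assume x: "x \<in> carrier (Omega FinS A)"
    show "?g x \<in> carrier (Omega V B)"
      unfolding g[OF x] using h x by (auto simp: sg_hom_def)
    fix y assume y: "y \<in> carrier (Omega FinS A)"
    have xy: "smul (Omega FinS A) x y \<in> carrier (Omega FinS A)"
      using Omega_semigroup[OF order_refl, of A] x y by (simp add: is_semigroup_def)
    show "?g (smul (Omega FinS A) x y) = smul (Omega V B) (?g x) (?g y)"
      unfolding g[OF x] g[OF y] g[OF xy] using h x y by (simp add: sg_hom_def)
  qed
  moreover have "\<forall>a\<in>A. ?g (letter FinS A a) = \<phi> a"
    using subst_letter letter_in_Omega[OF order_refl] by simp
  ultimately show *: "?g \<in> extensional (carrier (Omega FinS A)) \<and>
      cont_hom (Omega FinS A) (Omega_top FinS A) (Omega V B) (Omega_top V B) ?g \<and>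
      (\<forall>a\<in>A. ?g (letter FinS A a) = \<phi> a)"
    by (simp only: restrict_extensional cont_hom_def simp_thms)
  fix f assume f: "f \<in> extensional (carrier (Omega FinS A)) \<and>
      cont_hom (Omega FinS A) (Omega_top FinS A) (Omega V B) (Omega_top V B) f \<and>
      (\<forall>a\<in>A. f (letter FinS A a) = \<phi> a)"
  show "f = ?g"
  proof (rule extensionalityI)
    show "f \<in> extensional (carrier (Omega FinS A))" using f by simp
    show "?g \<in> extensional (carrier (Omega FinS A))" by (rule restrict_extensional)
    show "f x = ?g x" if "x \<in> carrier (Omega FinS A)" for x
    proof (rule cont_hom_unique[OF order_refl _ _ Omega_Hausdorff[OF V] _ that])
      show "cont_hom (Omega FinS A) (Omega_top FinS A) (Omega V B) (Omega_top V B) f"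
        using f by blast
      show "cont_hom (Omega FinS A) (Omega_top FinS A) (Omega V B) (Omega_top V B) ?g"
        using * by blast
      show "f (letter FinS A a) = ?g (letter FinS A a)" if "a \<in> A" for a
        using f * that by metis
    qed
  qed
qed

end

lemma psi_eq:
  assumes V: "V \<subseteq> FinS" and w: "w \<in> carrier (Omega FinS A)"
  shows "psi V A w = restrict w (interp V A)"
proof -
  have "letter V A \<in> A \<rightarrow> carrier (Omega V A)" using letter_in_Omega[OF V] by auto
  then have "psi V A w = subst_hom A V A (letter V A) w"
    unfolding psi_def using w by (simp add: hat_eq[OF V])
  also have "\<dots> = restrict w (interp V A)"
    unfolding subst_hom_def
  proof (rule restrict_ext)
    fix i assume i: "i \<in> interp V A"
    then have "(\<lambda>a\<in>A. letter V A a i) = snd i"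
      by (auto simp: letter_def interp_def PiE_iff extensional_def fun_eq_iff)
    then show "w (fst i, \<lambda>a\<in>A. letter V A a i) = w i" by simp
  qed
  finally show ?thesis .
qed

end

theory Submission
  imports Defs "HOL-Number_Theory.Cong" "HOL-Algebra.Multiplicative_Group"
begin

no_notation Congruence.eq_closure_of (\<open>closure'_of\<index>\<close>)

text \<open>Write \<open>D\<close> for the set of all \<open>n\<close> such that \<open>V\<close> contains the cyclic group of order \<open>n\<close>.  A pseudovariety
  of abelian groups is determined by \<open>D\<close>, and a pseudoword is determined modulo \<open>V\<close> by the exponents
  of its letters, which are compatible families of residues modulo the members of \<open>D\<close>.  A system
  with rational constraints thus becomes a linear system over the ring of these families, because
  rational languages have semilinear commutative images.  Call a family rational if it is given by a
  fraction, except for an arbitrary residue modulo one member of \<open>D\<close>.  The rational families form a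
  subring that is pure, so a linear system over this subring that has a solution has one within it.
  Equality of rational families is decidable if \<open>D\<close> is.  The operations with rational exponents that
  lie in closures of rational languages therefore yield a suitable signature.

  Conversely, \<open>n \<notin> D\<close> holds if and only if \<open>x\<^sup>n = a\<^sup>d\<close> has a solution modulo \<open>V\<close> for some
  \<open>0 < d < n\<close>.  Reducibility and the word problem turn this into a search over terms, and the enumeration
  of \<open>V\<close> provides the search for \<open>n \<in> D\<close>.\<close>

section \<open>Computable functions\<close>

text \<open>Constraints and equations live in different places: \<open>Cl\<close> is taken in the
  free profinite semigroup, whereas \<open>V\<close> sees only exponents. Rational exponents alone
  therefore do not give a solution over the signature; its elements must also lie in the prescribed
  closures. Hence the signature selects, by choice, one operation for each rational language and
  each list of codes, and only the codes are ever computed with. The exceptional residue in a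
  rational family is forced by the primes whose powers in \<open>D\<close> are bounded: such a prime
  is neither invertible nor cancellable, so fractions do not describe what happens there. With the
  residue allowed, an element is rational exactly if some positive integer multiple of it is an
  integer, and purity follows. Purity enters through the common denominator \<open>n\<close> of a
  linear system. Multiplied by \<open>n\<close>, the coefficients become integers, and a retraction
  onto the rational families respects the system. The remaining error is annihilated by
  \<open>n\<close>, so it sits at the bounded primes, and it vanishes if the retraction agrees with
  the given solution modulo a suitable member of \<open>D\<close>.\<close>

definition computable :: "nat \<Rightarrow> (nat list \<Rightarrow> nat) \<Rightarrow> bool" where
  "computable k f \<longleftrightarrow> (\<exists>g. recursive_fun k g \<and> (\<forall>xs. length xs = k \<longrightarrow> g xs = f xs))"

definition decidable :: "nat \<Rightarrow> (nat list \<Rightarrow> bool) \<Rightarrow> bool" where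
  "decidable k P \<longleftrightarrow> computable k (\<lambda>xs. of_bool (P xs))"

lemma computable_recursive: "recursive_fun k f \<Longrightarrow> computable k f"
  by (auto simp: computable_def)

text \<open>\<open>recursive_fun\<close> is sensitive to the values of a HOL function on lists of
  the wrong length. \<open>computable\<close> forgets these, so a function may be replaced by any
  other that agrees with it on lists of length \<open>k\<close>.\<close>

lemma computable_cong:
  "computable k f \<Longrightarrow> (\<And>xs. length xs = k \<Longrightarrow> f xs = g xs) \<Longrightarrow> computable k g"
  by (auto simp: computable_def)

lemma decidable_cong:
  "decidable k P \<Longrightarrow> (\<And>xs. length xs = k \<Longrightarrow> P xs = Q xs) \<Longrightarrow> decidable k Q"
  unfolding decidable_def by (erule computable_cong) simp

lemma computable_compose:
  assumes f: "computable (length gs) f" and gs: "\<forall>g\<in>set gs. computable k g"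
  shows "computable k (\<lambda>xs. f (map (\<lambda>g. g xs) gs))"
proof -
  obtain f' where f': "recursive_fun (length gs) f'"
    "\<And>xs. length xs = length gs \<Longrightarrow> f' xs = f xs"
    using f by (auto simp: computable_def)
  have "\<forall>g\<in>set gs. \<exists>h. recursive_fun k h \<and> (\<forall>xs. length xs = k \<longrightarrow> h xs = g xs)"
    using gs by (auto simp: computable_def)
  then obtain H where H: "\<And>g. g \<in> set gs \<Longrightarrow> recursive_fun k (H g)"
    "\<And>g xs. g \<in> set gs \<Longrightarrow> length xs = k \<Longrightarrow> H g xs = g xs"
    by metis
  have "recursive_fun k (\<lambda>xs. f' (map (\<lambda>h. h xs) (map H gs)))"
    using f'(1) H(1) by (intro recursive_fun.comp) auto
  moreover have "f' (map (\<lambda>h. h xs) (map H gs)) = f (map (\<lambda>g. g xs) gs)" if "length xs = k" for xs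
  proof -
    have "map (\<lambda>h. h xs) (map H gs) = map (\<lambda>g. g xs) gs" using H(2) that by simp
    then show ?thesis using f'(2)[of "map (\<lambda>h. h xs) (map H gs)"] by (simp only: length_map)
  qed
  ultimately show ?thesis unfolding computable_def by blast
qed

lemma computable_comp1:
  "computable 1 f \<Longrightarrow> computable k g \<Longrightarrow> computable k (\<lambda>xs. f [g xs])"
  using computable_compose[of "[g]" f k] by simp

lemma computable_comp2:
  "computable 2 f \<Longrightarrow> computable k g \<Longrightarrow> computable k h \<Longrightarrow> computable k (\<lambda>xs. f [g xs, h xs])"
  using computable_compose[of "[g, h]" f k] by (simp add: numeral_2_eq_2)

named_theorems comp_intros

lemma computable_nth [comp_intros]: "i < k \<Longrightarrow> computable k (\<lambda>xs. xs ! i)"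
  by (intro computable_recursive recursive_fun.proj)

lemma computable_hd [comp_intros]: "0 < k \<Longrightarrow> computable k hd"
  by (rule computable_cong[OF computable_nth[of 0]]) (auto simp: hd_conv_nth)

lemma computable_tl [comp_intros]:
  assumes "computable k f" shows "computable (Suc k) (\<lambda>ys. f (tl ys))"
proof -
  let ?gs = "map (\<lambda>i ys. ys ! Suc i) [0..<k] :: (nat list \<Rightarrow> nat) list"
  have "computable (Suc k) (\<lambda>ys. f (map (\<lambda>g. g ys) ?gs))"
    using assms by (intro computable_compose) (auto intro: computable_nth)
  then show ?thesis
  proof (rule computable_cong)
    fix ys :: "nat list" assume "length ys = Suc k"
    then have "map (\<lambda>g. g ys) ?gs = tl ys"
      by (intro nth_equalityI) (auto simp: nth_tl)
    then show "f (map (\<lambda>g. g ys) ?gs) = f (tl ys)" by simp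
  qed
qed

lemma computable_cons:
  assumes "computable (Suc k) f" "computable k g"
  shows "computable k (\<lambda>xs. f (g xs # xs))"
proof -
  let ?gs = "g # map (\<lambda>i ys. ys ! i) [0..<k]"
  have "computable k (\<lambda>ys. f (map (\<lambda>g. g ys) ?gs))"
    using assms by (intro computable_compose) (auto intro: computable_nth)
  then show ?thesis
  proof (rule computable_cong)
    fix ys :: "nat list" assume "length ys = k"
    then have "map (\<lambda>g. g ys) ?gs = g ys # ys"
      by (auto intro!: nth_equalityI)
    then show "f (map (\<lambda>g. g ys) ?gs) = f (g ys # ys)" by simp
  qed
qed

text \<open>In a primitive recursion the accumulator sits between the counter and the context. The
  body of a bounded quantifier does not depend on the accumulator, and dropping it makes the body
  fit \<open>computable_rec\<close>.\<close>

lemma computable_skip: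
  assumes "computable (Suc k) f"
  shows "computable (Suc (Suc k)) (\<lambda>ys. f (hd ys # tl (tl ys)))"
proof -
  define gs :: "(nat list \<Rightarrow> nat) list"
    where "gs = hd # map (\<lambda>i ys. ys ! Suc (Suc i)) [0..<k]"
  have "computable (Suc (Suc k)) (\<lambda>ys. f (map (\<lambda>g. g ys) gs))"
    using assms by (intro computable_compose) (auto simp: gs_def intro: computable_nth computable_hd)
  moreover have "map (\<lambda>g. g ys) gs = hd ys # tl (tl ys)" if "length ys = Suc (Suc k)" for ys
    using that by (auto simp: gs_def nth_tl intro!: nth_equalityI)
  ultimately show ?thesis by (rule computable_cong[OF _ arg_cong])
qed

text \<open>Bound variables are pushed onto the front of the argument list: the step sees the
  counter, the accumulator and then the context. The rules for bounded quantifiers and minimisation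
  have the same \<open>hd\<close>/\<open>tl\<close> shape, so nested definitions are handled by
  repeated introduction.\<close>

lemma computable_rec [comp_intros]:
  assumes a: "computable k a"
    and s: "computable (Suc (Suc k)) (\<lambda>ys. s (hd ys) (hd (tl ys)) (tl (tl ys)))"
    and n: "computable k n"
  shows "computable k (\<lambda>xs. rec_nat (a xs) (\<lambda>j r. s j r xs) (n xs))"
proof -
  obtain a' where a': "recursive_fun k a'" "\<And>xs. length xs = k \<Longrightarrow> a' xs = a xs"
    using a by (auto simp: computable_def)
  obtain s' where s': "recursive_fun (Suc (Suc k)) s'"
    "\<And>ys. length ys = Suc (Suc k) \<Longrightarrow> s' ys = s (hd ys) (hd (tl ys)) (tl (tl ys))"
    using s by (auto simp: computable_def)
  let ?h = "\<lambda>ys. rec_nat (a' (tl ys)) (\<lambda>n r. s' (n # r # tl ys)) (hd ys)"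
  have "computable (Suc k) ?h"
    by (intro computable_recursive recursive_fun.prim_rec a' s')
  then have "computable k (\<lambda>xs. ?h (n xs # xs))" using n by (rule computable_cons)
  then show ?thesis
  proof (rule computable_cong)
    fix xs :: "nat list" assume xs: "length xs = k"
    have "rec_nat (a' xs) (\<lambda>n r. s' (n # r # xs)) m = rec_nat (a xs) (\<lambda>j r. s j r xs) m" for m
      using xs by (induction m) (simp_all add: a' s')
    then show "?h (n xs # xs) = rec_nat (a xs) (\<lambda>j r. s j r xs) (n xs)" by simp
  qed
qed

lemma computable_Suc [comp_intros]: "computable k f \<Longrightarrow> computable k (\<lambda>xs. Suc (f xs))"
  using computable_comp1[OF computable_recursive[OF recursive_fun.succ]] by simp

lemma computable_const [comp_intros]: "computable k (\<lambda>_. c)"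
proof (induction c)
  case 0
  show ?case by (intro computable_recursive recursive_fun.zero)
qed (rule computable_Suc)

lemma computable_add [comp_intros]:
  assumes "computable k f" "computable k g" shows "computable k (\<lambda>xs. f xs + g xs)"
proof -
  have "computable k (\<lambda>xs. rec_nat (g xs) (\<lambda>j r. Suc r) (f xs))"
    by (intro comp_intros assms) simp
  moreover have "rec_nat a (\<lambda>j r. Suc r) m = m + a" for a m by (induction m) auto
  ultimately show ?thesis by simp
qed

lemma computable_mult [comp_intros]:
  assumes "computable k f" "computable k g" shows "computable k (\<lambda>xs. f xs * g xs)"
proof -
  have "computable k (\<lambda>xs. rec_nat 0 (\<lambda>j r. r + g xs) (f xs))"
    by (intro comp_intros assms) simp
  moreover have "rec_nat 0 (\<lambda>j r. r + a) m = m * a" for a m :: nat by (induction m) auto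
  ultimately show ?thesis by simp
qed

lemma computable_diff [comp_intros]:
  assumes "computable k f" "computable k g" shows "computable k (\<lambda>xs. f xs - g xs)"
proof -
  \<comment> \<open>A recursion that returns its counter is the truncated predecessor; iterating it
    gives subtraction.\<close>
  have pred: "rec_nat 0 (\<lambda>j r. j) m = m - 1" for m by (induction m) auto
  have "computable k (\<lambda>xs. rec_nat (f xs) (\<lambda>j r. rec_nat 0 (\<lambda>j r. j) r) (g xs))"
    by (intro comp_intros assms) simp_all
  moreover have "rec_nat a (\<lambda>j r. r - 1) m = a - m" for a m :: nat by (induction m) auto
  ultimately show ?thesis by (simp add: pred)
qed

lemma decidable_const [comp_intros]: "decidable k (\<lambda>_. b)"
  unfolding decidable_def by (rule computable_const)

lemma decidable_tl [comp_intros]: "decidable k P \<Longrightarrow> decidable (Suc k) (\<lambda>ys. P (tl ys))"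
  unfolding decidable_def by (rule computable_tl)

lemma computable_of_bool [comp_intros]: "decidable k P \<Longrightarrow> computable k (\<lambda>xs. of_bool (P xs))"
  by (simp add: decidable_def)

lemma decidableI:
  "computable k f \<Longrightarrow> (\<And>xs. f xs = of_bool (P xs)) \<Longrightarrow> decidable k P"
  unfolding decidable_def by (erule computable_cong)

lemma decidable_eq0: "computable k f \<Longrightarrow> decidable k (\<lambda>xs. f xs = 0)"
  by (rule decidableI[OF computable_diff[OF computable_const[of k 1], of f]]) auto

lemma decidable_not [comp_intros]: "decidable k P \<Longrightarrow> decidable k (\<lambda>xs. \<not> P xs)"
  by (rule decidableI[OF computable_diff[OF computable_const[of k 1] computable_of_bool[of k P]]]) auto

lemma decidable_conj [comp_intros]:
  "decidable k P \<Longrightarrow> decidable k Q \<Longrightarrow> decidable k (\<lambda>xs. P xs \<and> Q xs)"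
  by (rule decidableI[OF computable_mult[OF computable_of_bool[of k P] computable_of_bool[of k Q]]]) auto

lemma decidable_disj [comp_intros]:
  assumes "decidable k P" "decidable k Q" shows "decidable k (\<lambda>xs. P xs \<or> Q xs)"
  using decidable_not[OF decidable_conj[OF assms[THEN decidable_not]]] by simp

lemma decidable_imp [comp_intros]:
  assumes "decidable k P" "decidable k Q" shows "decidable k (\<lambda>xs. P xs \<longrightarrow> Q xs)"
  using decidable_disj[OF decidable_not assms(2), OF assms(1)] by simp

lemma decidable_le [comp_intros]:
  assumes "computable k f" "computable k g" shows "decidable k (\<lambda>xs. f xs \<le> g xs)"
  using decidable_eq0[OF computable_diff[OF assms]] by simp

lemma decidable_less [comp_intros]:
  assumes "computable k f" "computable k g" shows "decidable k (\<lambda>xs. f xs < g xs)"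
  using decidable_not[OF decidable_le[OF assms(2,1)]] by (simp add: not_le)

lemma decidable_eq [comp_intros]:
  assumes "computable k f" "computable k g" shows "decidable k (\<lambda>xs. f xs = g xs)"
  by (rule decidable_cong[OF decidable_conj[OF decidable_le[OF assms] decidable_le[OF assms(2,1)]]])
     auto

lemma computable_if [comp_intros]:
  assumes "decidable k P" "computable k f" "computable k g"
  shows "computable k (\<lambda>xs. if P xs then f xs else g xs)"
proof (rule computable_cong)
  show "computable k (\<lambda>xs. of_bool (P xs) * f xs + of_bool (\<not> P xs) * g xs)"
    by (intro comp_intros assms)
qed auto

lemma decidable_all_less [comp_intros]:
  assumes "decidable (Suc k) (\<lambda>ys. P (hd ys) (tl ys))" "computable k n"
  shows "decidable k (\<lambda>xs. \<forall>i<n xs. P i xs)"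
proof -
  have P: "computable (Suc (Suc k)) (\<lambda>ys. of_bool (P (hd ys) (tl (tl ys))))"
    using computable_skip[OF assms(1)[unfolded decidable_def]] by simp
  have "computable k (\<lambda>xs. rec_nat 1 (\<lambda>j r. of_bool (P j xs) * r) (n xs))"
    by (rule computable_rec[OF computable_const computable_mult[OF P] assms(2)])
       (intro comp_intros, simp)
  moreover have "rec_nat 1 (\<lambda>j r. of_bool (Q j) * r) m = (of_bool (\<forall>i<m. Q i) :: nat)" for Q m
    by (induction m) (auto simp: less_Suc_eq)
  ultimately show ?thesis by (simp add: decidable_def)
qed

lemma decidable_ex_less [comp_intros]:
  assumes "decidable (Suc k) (\<lambda>ys. P (hd ys) (tl ys))" "computable k n"
  shows "decidable k (\<lambda>xs. \<exists>i<n xs. P i xs)"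
  using decidable_not[OF decidable_all_less[OF decidable_not[OF assms(1)] assms(2)]] by simp

text \<open>Minimisation is available only for searches that always succeed. For this reason many of
  the searches below carry a disjunct that makes them stop on meaningless input.\<close>

lemma computable_Least:
  assumes P: "decidable (Suc k) (\<lambda>ys. P (hd ys) (tl ys))"
    and ex: "\<And>xs. length xs = k \<Longrightarrow> \<exists>y. P y xs"
  shows "computable k (\<lambda>xs. LEAST y. P y xs)"
proof -
  obtain f where f: "recursive_fun (Suc k) f"
    "\<And>ys. length ys = Suc k \<Longrightarrow> f ys = of_bool (\<not> P (hd ys) (tl ys))"
    using decidable_not[OF P] by (auto simp: decidable_def computable_def)
  then have "recursive_fun k (\<lambda>xs. LEAST y. f (y # xs) = 0)"
    using ex by (intro recursive_fun.minimize) auto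
  then show ?thesis
    by (rule computable_cong[OF computable_recursive]) (simp add: f(2))
qed

lemma decidable_dvd [comp_intros]:
  assumes "computable k f" "computable k g" shows "decidable k (\<lambda>xs. f xs dvd g xs)"
proof -
  have "decidable k (\<lambda>xs. \<exists>i<Suc (g xs). g xs = f xs * i)"
    by (intro comp_intros assms) simp_all
  moreover have "(\<exists>i<Suc b. b = a * i) \<longleftrightarrow> a dvd b" for a b :: nat
  proof
    assume "a dvd b"
    then obtain i where i: "b = a * i" ..
    show "\<exists>i<Suc b. b = a * i"
    proof (cases "b = 0")
      case True then show ?thesis by (intro exI[of _ 0]) simp
    next
      case False then show ?thesis using i by (intro exI[of _ i]) (cases a, auto)
    qed
  qed auto
  ultimately show ?thesis by simp
qed

lemma computable_div [comp_intros]: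
  assumes "computable k f" "computable k g" shows "computable k (\<lambda>xs. f xs div g xs)"
proof -
  \<comment> \<open>The first disjunct keeps the search total; for a zero divisor it yields 0, which
    is the value of \<open>a div 0\<close> in HOL.\<close>
  have "computable k (\<lambda>xs. LEAST q. g xs = 0 \<or> f xs < g xs * Suc q)"
  proof (rule computable_Least)
    show "decidable (Suc k) (\<lambda>ys. g (tl ys) = 0 \<or> f (tl ys) < g (tl ys) * Suc (hd ys))"
      by (intro comp_intros assms) simp
    show "\<exists>q. g xs = 0 \<or> f xs < g xs * Suc q" for xs
      by (rule exI[of _ "f xs"]) (cases "g xs"; simp)
  qed
  moreover have "(LEAST q. b = 0 \<or> a < b * Suc q) = a div b" for a b :: nat
  proof (cases "b = 0")
    case False
    then show ?thesis
    proof (intro Least_equality)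
      show "b = 0 \<or> a < b * Suc (a div b)"
        using False by (metis dividend_less_times_div mult_Suc_right neq0_conv)
      fix q assume "b = 0 \<or> a < b * Suc q"
      then have "a div b < Suc q" using False by (simp add: less_mult_imp_div_less mult.commute)
      then show "a div b \<le> q" by simp
    qed
  qed simp
  ultimately show ?thesis by simp
qed

lemma computable_mod [comp_intros]:
  assumes "computable k f" "computable k g" shows "computable k (\<lambda>xs. f xs mod g xs)"
  using computable_diff[OF assms(1) computable_mult[OF computable_div[OF assms] assms(2)]]
  by (simp add: minus_div_mult_eq_mod)

section \<open>Pairs and lists coded as numbers\<close>

lemma computable_prod_encode [comp_intros]:
  assumes "computable k f" "computable k g"
  shows "computable k (\<lambda>xs. prod_encode (f xs, g xs))"
  unfolding prod_encode_def triangle_def prod.case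
  by (intro comp_intros assms)

definition pfst :: "nat \<Rightarrow> nat" where "pfst z = fst (prod_decode z)"
definition psnd :: "nat \<Rightarrow> nat" where "psnd z = snd (prod_decode z)"

lemma pfst_encode [simp]: "pfst (prod_encode (x, y)) = x"
  and psnd_encode [simp]: "psnd (prod_encode (x, y)) = y"
  and pair_encode [simp]: "prod_encode (pfst z, psnd z) = z"
  by (simp_all add: pfst_def psnd_def)

lemma psnd_le: "psnd z \<le> z"
  using le_prod_encode_2[of "psnd z" "pfst z"] by simp

lemma computable_pfst [comp_intros]:
  assumes "computable k f" shows "computable k (\<lambda>xs. pfst (f xs))"
proof -
  have "computable k (\<lambda>xs. LEAST x. \<exists>y<Suc (f xs). prod_encode (x, y) = f xs)"
  proof (rule computable_Least)
    show "decidable (Suc k) (\<lambda>ys. \<exists>y<Suc (f (tl ys)). prod_encode (hd ys, y) = f (tl ys))"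
      by (intro comp_intros assms) simp_all
    show "\<exists>x. \<exists>y<Suc (f xs). prod_encode (x, y) = f xs" for xs
      by (intro exI[of _ "pfst (f xs)"] exI[of _ "psnd (f xs)"]) (simp add: psnd_le less_Suc_eq_le)
  qed
  moreover have "(LEAST x. \<exists>y<Suc z. prod_encode (x, y) = z) = pfst z" for z
    by (rule Least_equality)
       (auto intro!: exI[of _ "psnd z"] simp: psnd_le less_Suc_eq_le)
  ultimately show ?thesis by simp
qed

lemma computable_psnd [comp_intros]:
  assumes "computable k f" shows "computable k (\<lambda>xs. psnd (f xs))"
proof -
  have "computable k (\<lambda>xs. LEAST y. prod_encode (pfst (f xs), y) = f xs)"
  proof (rule computable_Least)
    show "decidable (Suc k) (\<lambda>ys. prod_encode (pfst (f (tl ys)), hd ys) = f (tl ys))"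
      by (intro comp_intros assms) simp_all
    show "\<exists>y. prod_encode (pfst (f xs), y) = f xs" for xs
      by (intro exI[of _ "psnd (f xs)"]) simp
  qed
  moreover have "(LEAST y. prod_encode (pfst z, y) = z) = psnd z" for z
    by (rule Least_equality) (simp, metis psnd_encode order_refl)
  ultimately show ?thesis by simp
qed

text \<open>These operations mirror \<open>list_encode\<close>, where 0 is the empty list and a
  nonempty list is the successor of a pair. The tail of 0 is 0, so dropping past the end is stable
  and the length is the number of drops until 0.\<close>

definition consc :: "nat \<Rightarrow> nat \<Rightarrow> nat" where "consc x l = Suc (prod_encode (x, l))"
definition hdc :: "nat \<Rightarrow> nat" where "hdc l = pfst (l - 1)"
definition tlc :: "nat \<Rightarrow> nat" where "tlc l = psnd (l - 1)"
definition dropc :: "nat \<Rightarrow> nat \<Rightarrow> nat" where "dropc i l = rec_nat l (\<lambda>_ r. tlc r) i"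
definition nthc :: "nat \<Rightarrow> nat \<Rightarrow> nat" where "nthc l i = hdc (dropc i l)"
definition lenc :: "nat \<Rightarrow> nat" where "lenc l = (LEAST n. dropc n l = 0)"

lemma list_encode_consc: "list_encode (x # xs) = consc x (list_encode xs)"
  by (simp add: consc_def)

lemma hdc_consc [simp]: "hdc (consc x l) = x"
  and tlc_consc [simp]: "tlc (consc x l) = l"
  and tlc_0 [simp]: "tlc 0 = 0"
  using psnd_le[of 0] by (simp_all add: hdc_def tlc_def consc_def)

lemma dropc_Suc: "dropc (Suc i) l = dropc i (tlc l)"
  by (induction i) (simp_all add: dropc_def)

lemma dropc_0 [simp]: "dropc 0 l = l"
  by (simp add: dropc_def)

lemma nthc_consc [simp]: "nthc (consc x l) 0 = x" "nthc (consc x l) (Suc i) = nthc l i"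
  by (simp_all add: nthc_def dropc_Suc)

lemma nthc_encode: "i < length xs \<Longrightarrow> nthc (list_encode xs) i = xs ! i"
proof (induction xs arbitrary: i)
  case (Cons x xs)
  then show ?case by (cases i) (simp_all only: list_encode_consc nthc_consc length_Cons Suc_less_eq nth_Cons_0 nth_Cons_Suc)
qed simp

lemma dropc_encode: "dropc i (list_encode xs) = list_encode (drop i xs)"
proof (induction xs arbitrary: i)
  case Nil
  show ?case by (induction i) (simp_all add: dropc_Suc)
next
  case (Cons x xs)
  then show ?case by (cases i) (simp_all only: list_encode_consc dropc_Suc tlc_consc drop_Suc_Cons dropc_0 drop_0)
qed

lemma list_encode_0_iff: "list_encode xs = 0 \<longleftrightarrow> xs = []"
  by (cases xs) simp_all

lemma lenc_encode: "lenc (list_encode xs) = length xs"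
  unfolding lenc_def dropc_encode list_encode_0_iff
  by (rule Least_equality) simp_all

lemma nthc_decode: "i < length (list_decode l) \<Longrightarrow> nthc l i = list_decode l ! i"
  using nthc_encode[of i "list_decode l"] by simp

lemma lenc_decode: "lenc l = length (list_decode l)"
  using lenc_encode[of "list_decode l"] by simp

lemma computable_consc [comp_intros]:
  "computable k f \<Longrightarrow> computable k g \<Longrightarrow> computable k (\<lambda>xs. consc (f xs) (g xs))"
  unfolding consc_def by (intro comp_intros)

lemma computable_tlc [comp_intros]: "computable k f \<Longrightarrow> computable k (\<lambda>xs. tlc (f xs))"
  unfolding tlc_def by (intro comp_intros)

lemma computable_dropc [comp_intros]:
  "computable k f \<Longrightarrow> computable k g \<Longrightarrow> computable k (\<lambda>xs. dropc (f xs) (g xs))"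
  unfolding dropc_def by (intro comp_intros) simp_all

lemma computable_nthc [comp_intros]:
  "computable k f \<Longrightarrow> computable k g \<Longrightarrow> computable k (\<lambda>xs. nthc (f xs) (g xs))"
  unfolding nthc_def hdc_def by (intro comp_intros)

lemma computable_lenc [comp_intros]:
  assumes "computable k f" shows "computable k (\<lambda>xs. lenc (f xs))"
  unfolding lenc_def
proof (rule computable_Least)
  show "decidable (Suc k) (\<lambda>ys. dropc (hd ys) (f (tl ys)) = 0)"
    by (intro comp_intros assms) simp_all
  have "dropc (length (list_decode l)) l = 0" for l
    using dropc_encode[of "length (list_decode l)" "list_decode l"] by simp
  then show "\<exists>n. dropc n (f xs) = 0" for xs by blast
qed

text \<open>The list of all earlier values is carried along as a single number, latest value first,
  which reduces recursion on all smaller arguments to primitive recursion. The value at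
  \<open>c'\<close> therefore stands at position \<open>c - Suc c'\<close> of the history for
  \<open>c\<close>.\<close>

lemma course_of_values:
  assumes F: "computable 2 F"
  obtains v where "computable 1 (\<lambda>xs. v (hd xs))"
    and "\<And>c. \<exists>h. v c = F [h, c] \<and> (\<forall>c'<c. nthc h (c - Suc c') = v c')"
proof
  define H where "H c = rec_nat 0 (\<lambda>n r. consc (F [r, n]) r) c" for c
  define v where "v c = F [H c, c]" for c
  have "computable (Suc (Suc 1)) (\<lambda>ys. F [hd (tl ys), hd ys])"
    by (intro computable_comp2[OF F] comp_intros) simp_all
  then have "computable 1 (\<lambda>xs. H (hd xs))"
    unfolding H_def by (intro comp_intros) simp_all
  then show "computable 1 (\<lambda>xs. v (hd xs))"
    unfolding v_def by (intro computable_comp2[OF F] comp_intros) simp_all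
  have "\<forall>c'<c. nthc (H c) (c - Suc c') = v c'" for c
  proof (induction c)
    case (Suc c)
    have H: "H (Suc c) = consc (v c) (H c)" by (simp add: H_def v_def)
    show ?case
    proof (intro allI impI)
      fix c' assume "c' < Suc c"
      show "nthc (H (Suc c)) (Suc c - Suc c') = v c'"
      proof (cases "c' = c")
        case False
        with \<open>c' < Suc c\<close> have "c' < c" by simp
        then have "Suc c - Suc c' = Suc (c - Suc c')" by simp
        then show ?thesis using Suc \<open>c' < c\<close> H by simp
      qed (simp add: H)
    qed
  qed simp
  then show "\<exists>h. v c = F [h, c] \<and> (\<forall>c'<c. nthc h (c - Suc c') = v c')" for c
    by (auto simp: v_def)
qed

section \<open>Codes of terms and tables\<close>

lemma mem_less_list_encode: "x \<in> set xs \<Longrightarrow> x < list_encode xs"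
proof (induction xs)
  case (Cons y xs)
  then show ?case
    using le_prod_encode_1[of y "list_encode xs"] le_prod_encode_2[of "list_encode xs" y] by auto
qed simp

text \<open>\<open>sum_encode\<close> gives the even numbers to the left summand and the odd ones to
  the right, so parity tells variables from applications.\<close>

definition appc :: "nat \<Rightarrow> nat \<Rightarrow> nat" where "appc i l = Suc (2 * prod_encode (i, l))"

lemma term_code_Var: "term_code (Var x) = 2 * x"
  and term_code_App: "term_code (App i ts) = appc i (list_encode (map term_code ts))"
  by (simp_all add: sum_encode_def appc_def)

declare term_code.simps [simp del]

lemma appc_arg_less: "t \<in> set ts \<Longrightarrow> term_code t < term_code (App i ts)"
  using mem_less_list_encode[of "term_code t" "map term_code ts"]
    le_prod_encode_2[of "list_encode (map term_code ts)" i]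
  unfolding term_code_App appc_def by simp

lemma computable_appc [comp_intros]:
  "computable k f \<Longrightarrow> computable k g \<Longrightarrow> computable k (\<lambda>xs. appc (f xs) (g xs))"
  unfolding appc_def by (intro comp_intros)

text \<open>A search over all numbers is thus a search over all terms, and a number that has been
  found can be turned back into a term.\<close>

lemma term_code_surj: "\<exists>t. term_code t = c"
proof (induction c rule: less_induct)
  case (less c)
  show ?case
  proof (cases "even c")
    case True
    then obtain x where "c = 2 * x" ..
    then show ?thesis using term_code_Var by blast
  next
    case False
    then obtain y where y: "c = Suc (2 * y)" by (metis oddE Suc_eq_plus1)
    define l where "l = list_decode (psnd y)"
    have "\<forall>x\<in>set l. \<exists>t. term_code t = x"
    proof
      fix x assume "x \<in> set l"
      then have "x < psnd y" using mem_less_list_encode[of x l] by (simp add: l_def)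
      then have "x < c" using psnd_le[of y] y by simp
      then show "\<exists>t. term_code t = x" by (rule less)
    qed
    then obtain T where "\<forall>x\<in>set l. term_code (T x) = x" by metis
    then have "map term_code (map T l) = l" by (simp add: map_idI)
    then have "term_code (App (pfst y) (map T l)) = c"
      unfolding term_code_App appc_def by (simp add: l_def y)
    then show ?thesis by blast
  qed
qed

text \<open>The code of a term exceeds the codes of its arguments, so structural recursion is
  course-of-values recursion on codes. The values at the arguments are folded from left to right,
  starting from \<open>z\<close>; the step also sees the operation symbol and the position.\<close>

lemma computable_term_rec:
  assumes vr: "computable 1 vr" and z: "computable 2 z" and st: "computable (Suc 3) st"
  obtains v where "computable 1 (\<lambda>xs. v (hd xs))"
    and "\<And>x. v (term_code (Var x)) = vr [x]"
    and "\<And>i ts. v (term_code (App i ts)) =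
           rec_nat (z [i, length ts]) (\<lambda>j r. st [i, j, v (term_code (ts ! j)), r]) (length ts)"
proof -
  \<comment> \<open>\<open>c div 2\<close> is the variable if \<open>c\<close> is even, and the pair
    of symbol and argument list if \<open>c\<close> is odd. Values at arguments are looked up in the
    history \<open>h\<close>.\<close>
  define F where "F = (\<lambda>xs. let h = hd xs; c = hd (tl xs); i = pfst (c div 2); l = psnd (c div 2) in
    if 2 dvd c then vr [c div 2]
    else rec_nat (z [i, lenc l]) (\<lambda>j r. st [i, j, nthc h (c - Suc (nthc l j)), r]) (lenc l))"
  have st': "computable k (\<lambda>xs. st [a xs, b xs, c xs, d xs])"
    if "computable k a" "computable k b" "computable k c" "computable k d" for k a b c d
    using computable_compose[of "[a, b, c, d]" st k] st that by (simp add: numeral_3_eq_3)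
  have "computable 2 F"
    unfolding F_def Let_def numeral_2_eq_2
    by (intro comp_intros computable_comp1[OF vr] computable_comp2[OF z] st') simp_all
  from course_of_values[OF this] obtain v where v: "computable 1 (\<lambda>xs. v (hd xs))"
    and step: "\<And>c. \<exists>h. v c = F [h, c] \<and> (\<forall>c'<c. nthc h (c - Suc c') = v c')" by blast
  show thesis
  proof (rule that[OF v])
    fix x
    obtain h where "v (term_code (Var x)) = F [h, term_code (Var x)]" using step by blast
    then show "v (term_code (Var x)) = vr [x]" by (simp add: F_def term_code_Var Let_def)
  next
    fix i ts
    let ?c = "term_code (App i ts)" and ?l = "list_encode (map term_code ts)"
    obtain h where h: "v ?c = F [h, ?c]" "\<And>c'. c' < ?c \<Longrightarrow> nthc h (?c - Suc c') = v c'"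
      using step by blast
    have c: "?c div 2 = prod_encode (i, ?l)" "\<not> 2 dvd ?c"
      unfolding term_code_App appc_def by simp_all
    have "v ?c = rec_nat (z [i, length ts])
        (\<lambda>j r. st [i, j, nthc h (?c - Suc (nthc ?l j)), r]) (length ts)"
      unfolding h(1) F_def Let_def using c by (simp add: lenc_encode)
    also have "rec_nat (z [i, length ts]) (\<lambda>j r. st [i, j, nthc h (?c - Suc (nthc ?l j)), r]) m =
      rec_nat (z [i, length ts]) (\<lambda>j r. st [i, j, v (term_code (ts ! j)), r]) m"
      if "m \<le> length ts" for m
      using that
    proof (induction m)
      case (Suc m)
      then have "nthc ?l m = term_code (ts ! m)" "ts ! m \<in> set ts" by (simp_all add: nthc_encode)
      then have "nthc h (?c - Suc (nthc ?l m)) = v (term_code (ts ! m))"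
        using h(2) appc_arg_less by metis
      then show ?case using Suc by simp
    qed simp
    finally show "v ?c = rec_nat (z [i, length ts])
        (\<lambda>j r. st [i, j, v (term_code (ts ! j)), r]) (length ts)" by simp
  qed
qed

lemma decidable_wf_term:
  assumes A: "decidable 1 (\<lambda>xs. hd xs \<in> A)" and ar: "computable 1 (\<lambda>xs. fst (\<nu> (hd xs)))"
  obtains W where "decidable 1 (\<lambda>xs. W (hd xs))" "\<And>t. W (term_code t) \<longleftrightarrow> wf_term \<nu> A t"
proof -
  have ar': "computable k (\<lambda>xs. fst (\<nu> (f xs)))" if "computable k f" for k f
    using computable_comp1[OF ar that] by simp
  have A': "decidable k (\<lambda>xs. f xs \<in> A)" if "computable k f" for k f
    using computable_comp1[OF A[unfolded decidable_def] that] by (simp add: decidable_def)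
  obtain v where v: "computable 1 (\<lambda>xs. v (hd xs))"
    and V: "\<And>x. v (term_code (Var x)) = of_bool (x \<in> A)"
    and vApp: "\<And>i ts. v (term_code (App i ts)) =
           rec_nat (of_bool (length ts = fst (\<nu> i))) (\<lambda>j r. v (term_code (ts ! j)) * r) (length ts)"
  proof (rule computable_term_rec)
    show "computable 1 (\<lambda>xs. of_bool (hd xs \<in> A))" using A by (intro comp_intros)
    show "computable 2 (\<lambda>xs. of_bool (xs ! 1 = fst (\<nu> (xs ! 0))))"
      by (intro comp_intros ar') simp_all
    show "computable (Suc 3) (\<lambda>xs. xs ! 2 * xs ! 3)" by (intro comp_intros) simp_all
  qed (simp add: numeral_2_eq_2 numeral_3_eq_3)
  have rec: "rec_nat a (\<lambda>j r. w j * r) m = a * prod w {..<m}" for a m :: nat and w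
    by (induction m) simp_all
  have eq: "v (term_code t) = of_bool (wf_term \<nu> A t)" for t
  proof (induction t)
    case (App i ts)
    then have "v (term_code (ts ! j)) = of_bool (wf_term \<nu> A (ts ! j))" if "j < length ts" for j
      using that by simp
    then have "(\<Prod>j<length ts. v (term_code (ts ! j))) = (\<Prod>j<length ts. of_bool (wf_term \<nu> A (ts ! j)))"
      by simp
    also have "\<dots> = of_bool (\<forall>j<length ts. wf_term \<nu> A (ts ! j))"
      by (auto intro!: prod.neutral)
    finally show ?case unfolding vApp rec by (auto simp: all_set_conv_all_nth)
  qed (simp add: V)
  show thesis
  proof (rule that)
    show "decidable 1 (\<lambda>xs. v (hd xs) = 1)" using v by (intro comp_intros)
    show "v (term_code t) = 1 \<longleftrightarrow> wf_term \<nu> A t" for t unfolding eq by simp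
  qed
qed

section \<open>Multiplication tables\<close>

definition tmul :: "nat \<Rightarrow> nat \<Rightarrow> nat \<Rightarrow> nat" where
  "tmul c i j = nthc (psnd c) (i * pfst c + j)"

lemma computable_tmul [comp_intros]:
  "computable k f \<Longrightarrow> computable k g \<Longrightarrow> computable k h \<Longrightarrow> computable k (\<lambda>xs. tmul (f xs) (g xs) (h xs))"
  unfolding tmul_def by (intro comp_intros)

lemma carrier_table_sg: "carrier (table_sg c) = {..<pfst c}"
  by (simp add: table_sg_def pfst_def split: prod.split)

lemma table_index_less: "i < n \<Longrightarrow> j < n \<Longrightarrow> i * n + j < n * (n :: nat)"
proof -
  assume "i < n" "j < n"
  then have "i * n + j < Suc i * n" by simp
  also have "\<dots> \<le> n * n" using \<open>i < n\<close> by (intro mult_le_mono1) simp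
  finally show ?thesis .
qed

lemma smul_table_sg:
  assumes "lenc (psnd c) = pfst c * pfst c" "i < pfst c" "j < pfst c"
  shows "smul (table_sg c) i j = tmul c i j"
  using assms table_index_less[OF assms(2,3)]
  by (simp add: table_sg_def pfst_def psnd_def tmul_def nthc_decode lenc_decode split: prod.splits)

text \<open>Unfolding the semigroup axioms on the table leaves only bounded quantifiers over
  arithmetic expressions, so being a table is decidable.\<close>

lemma table_code_iff:
  "table_code c \<longleftrightarrow> lenc (psnd c) = pfst c * pfst c \<and> 0 < pfst c \<and>
     (\<forall>i<pfst c. \<forall>j<pfst c. tmul c i j < pfst c) \<and>
     (\<forall>i<pfst c. \<forall>j<pfst c. \<forall>k<pfst c. tmul c (tmul c i j) k = tmul c i (tmul c j k))"
  (is "_ \<longleftrightarrow> ?len \<and> ?ne \<and> ?cl \<and> ?as")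
proof -
  have "table_code c \<longleftrightarrow> ?len \<and> table_sg c \<in> FinS"
    by (simp add: table_code_def pfst_def psnd_def lenc_decode split: prod.split)
  moreover have "table_sg c \<in> FinS \<longleftrightarrow> ?ne \<and> ?cl \<and> ?as" if len: ?len
  proof -
    note smul = smul_table_sg[OF len]
    have cl: "(\<forall>x\<in>{..<pfst c}. \<forall>y\<in>{..<pfst c}. smul (table_sg c) x y \<in> {..<pfst c}) \<longleftrightarrow> ?cl"
      using smul by auto
    have as: "(\<forall>x\<in>{..<pfst c}. \<forall>y\<in>{..<pfst c}. \<forall>z\<in>{..<pfst c}.
        smul (table_sg c) (smul (table_sg c) x y) z = smul (table_sg c) x (smul (table_sg c) y z)) \<longleftrightarrow> ?as"
      if ?cl using smul that by (auto simp: Ball_def)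
    have "table_sg c \<in> FinS \<longleftrightarrow> is_semigroup (table_sg c) \<and> ?ne"
      by (auto simp: FinS_def carrier_table_sg)
    also have "is_semigroup (table_sg c) \<longleftrightarrow> ?cl \<and> ?as"
      unfolding is_semigroup_def carrier_table_sg cl by (rule conj_cong[OF refl as])
    finally show ?thesis by (simp only: conj_commute conj_assoc)
  qed
  ultimately show ?thesis by blast
qed

lemma decidable_table_code [comp_intros]:
  assumes "computable k f" shows "decidable k (\<lambda>xs. table_code (f xs))"
  unfolding table_code_iff by (intro comp_intros assms) simp_all

section \<open>Pseudovarieties of abelian groups and cyclic groups\<close>

definition Zn :: "nat \<Rightarrow> nat semigrp" where
  "Zn n = \<lparr>carrier = {..<n}, smul = (\<lambda>x y. (x + y) mod n)\<rparr>"

lemma Zn_simps [simp]: "carrier (Zn n) = {..<n}" "smul (Zn n) x y = (x + y) mod n"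
  by (simp_all add: Zn_def)

definition exponents :: "nat semigrp set \<Rightarrow> nat set" where
  "exponents V = {n. 0 < n \<and> Zn n \<in> V}"

text \<open>\<open>is_abelian_group\<close> hides the unit behind an existential quantifier.
  Choosing a unit produces a structure to which the library theory of commutative groups
  applies.\<close>

definition grp :: "'a semigrp \<Rightarrow> 'a monoid" where
  "grp S = (let G = \<lambda>e. \<lparr>carrier = carrier S, monoid.mult = smul S, one = e\<rparr>
            in G (SOME e. comm_group (G e)))"

lemma grp_simps [simp]: "carrier (grp S) = carrier S" "monoid.mult (grp S) = smul S"
  by (simp_all add: grp_def Let_def)

lemma comm_group_grp: "is_abelian_group S \<Longrightarrow> comm_group (grp S)"
  unfolding is_abelian_group_def grp_def Let_def by (rule someI_ex)

lemma sg_hom_compose: "sg_hom S T f \<Longrightarrow> sg_hom T U g \<Longrightarrow> sg_hom S U (g \<circ> f)"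
  by (auto simp: sg_hom_def Pi_iff)

lemma Zn_FinS: "0 < n \<Longrightarrow> Zn n \<in> FinS"
  by (auto simp: FinS_def is_semigroup_def mod_simps algebra_simps)

lemma Zn_abelian: "0 < n \<Longrightarrow> is_abelian_group (Zn n)"
  unfolding is_abelian_group_def
proof (intro exI[of _ 0] comm_groupI)
  fix x assume "0 < n" "x \<in> carrier \<lparr>carrier = carrier (Zn n), monoid.mult = smul (Zn n), one = 0\<rparr>"
  then show "\<exists>y\<in>carrier \<lparr>carrier = carrier (Zn n), monoid.mult = smul (Zn n), one = 0\<rparr>.
      y \<otimes>\<^bsub>\<lparr>carrier = carrier (Zn n), monoid.mult = smul (Zn n), one = 0\<rparr>\<^esub> x
      = \<one>\<^bsub>\<lparr>carrier = carrier (Zn n), monoid.mult = smul (Zn n), one = 0\<rparr>\<^esub>"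
    by (intro bexI[of _ "(n - x) mod n"]) (auto simp: mod_simps)
qed (auto simp: mod_simps algebra_simps)

lemma one_grp_Zn: assumes "0 < n" shows "\<one>\<^bsub>grp (Zn n)\<^esub> = 0"
proof -
  interpret comm_group "grp (Zn n)" by (rule comm_group_grp[OF Zn_abelian[OF assms]])
  have "0 = \<one>\<^bsub>grp (Zn n)\<^esub>" by (rule one_unique) (use assms in auto)
  then show ?thesis by simp
qed

lemma pow_grp_Zn:
  assumes "0 < n" "g < n" shows "g [^]\<^bsub>grp (Zn n)\<^esub> (k :: nat) = (k * g) mod n"
proof -
  interpret comm_group "grp (Zn n)" by (rule comm_group_grp[OF Zn_abelian[OF assms(1)]])
  show ?thesis
    by (induction k) (use assms in \<open>simp_all add: one_grp_Zn mod_simps algebra_simps\<close>)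
qed

text \<open>The generator is written \<open>1 mod n\<close> because the carrier of
  \<open>Zn 1\<close> contains only 0.\<close>

lemma ord_Zn_1: assumes "0 < n" shows "group.ord (grp (Zn n)) (1 mod n) = n"
proof -
  interpret comm_group "grp (Zn n)" by (rule comm_group_grp[OF Zn_abelian[OF assms]])
  have g: "1 mod n < n" using assms by simp
  have "ord (1 mod n) dvd k \<longleftrightarrow> n dvd k" for k
  proof -
    have "(1 mod n) [^]\<^bsub>grp (Zn n)\<^esub> k = k mod n"
      unfolding pow_grp_Zn[OF assms g] mod_mult_right_eq by simp
    then show ?thesis
      using pow_eq_id[of "1 mod n" k] g one_grp_Zn[OF assms] by (simp add: mod_eq_0_iff_dvd)
  qed
  then show ?thesis by (meson dvd_antisym dvd_refl)
qed

text \<open>A finite product lives on functions; this moves it to a member of \<open>FinS\<close>.\<close>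

lemma FinS_copy:
  fixes P :: "'a semigrp"
  assumes "is_semigroup P" "finite (carrier P)" "carrier P \<noteq> {}"
  obtains T where "T \<in> FinS" "sg_isomorphic T P"
proof -
  obtain h where h: "bij_betw h (carrier P) {..<card (carrier P)}"
    using ex_bij_betw_finite_nat[OF assms(2)] by (auto simp: atLeast0LessThan)
  define g where "g = the_inv_into (carrier P) h"
  have g: "bij_betw g {..<card (carrier P)} (carrier P)"
    unfolding g_def by (rule bij_betw_the_inv_into[OF h])
  have gh: "g (h x) = x" if "x \<in> carrier P" for x
    using h that by (simp add: g_def bij_betw_def the_inv_into_f_f)
  define T where "T = \<lparr>carrier = {..<card (carrier P)}, smul = (\<lambda>x y. h (smul P (g x) (g y)))\<rparr>"
  have gP: "g x \<in> carrier P" if "x < card (carrier P)" for x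
    using g that by (auto simp: bij_betw_def)
  have hP: "h x < card (carrier P)" if "x \<in> carrier P" for x
    using h that by (auto simp: bij_betw_def)
  have cl: "smul P x y \<in> carrier P" if "x \<in> carrier P" "y \<in> carrier P" for x y
    using assms(1) that by (simp add: is_semigroup_def)
  have "T \<in> FinS"
    using assms gP hP cl gh by (auto simp: FinS_def is_semigroup_def T_def card_gt_0_iff lessThan_empty_iff)
  moreover have "sg_isomorphic T P"
    unfolding sg_isomorphic_def sg_hom_def
    by (intro exI[of _ g]) (use gP hP cl gh g in \<open>auto simp: T_def\<close>)
  ultimately show thesis by (rule that)
qed

lemma direct_product_semigroup:
  assumes "\<And>i. i < n \<Longrightarrow> is_semigroup (S i)" shows "is_semigroup (direct_product n S)"
  using assms unfolding is_semigroup_def direct_product_def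
  by (fastforce simp: PiE_iff intro!: restrict_ext)

lemma (in group) pow_cong:
  assumes "x \<in> carrier G" "x [^] n = \<one>" "[i = j] (mod n)"
  shows "x [^] (i :: nat) = x [^] (j :: nat)"
proof -
  have "x [^] k = x [^] (k mod n)" for k :: nat
  proof -
    have "x [^] k = x [^] (n * (k div n) + k mod n)" by simp
    also have "\<dots> = x [^] (n * (k div n)) \<otimes> x [^] (k mod n)"
      by (rule nat_pow_mult[OF assms(1), symmetric])
    also have "\<dots> = (x [^] n) [^] (k div n) \<otimes> x [^] (k mod n)"
      by (simp only: nat_pow_pow[OF assms(1)])
    finally show ?thesis using assms by simp
  qed
  then show ?thesis using assms(3) unfolding cong_def by metis
qed

text \<open>Commutativity lets a product be regrouped letter by letter, so only the numbers of
  occurrences matter. This is the origin of the reduction of pseudowords to exponents.\<close>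

lemma word_prod_grp:
  assumes S: "is_abelian_group S" and \<phi>: "\<phi> \<in> A \<rightarrow> carrier S" and A: "finite A"
    and u: "u \<in> lists A" "u \<noteq> []"
  shows "word_prod S (map \<phi> u) = finprod (grp S) (\<lambda>a. \<phi> a [^]\<^bsub>grp S\<^esub> count_list u a) A"
proof -
  interpret comm_group "grp S" by (rule comm_group_grp[OF S])
  let ?P = "\<lambda>u. finprod (grp S) (\<lambda>a. \<phi> a [^]\<^bsub>grp S\<^esub> count_list u a) A"
  have \<phi>': "\<phi> a \<in> carrier (grp S)" if "a \<in> A" for a using \<phi> that by auto
  have Cons: "?P (b # w) = \<phi> b \<otimes>\<^bsub>grp S\<^esub> ?P w" if "b \<in> A" for b w
  proof -
    have "?P (b # w) = finprod (grp S) (\<lambda>a. (if a = b then \<phi> a else \<one>\<^bsub>grp S\<^esub>)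
        \<otimes>\<^bsub>grp S\<^esub> \<phi> a [^]\<^bsub>grp S\<^esub> count_list w a) A"
    proof (rule finprod_cong')
      fix a assume "a \<in> A"
      then show "\<phi> a [^]\<^bsub>grp S\<^esub> count_list (b # w) a =
        (if a = b then \<phi> a else \<one>\<^bsub>grp S\<^esub>) \<otimes>\<^bsub>grp S\<^esub> \<phi> a [^]\<^bsub>grp S\<^esub> count_list w a"
        using m_comm[OF \<phi>'[of b] nat_pow_closed[OF \<phi>'[of b], of "count_list w b"]]
        by (cases "a = b") (simp_all add: \<phi>' del: grp_simps)
    qed (use \<phi>' in \<open>auto simp del: grp_simps\<close>)
    also have "\<dots> = finprod (grp S) (\<lambda>a. if a = b then \<phi> a else \<one>\<^bsub>grp S\<^esub>) A \<otimes>\<^bsub>grp S\<^esub> ?P w"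
      by (rule finprod_multf) (use \<phi>' in \<open>auto simp del: grp_simps\<close>)
    also have "finprod (grp S) (\<lambda>a. if a = b then \<phi> a else \<one>\<^bsub>grp S\<^esub>) A = \<phi> b"
      using finprod_singleton_swap[OF that A, of \<phi>] \<phi>' by (auto simp del: grp_simps)
    finally show ?thesis .
  qed
  have Nil: "?P [] = \<one>\<^bsub>grp S\<^esub>" by (intro finprod_one_eqI) simp
  from u show ?thesis
  proof (induction u rule: list.induct)
    case (Cons b w)
    show ?case
    proof (cases "w = []")
      case True
      then show ?thesis using Cons.prems \<phi>' r_one[OF \<phi>', of b] by (simp add: assms Cons Nil \<open>\<And>w b. b \<in> A \<Longrightarrow> ?P (b # w) = \<phi> b \<otimes>\<^bsub>grp S\<^esub> ?P w\<close> del: count_list.simps)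
    next
      case False
      then have "word_prod S (map \<phi> w) = ?P w" using Cons by auto
      moreover have "b \<in> A" using Cons.prems by auto
      ultimately show ?thesis using False \<open>\<And>w b. b \<in> A \<Longrightarrow> ?P (b # w) = \<phi> b \<otimes>\<^bsub>grp S\<^esub> ?P w\<close>[of b w]
        by (simp add: word_prod_Cons del: count_list.simps)
    qed
  qed simp
qed

lemma word_prod_Zn:
  assumes n: "0 < n" and f: "\<And>a. a \<in> A \<Longrightarrow> f a < n" and A: "finite A" and u: "u \<in> lists A" "u \<noteq> []"
  shows "word_prod (Zn n) (map f u) = (\<Sum>a\<in>A. count_list u a * f a) mod n"
  using u
proof (induction u rule: list.induct)
  case (Cons b w)
  have b: "b \<in> A" using Cons.prems by auto
  have eq: "(\<Sum>a\<in>A. count_list (b # w) a * f a) = f b + (\<Sum>a\<in>A. count_list w a * f a)"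
  proof -
    have "(\<Sum>a\<in>A. count_list (b # w) a * f a) = (\<Sum>a\<in>A. (if a = b then f a else 0) + count_list w a * f a)"
      by (intro sum.cong) auto
    then show ?thesis using A b by (simp add: sum.distrib)
  qed
  show ?case
  proof (cases "w = []")
    case True
    then show ?thesis using b f eq by simp
  next
    case False
    then show ?thesis using Cons eq by (simp add: word_prod_Cons mod_simps del: count_list.simps)
  qed
qed simp

section \<open>Closure properties of a pseudovariety of abelian groups\<close>

locale abelian_pv =
  fixes V :: "nat semigrp set"
  assumes pv: "pseudovariety V" and abelian: "S \<in> V \<Longrightarrow> is_abelian_group S"
begin

lemma V_FinS: "V \<subseteq> FinS"
  using pv by (simp add: pseudovariety_def)

lemma V_sub: "S \<in> V \<Longrightarrow> H \<subseteq> carrier S \<Longrightarrow> H \<noteq> {} \<Longrightarrow> (\<And>x y. x \<in> H \<Longrightarrow> y \<in> H \<Longrightarrow> smul S x y \<in> H)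
    \<Longrightarrow> S\<lparr>carrier := H\<rparr> \<in> V"
  using pv unfolding pseudovariety_def by blast

lemma V_image: "S \<in> V \<Longrightarrow> T \<in> FinS \<Longrightarrow> sg_hom S T f \<Longrightarrow> f ` carrier S = carrier T \<Longrightarrow> T \<in> V"
  using pv unfolding pseudovariety_def by blast

lemma V_iso: "S \<in> V \<Longrightarrow> T \<in> FinS \<Longrightarrow> sg_isomorphic S T \<Longrightarrow> T \<in> V"
  unfolding sg_isomorphic_def bij_betw_def using V_image by blast

lemma V_product_image:
  assumes S: "\<And>i. i < n \<Longrightarrow> S i \<in> V" and T: "T \<in> FinS"
    and f: "sg_hom (direct_product n S) T f" "f ` carrier (direct_product n S) = carrier T"
  shows "T \<in> V"
proof -
  have fin: "S i \<in> FinS" if "i < n" for i using S V_FinS that by blast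
  have 1: "is_semigroup (direct_product n S)"
    using fin by (intro direct_product_semigroup) (simp add: FinS_def)
  have 2: "finite (carrier (direct_product n S))" "carrier (direct_product n S) \<noteq> {}"
    using fin by (auto simp: direct_product_def FinS_def PiE_eq_empty_iff intro!: finite_PiE)
  obtain U where U: "U \<in> FinS" "sg_isomorphic U (direct_product n S)"
    using FinS_copy[OF 1 2] by blast
  then have "U \<in> V" using pv S unfolding pseudovariety_def by blast
  obtain g where g: "sg_hom U (direct_product n S) g" "bij_betw g (carrier U) (carrier (direct_product n S))"
    using U(2) by (auto simp: sg_isomorphic_def)
  have "(f \<circ> g) ` carrier U = carrier T"
    unfolding image_comp[symmetric] bij_betw_imp_surj_on[OF g(2)] by (rule f(2))
  then show ?thesis using V_image[OF \<open>U \<in> V\<close> T sg_hom_compose[OF g(1) f(1)]] by blast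
qed

text \<open>Exponent vectors form a product of cyclic groups of orders \<open>m i\<close>, and this
  product maps onto \<open>T\<close>: reduction modulo \<open>m i\<close> is harmless because
  \<open>m i\<close> annihilates \<open>g i\<close>. The case \<open>k = 0\<close> covers the
  trivial group.\<close>

lemma V_generated:
  fixes g :: "nat \<Rightarrow> nat" and m :: "nat \<Rightarrow> nat"
  assumes T: "T \<in> FinS" "is_abelian_group T"
    and g: "\<And>i. i < k \<Longrightarrow> g i \<in> carrier T" "\<And>i. i < k \<Longrightarrow> m i \<in> exponents V"
      "\<And>i. i < k \<Longrightarrow> g i [^]\<^bsub>grp T\<^esub> m i = \<one>\<^bsub>grp T\<^esub>"
    and gen: "\<And>x. x \<in> carrier T \<Longrightarrow> \<exists>e. x = finprod (grp T) (\<lambda>i. g i [^]\<^bsub>grp T\<^esub> (e i :: nat)) {..<k}"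
  shows "T \<in> V"
proof -
  interpret comm_group "grp T" by (rule comm_group_grp[OF T(2)])
  have g': "g i \<in> carrier (grp T)" if "i < k" for i using g(1) that by simp
  define f where "f u = finprod (grp T) (\<lambda>i. g i [^]\<^bsub>grp T\<^esub> (u i :: nat)) {..<k}" for u
  have fT: "f u \<in> carrier (grp T)" for u
    unfolding f_def by (intro finprod_closed) (use g' in \<open>auto simp del: grp_simps\<close>)
  have pow_mod: "g i [^]\<^bsub>grp T\<^esub> (a mod m i) = g i [^]\<^bsub>grp T\<^esub> a" if "i < k" for i a
    by (rule pow_cong[OF g'[OF that] g(3)[OF that]]) (simp add: cong_def)
  have "sg_hom (direct_product k (\<lambda>i. Zn (m i))) T f"
    unfolding sg_hom_def
  proof (intro conjI ballI funcsetI)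
    fix u v
    have "f (smul (direct_product k (\<lambda>i. Zn (m i))) u v)
       = finprod (grp T) (\<lambda>i. g i [^]\<^bsub>grp T\<^esub> u i \<otimes>\<^bsub>grp T\<^esub> g i [^]\<^bsub>grp T\<^esub> v i) {..<k}"
      unfolding f_def
    proof (rule finprod_cong')
      fix i assume "i \<in> {..<k}"
      then show "g i [^]\<^bsub>grp T\<^esub> smul (direct_product k (\<lambda>i. Zn (m i))) u v i
          = g i [^]\<^bsub>grp T\<^esub> u i \<otimes>\<^bsub>grp T\<^esub> g i [^]\<^bsub>grp T\<^esub> v i"
        using pow_mod[of i "u i + v i"] nat_pow_mult[OF g', of i "u i" "v i"]
        by (simp add: direct_product_def del: grp_simps)
    qed (use g' in \<open>auto simp del: grp_simps\<close>)
    also have "\<dots> = f u \<otimes>\<^bsub>grp T\<^esub> f v"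
      unfolding f_def by (rule finprod_multf) (use g' in \<open>auto simp del: grp_simps\<close>)
    finally show "f (smul (direct_product k (\<lambda>i. Zn (m i))) u v) = smul T (f u) (f v)" by simp
  qed (use fT in simp)
  moreover have "f ` carrier (direct_product k (\<lambda>i. Zn (m i))) = carrier T"
  proof
    show "f ` carrier (direct_product k (\<lambda>i. Zn (m i))) \<subseteq> carrier T" using fT by auto
    show "carrier T \<subseteq> f ` carrier (direct_product k (\<lambda>i. Zn (m i)))"
    proof
      fix x assume "x \<in> carrier T"
      then obtain e where e: "x = f e" using gen unfolding f_def by blast
      let ?u = "\<lambda>i\<in>{..<k}. e i mod m i"
      have "?u \<in> carrier (direct_product k (\<lambda>i. Zn (m i)))"
        using g(2) by (auto simp: direct_product_def exponents_def)
      moreover have "f ?u = x"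
        unfolding e f_def by (rule finprod_cong') (use pow_mod g' in \<open>auto simp del: grp_simps\<close>)
      ultimately show "x \<in> f ` carrier (direct_product k (\<lambda>i. Zn (m i)))" by blast
    qed
  qed
  ultimately show ?thesis
    by (rule V_product_image[rotated 2]) (use T g(2) in \<open>auto simp: exponents_def\<close>)
qed

lemma exponents_pos: "n \<in> exponents V \<Longrightarrow> 0 < n"
  by (simp add: exponents_def)

text \<open>The powers of \<open>x\<close> form a subsemigroup on which the discrete logarithm
  \<open>f\<close> is defined, since powers with exponents below the order are distinct. It maps
  this subsemigroup onto the cyclic group of that order.\<close>

lemma ord_in_exponents:
  assumes S: "S \<in> V" and x: "x \<in> carrier S"
  shows "group.ord (grp S) x \<in> exponents V"
proof -
  interpret comm_group "grp S" by (rule comm_group_grp[OF abelian[OF S]])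
  have fin: "finite (carrier (grp S))" using S V_FinS by (auto simp: FinS_def)
  have x': "x \<in> carrier (grp S)" using x by simp
  define n where "n = ord x"
  have n: "0 < n" using ord_ge_1[OF fin x'] by (simp add: n_def)
  have xn: "x [^]\<^bsub>grp S\<^esub> n = \<one>\<^bsub>grp S\<^esub>" unfolding n_def by (rule pow_ord_eq_1[OF x'])
  have inj: "i = j" if "x [^]\<^bsub>grp S\<^esub> i = x [^]\<^bsub>grp S\<^esub> j" "i < n" "j < n" for i j :: nat
    using ord_inj[OF x'] that unfolding inj_on_def n_def by fastforce
  have pow_mod: "x [^]\<^bsub>grp S\<^esub> (k mod n) = x [^]\<^bsub>grp S\<^esub> k" for k
    by (rule pow_cong[OF x' xn]) (simp add: cong_def)
  define H where "H = range (\<lambda>i :: nat. x [^]\<^bsub>grp S\<^esub> i)"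
  define f where "f y = (THE i. i < n \<and> x [^]\<^bsub>grp S\<^esub> i = y)" for y
  have f: "f (x [^]\<^bsub>grp S\<^esub> (i :: nat)) = i mod n" for i
    unfolding f_def by (rule the_equality) (use n pow_mod inj in auto)
  have mult: "smul S (x [^]\<^bsub>grp S\<^esub> (i :: nat)) (x [^]\<^bsub>grp S\<^esub> j) = x [^]\<^bsub>grp S\<^esub> (i + j)" for i j
    using nat_pow_mult[OF x', of i j] by simp
  have SH: "S\<lparr>carrier := H\<rparr> \<in> V"
  proof (rule V_sub[OF S])
    show "H \<subseteq> carrier S" unfolding H_def using nat_pow_closed[OF x'] by auto
    show "smul S y z \<in> H" if "y \<in> H" "z \<in> H" for y z
      using that mult unfolding H_def by auto
  qed (simp add: H_def)
  have "sg_hom (S\<lparr>carrier := H\<rparr>) (Zn n) f"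
    unfolding sg_hom_def using n mult by (auto simp: H_def f mod_simps)
  moreover have "f ` carrier (S\<lparr>carrier := H\<rparr>) = carrier (Zn n)"
  proof
    show "carrier (Zn n) \<subseteq> f ` carrier (S\<lparr>carrier := H\<rparr>)"
    proof
      fix i assume "i \<in> carrier (Zn n)"
      then have "i = f (x [^]\<^bsub>grp S\<^esub> i)" using f by simp
      then show "i \<in> f ` carrier (S\<lparr>carrier := H\<rparr>)" by (auto simp: H_def)
    qed
  qed (use n in \<open>auto simp: H_def f\<close>)
  ultimately have "Zn n \<in> V" by (rule V_image[OF SH Zn_FinS[OF n]])
  then show ?thesis using n by (simp add: exponents_def n_def)
qed

lemma exponents_dvd:
  assumes n: "n \<in> exponents V" and m: "m dvd n" shows "m \<in> exponents V"
proof -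
  have n0: "0 < n" using n by (rule exponents_pos)
  have m0: "0 < m" using m n0 by (metis dvd_0_left_iff neq0_conv)
  have "sg_hom (Zn n) (Zn m) (\<lambda>x. x mod m)"
    using m m0 by (auto simp: sg_hom_def mod_mod_cancel mod_simps)
  moreover have "(\<lambda>x. x mod m) ` carrier (Zn n) = carrier (Zn m)"
  proof
    show "carrier (Zn m) \<subseteq> (\<lambda>x. x mod m) ` carrier (Zn n)"
    proof
      fix x assume "x \<in> carrier (Zn m)"
      then show "x \<in> (\<lambda>x. x mod m) ` carrier (Zn n)"
        using dvd_imp_le[OF m n0] by (intro image_eqI[of _ _ x]) auto
    qed
  qed (use m0 in auto)
  moreover have "Zn n \<in> V" using n by (simp add: exponents_def)
  ultimately have "Zn m \<in> V" using V_image Zn_FinS[OF m0] by blast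
  then show ?thesis using m0 by (simp add: exponents_def)
qed

lemma exponents_1: "1 \<in> exponents V"
proof -
  interpret comm_group "grp (Zn 1)" by (rule comm_group_grp[OF Zn_abelian]) simp
  have "Zn 1 \<in> V"
    by (rule V_generated[of _ 0 "\<lambda>_. 0" "\<lambda>_. 1"]) (use Zn_FinS Zn_abelian one_grp_Zn[of 1] in \<open>auto simp del: One_nat_def\<close>)
  then show ?thesis by (simp add: exponents_def)
qed

text \<open>The elements \<open>p = l / m\<close> and \<open>q = l / n\<close> of
  \<open>Zn l\<close> are annihilated by \<open>m\<close> and \<open>n\<close>. They are coprime, so
  by Bezout they generate \<open>Zn l\<close>, and \<open>V_generated\<close> applies.\<close>

lemma exponents_lcm:
  assumes m: "m \<in> exponents V" and n: "n \<in> exponents V" shows "lcm m n \<in> exponents V"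
proof -
  have m0: "0 < m" and n0: "0 < n" using assms exponents_pos by auto
  define l where "l = lcm m n"
  have l0: "0 < l" using m0 n0 by (simp add: l_def lcm_pos_nat)
  define p where "p = n div gcd m n"
  define q where "q = m div gcd m n"
  have p: "l = m * p" by (simp add: l_def p_def lcm_nat_def div_mult_swap)
  have q: "l = n * q" by (simp add: l_def q_def lcm_nat_def div_mult_swap mult.commute)
  have pq: "coprime p q" unfolding p_def q_def using div_gcd_coprime[of m n] m0
    by (simp add: coprime_commute)
  interpret comm_group "grp (Zn l)" by (rule comm_group_grp[OF Zn_abelian[OF l0]])
  have lt: "p mod l < l" "q mod l < l" using l0 by auto
  define g where "g i = (if i = 0 then p mod l else q mod l)" for i :: nat
  have g: "g i < l" for i using lt by (simp add: g_def)
  have "Zn l \<in> V"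
  proof (rule V_generated[of _ 2 g "\<lambda>i. if i = 0 then m else n"])
    show "g i [^]\<^bsub>grp (Zn l)\<^esub> (if i = 0 then m else n) = \<one>\<^bsub>grp (Zn l)\<^esub>" for i
      unfolding pow_grp_Zn[OF l0 g] one_grp_Zn[OF l0] using p q by (auto simp: g_def mod_simps)
    fix x assume "x \<in> carrier (Zn l)"
    then have x: "x < l" by simp
    obtain a b where ab: "[a * p + b * q = x] (mod l)"
    proof (cases "q = 0")
      case True
      then have "p = 1" using pq by simp
      then show thesis using that[of x 0] by simp
    next
      case False
      obtain a b where ab: "p * a = q * b + 1"
        using bezout_nat[of p q] pq p l0 by (metis coprime_iff_gcd_eq_1 gr0I mult_0_right nat_less_le)
      have "p * (a * x) = q * (b * x) + x" using ab by (metis add_mult_distrib mult.assoc mult_1)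
      \<comment> \<open>The factor \<open>l - 1\<close> stands for -1 modulo \<open>l\<close> and
        keeps the exponents natural.\<close>
      then have "(a * x) * p + (b * x * (l - 1)) * q = x + (b * x * q) * l"
        using l0 by (cases l) (auto simp: algebra_simps)
      then show thesis by (intro that[of "a * x" "b * x * (l - 1)"]) (simp add: cong_def)
    qed
    define e where "e i = (if i = 0 then a else b)" for i :: nat
    have "finprod (grp (Zn l)) (\<lambda>i. g i [^]\<^bsub>grp (Zn l)\<^esub> e i) {..<2}
        = g 1 [^]\<^bsub>grp (Zn l)\<^esub> e 1 \<otimes>\<^bsub>grp (Zn l)\<^esub> g 0 [^]\<^bsub>grp (Zn l)\<^esub> e 0"
    proof -
      have gc: "g i [^]\<^bsub>grp (Zn l)\<^esub> e i \<in> carrier (grp (Zn l))" for i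
        using g by (intro nat_pow_closed) simp
      have "{..<2} = insert 1 {0 :: nat}" by auto
      then show ?thesis using gc r_one[OF gc] by (simp del: grp_simps)
    qed
    also have "\<dots> = (b * q + a * p) mod l"
      unfolding pow_grp_Zn[OF l0 g] by (simp add: e_def g_def mod_simps)
    also have "\<dots> = x" using ab x by (simp add: cong_def add.commute)
    finally show "\<exists>e. x = finprod (grp (Zn l)) (\<lambda>i. g i [^]\<^bsub>grp (Zn l)\<^esub> (e i :: nat)) {..<2}" by blast
  qed (use m n l0 g Zn_FinS Zn_abelian in auto)
  then show ?thesis using l0 by (simp add: exponents_def l_def)
qed

lemma exponents_Lcm: "finite M \<Longrightarrow> M \<subseteq> exponents V \<Longrightarrow> Lcm M \<in> exponents V"
  by (induction M rule: finite_induct) (use exponents_1 exponents_lcm in auto)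

text \<open>A finite group is generated by all its elements, and their orders serve as the
  annihilating exponents in \<open>V_generated\<close>. Membership thereby becomes a condition on
  orders of elements, which can be read off a table.\<close>

lemma V_iff:
  assumes S: "S \<in> FinS"
  shows "S \<in> V \<longleftrightarrow> is_abelian_group S \<and> (\<forall>x\<in>carrier S. group.ord (grp S) x \<in> exponents V)"
proof
  assume *: "is_abelian_group S \<and> (\<forall>x\<in>carrier S. group.ord (grp S) x \<in> exponents V)"
  then interpret comm_group "grp S" by (intro comm_group_grp) simp
  have fin: "finite (carrier S)" using S by (simp add: FinS_def)
  obtain g where g: "bij_betw g {..<card (carrier S)} (carrier S)"
    using ex_bij_betw_nat_finite[OF fin] by (auto simp: atLeast0LessThan)
  have gS: "g i \<in> carrier (grp S)" if "i < card (carrier S)" for i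
    using g that by (auto simp: bij_betw_def)
  show "S \<in> V"
  proof (rule V_generated[of _ "card (carrier S)" g "\<lambda>i. ord (g i)"])
    fix x assume "x \<in> carrier S"
    then obtain j where j: "j < card (carrier S)" "x = g j" using g by (auto simp: bij_betw_def)
    have "x = finprod (grp S) (\<lambda>i. g i [^]\<^bsub>grp S\<^esub> (of_bool (j = i) :: nat)) {..<card (carrier S)}"
    proof -
      have "finprod (grp S) (\<lambda>i. if j = i then g i else \<one>\<^bsub>grp S\<^esub>) {..<card (carrier S)} = g j"
        by (rule finprod_singleton) (use j gS in \<open>auto simp del: grp_simps\<close>)
      moreover have "finprod (grp S) (\<lambda>i. g i [^]\<^bsub>grp S\<^esub> (of_bool (j = i) :: nat)) {..<card (carrier S)}
        = finprod (grp S) (\<lambda>i. if j = i then g i else \<one>\<^bsub>grp S\<^esub>) {..<card (carrier S)}"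
        by (rule finprod_cong') (use gS in \<open>auto simp del: grp_simps\<close>)
      ultimately show ?thesis using j by simp
    qed
    then show "\<exists>e. x = finprod (grp S) (\<lambda>i. g i [^]\<^bsub>grp S\<^esub> (e i :: nat)) {..<card (carrier S)}"
      by (intro exI[of _ "\<lambda>i. of_bool (j = i)"])
  qed (use S * gS pow_ord_eq_1 in auto)
qed (use abelian ord_in_exponents in auto)

lemma common_exponent:
  assumes S: "S \<in> V"
  obtains n where "n \<in> exponents V" "\<And>x. x \<in> carrier S \<Longrightarrow> x [^]\<^bsub>grp S\<^esub> n = \<one>\<^bsub>grp S\<^esub>"
proof
  interpret comm_group "grp S" by (rule comm_group_grp[OF abelian[OF S]])
  have fin: "finite (carrier S)" using S V_FinS by (auto simp: FinS_def)
  let ?n = "Lcm (ord ` carrier S)"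
  show "?n \<in> exponents V" using fin ord_in_exponents[OF S] by (intro exponents_Lcm) auto
  show "x [^]\<^bsub>grp S\<^esub> ?n = \<one>\<^bsub>grp S\<^esub>" if "x \<in> carrier S" for x
    using that by (subst pow_eq_id) auto
qed

end

section \<open>Approximation of pseudowords by words\<close>

lemma word_component:
  assumes V: "V \<subseteq> FinS" and i: "i \<in> interp V A" and u: "u \<in> lists A" "u \<noteq> []"
  shows "word V A u i = word_prod (fst i) (map (snd i) u)"
proof -
  have h: "sg_hom (big_product V A) (fst i) (\<lambda>w. w i)"
    using i by (auto simp: sg_hom_def big_product_def PiE_iff)
  have "set (map (letter V A) u) \<subseteq> carrier (big_product V A)"
    using u letter_in_product[OF V] by auto
  from word_prod_hom[OF big_product_semigroup[OF V] h _ this]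
  have "word V A u i = word_prod (fst i) (map ((\<lambda>w. w i) \<circ> letter V A) u)"
    using u by (simp add: word_def)
  moreover have "map ((\<lambda>w. w i) \<circ> letter V A) u = map (snd i) u"
    using i by (simp add: letter_def)
  ultimately show ?thesis by simp
qed

text \<open>Since the factors are discrete, prescribing finitely many coordinates is an open
  condition. Hence a point of a closure may be replaced by a point of the set itself as long as only
  finitely many coordinates are inspected.\<close>

lemma openin_agree:
  assumes F: "finite F" "F \<subseteq> interp FinS A" and w: "w \<in> topspace (big_top FinS A)"
  shows "openin (big_top FinS A) {v \<in> topspace (big_top FinS A). \<forall>i\<in>F. v i = w i}"
  using F
proof (induction F rule: finite_induct)
  case (insert i F)
  let ?X = "big_top FinS A"
  have i: "i \<in> interp FinS A" using insert by simp
  have wi: "w i \<in> carrier (fst i)"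
    using w i unfolding big_top_def by auto
  have "openin ?X {v \<in> topspace ?X. v i \<in> {w i}}"
    by (rule openin_continuous_map_preimage[where Y = "discrete_topology (carrier (fst i))"])
       (use wi continuous_map_product_projection[OF i,
          of "\<lambda>i. discrete_topology (carrier (fst i))"] in \<open>auto simp: big_top_def\<close>)
  moreover have "{v \<in> topspace ?X. \<forall>j\<in>insert i F. v j = w j}
      = {v \<in> topspace ?X. v i \<in> {w i}} \<inter> {v \<in> topspace ?X. \<forall>i\<in>F. v i = w i}" by auto
  ultimately show ?case using insert by (metis (no_types, lifting) insert_subset openin_Int)
qed simp

lemma in_closure_approx:
  assumes w: "w \<in> big_top FinS A closure_of W" and F: "finite F" "F \<subseteq> interp FinS A"
  shows "\<exists>v\<in>W. \<forall>i\<in>F. v i = w i"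
proof -
  have top: "w \<in> topspace (big_top FinS A)" using w by (simp add: in_closure_of)
  have op: "openin (big_top FinS A) {v \<in> topspace (big_top FinS A). \<forall>i\<in>F. v i = w i}"
    by (rule openin_agree[OF F top])
  have mem: "w \<in> {v \<in> topspace (big_top FinS A). \<forall>i\<in>F. v i = w i}" using top by simp
  show ?thesis
    using w[unfolded in_closure_of, THEN conjunct2, rule_format, OF conjI[OF mem op]] by auto
qed

definition nonempty_words :: "nat list set \<Rightarrow> nat list set" where
  "nonempty_words L = {u \<in> L. u \<noteq> []}"

lemma words_in_Omega: "L \<subseteq> lists A \<Longrightarrow> word FinS A ` nonempty_words L \<subseteq> carrier (Omega FinS A)"
  using word_in_Omega[OF order_refl, of _ A] by (force simp: nonempty_words_def)

text \<open>The empty word becomes the isolated point \<open>None\<close> and cannot approximate an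
  element \<open>Some w\<close>, so only the nonempty words of \<open>L\<close> count.\<close>

lemma Cl_Some_iff:
  assumes L: "L \<subseteq> lists A"
  shows "Some w \<in> Cl A L \<longleftrightarrow> w \<in> Omega_top FinS A closure_of (word FinS A ` nonempty_words L)"
    (is "?l \<longleftrightarrow> w \<in> ?X closure_of ?W")
proof -
  let ?Y = "adjoin_one_top ?X"
  have top: "topspace ?Y = insert None (Some ` topspace ?X)"
  proof -
    have "openin ?Y (insert None (Some ` topspace ?X))"
      unfolding openin_adjoin_one_top
    proof
      have "{x. Some x \<in> insert None (Some ` topspace ?X)} = topspace ?X" by auto
      then show "openin ?X {x. Some x \<in> insert None (Some ` topspace ?X)}" by simp
    qed simp
    then show ?thesis
      using openin_subset[of ?Y] openin_adjoin_one_top[of ?X "topspace ?Y"] by blast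
  qed
  show ?thesis
  proof
    assume w: ?l
    then have wtop: "w \<in> topspace ?X" unfolding Cl_def in_closure_of top by auto
    show "w \<in> ?X closure_of ?W"
      unfolding in_closure_of
    proof (intro conjI allI impI)
      fix T assume T: "w \<in> T \<and> openin ?X T"
      then have "openin ?Y (Some ` T)"
        using openin_subset[of ?X T] by (auto simp: openin_adjoin_one_top inj_image_mem_iff)
      moreover have "\<forall>T. Some w \<in> T \<and> openin ?Y T \<longrightarrow> (\<exists>y. y \<in> word1 A ` L \<and> y \<in> T)"
        using w unfolding Cl_def in_closure_of by simp
      moreover have "Some w \<in> Some ` T" using T by simp
      ultimately have "\<exists>y. y \<in> word1 A ` L \<and> y \<in> Some ` T" by (simp only: simp_thms)
      then obtain u where u: "u \<in> L" "word1 A u \<in> Some ` T" by (elim exE conjE imageE) simp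
      then have "u \<noteq> []" by (auto simp: word1_def)
      then show "\<exists>y. y \<in> ?W \<and> y \<in> T"
        using u by (auto simp: word1_def nonempty_words_def)
    qed (rule wtop)
  next
    assume w: "w \<in> ?X closure_of ?W"
    show ?l
      unfolding Cl_def in_closure_of
    proof (intro conjI allI impI)
      show "Some w \<in> topspace ?Y" using w unfolding top in_closure_of by simp
      fix T assume T: "Some w \<in> T \<and> openin ?Y T"
      then have "openin ?X {x. Some x \<in> T}" by (simp add: openin_adjoin_one_top)
      moreover have "w \<in> {x. Some x \<in> T}" using T by simp
      moreover have "w \<in> U \<and> openin ?X U \<longrightarrow> (\<exists>y. y \<in> ?W \<and> y \<in> U)" for U
        using w unfolding in_closure_of by blast
      ultimately have "\<exists>y. y \<in> ?W \<and> y \<in> {x. Some x \<in> T}" by metis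
      then obtain u where "u \<in> L" "u \<noteq> []" "Some (word FinS A u) \<in> T"
        by (auto simp: nonempty_words_def)
      then show "\<exists>y. y \<in> word1 A ` L \<and> y \<in> T"
        by (intro exI[of _ "Some (word FinS A u)"]) (auto simp: word1_def image_iff intro!: bexI[of _ u])
    qed
  qed
qed

lemma Omega_closure_approx:
  assumes w: "w \<in> Omega_top FinS A closure_of W" and F: "finite F" "F \<subseteq> interp FinS A"
  shows "\<exists>v\<in>W. \<forall>i\<in>F. v i = w i"
proof -
  have "w \<in> big_top FinS A closure_of W"
    using w closure_of_mono[of "carrier (Omega FinS A) \<inter> W" W "big_top FinS A"]
    by (auto simp: Omega_top_def closure_of_subtopology)
  then show ?thesis by (rule in_closure_approx[OF _ F])
qed

section \<open>Exponents of letters in pseudowords\<close>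

definition unit_at :: "nat set \<Rightarrow> nat \<Rightarrow> nat \<Rightarrow> nat \<Rightarrow> nat" where
  "unit_at A m a = (\<lambda>b\<in>A. if b = a then 1 mod m else 0)"

text \<open>\<open>exv A w a m\<close> is the exponent of the letter \<open>a\<close> in \<open>w\<close>, modulo \<open>m\<close>.\<close>

definition exv :: "nat set \<Rightarrow> pseudoword \<Rightarrow> nat \<Rightarrow> nat \<Rightarrow> int" where
  "exv A w a m = int (w (Zn m, unit_at A m a))"

lemma unit_at_interp: "0 < m \<Longrightarrow> Zn m \<in> V \<Longrightarrow> (Zn m, unit_at A m a) \<in> interp V A"
  by (auto simp: interp_def unit_at_def)

lemma exv_word:
  assumes A: "finite A" "a \<in> A" and u: "u \<in> lists A" "u \<noteq> []" and m: "0 < m"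
  shows "exv A (word FinS A u) a m = int (count_list u a) mod int m"
proof -
  have "word FinS A u (Zn m, unit_at A m a) = word_prod (Zn m) (map (unit_at A m a) u)"
    using word_component[OF order_refl unit_at_interp[OF m Zn_FinS[OF m]] u] by simp
  also have "\<dots> = (\<Sum>b\<in>A. count_list u b * unit_at A m a b) mod m"
    by (rule word_prod_Zn[OF m _ A(1) u]) (use m in \<open>auto simp: unit_at_def\<close>)
  also have "(\<Sum>b\<in>A. count_list u b * unit_at A m a b) = (\<Sum>b\<in>A. if b = a then count_list u a * (1 mod m) else 0)"
    by (intro sum.cong) (auto simp: unit_at_def)
  also have "\<dots> = count_list u a * (1 mod m)" using A by simp
  finally show ?thesis by (simp add: exv_def zmod_int mod_mult_right_eq)
qed

text \<open>Exponents modulo the members of \<open>M\<close> are coordinates as well, so a single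
  word can match finitely many of them together with those in \<open>F\<close>.\<close>

lemma closure_approx:
  assumes A: "finite A" and L: "L \<subseteq> lists A"
    and w: "w \<in> Omega_top FinS A closure_of (word FinS A ` nonempty_words L)"
    and F: "finite F" "F \<subseteq> interp FinS A" and M: "finite M" "0 \<notin> M"
  obtains u where "u \<in> L" "u \<noteq> []" "\<And>i. i \<in> F \<Longrightarrow> word FinS A u i = w i"
    "\<And>a m. a \<in> A \<Longrightarrow> m \<in> M \<Longrightarrow> exv A w a m = int (count_list u a) mod int m"
proof -
  let ?F = "F \<union> (\<lambda>(m, a). (Zn m, unit_at A m a)) ` (M \<times> A)"
  have "finite ?F" "?F \<subseteq> interp FinS A"
    using F M A unit_at_interp Zn_FinS by (auto intro!: unit_at_interp) (metis Zn_FinS neq0_conv)+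
  from Omega_closure_approx[OF w this] obtain u where u: "u \<in> nonempty_words L"
    "\<And>i. i \<in> ?F \<Longrightarrow> word FinS A u i = w i" by blast
  show thesis
  proof (rule that)
    show "u \<in> L" "u \<noteq> []" using u(1) by (auto simp: nonempty_words_def)
    show "word FinS A u i = w i" if "i \<in> F" for i using u(2) that by simp
    fix a m assume am: "a \<in> A" "m \<in> M"
    then have "0 < m" using M by (metis neq0_conv)
    have "exv A w a m = exv A (word FinS A u) a m"
      using u(2)[of "(Zn m, unit_at A m a)"] am by (force simp: exv_def)
    also have "\<dots> = int (count_list u a) mod int m"
      using exv_word[OF A am(1) _ _ \<open>0 < m\<close>] \<open>u \<in> L\<close> \<open>u \<noteq> []\<close> L by blast
    finally show "exv A w a m = int (count_list u a) mod int m" .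
  qed
qed

lemma nonempty_words_lists: "word FinS A ` nonempty_words (lists A) = {word FinS A w | w. w \<in> lists A \<and> w \<noteq> []}"
  by (auto simp: nonempty_words_def)

lemma Omega_approx:
  assumes A: "finite A" and w: "w \<in> carrier (Omega FinS A)"
    and F: "finite F" "F \<subseteq> interp FinS A" and M: "finite M" "0 \<notin> M"
  obtains u where "u \<in> lists A" "u \<noteq> []" "\<And>i. i \<in> F \<Longrightarrow> word FinS A u i = w i"
    "\<And>a m. a \<in> A \<Longrightarrow> m \<in> M \<Longrightarrow> exv A w a m = int (count_list u a) mod int m"
proof (rule closure_approx[OF A order_refl _ F M])
  show "w \<in> Omega_top FinS A closure_of (word FinS A ` nonempty_words (lists A))"
    unfolding nonempty_words_lists using words_dense[OF order_refl, of A] w by simp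
qed (use that in blast)

text \<open>For words both sides count the same occurrences; a word that approximates
  \<open>w\<close> modulo \<open>m\<close> and modulo \<open>n\<close> at once transfers this to
  \<open>w\<close>.\<close>

lemma exv_mod:
  assumes A: "finite A" "a \<in> A" and w: "w \<in> carrier (Omega FinS A)" and m: "m dvd n" "0 < n"
  shows "exv A w a m = exv A w a n mod int m"
proof -
  have m0: "0 < m" using m by (metis dvd_0_left_iff neq0_conv)
  obtain u where u: "\<And>a k. a \<in> A \<Longrightarrow> k \<in> {m, n} \<Longrightarrow> exv A w a k = int (count_list u a) mod int k"
    by (rule Omega_approx[OF A(1) w finite.emptyI empty_subsetI, of "{m, n}"]) (use m m0 in auto)
  show ?thesis using u[OF A(2)] m by (simp add: mod_mod_cancel)
qed

lemma exv_bounds: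
  assumes A: "finite A" "a \<in> A" and w: "w \<in> carrier (Omega FinS A)" and m: "0 < m"
  shows "exv A w a m mod int m = exv A w a m"
  using exv_mod[OF A w dvd_refl m] by simp

lemma component_in_carrier:
  assumes "w \<in> carrier (Omega FinS A)" "i \<in> interp FinS A" shows "w i \<in> carrier (fst i)"
  using assms Omega_subset[OF order_refl, of A] by (force simp: big_product_def PiE_iff)

text \<open>In a word over \<open>B\<close> every occurrence of \<open>b\<close> contributes the
  exponent of \<open>a\<close> in the image of \<open>b\<close>, and approximation carries this over
  to pseudowords. Substitution is thus linear on exponents, which turns equations modulo
  \<open>V\<close> into linear equations.\<close>

lemma exv_hat:
  assumes A: "finite A" "a \<in> A" and B: "finite B" and \<phi>: "\<phi> \<in> B \<rightarrow> carrier (Omega FinS A)"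
    and u: "u \<in> carrier (Omega FinS B)" and m: "0 < m"
  shows "[exv A (hat B (Omega FinS A) (Omega_top FinS A) \<phi> u) a m
          = (\<Sum>b\<in>B. exv B u b m * exv A (\<phi> b) a m)] (mod int m)"
proof -
  let ?i = "(Zn m, unit_at A m a)" and ?f = "\<lambda>b\<in>B. \<phi> b (Zn m, unit_at A m a)"
  have i: "?i \<in> interp FinS A" by (rule unit_at_interp[OF m Zn_FinS[OF m]])
  have \<phi>m: "\<phi> b ?i < m" if "b \<in> B" for b
    using component_in_carrier[of "\<phi> b", OF _ i] \<phi> that by auto
  have j: "(Zn m, ?f) \<in> interp FinS B"
    using \<phi>m Zn_FinS[OF m] by (auto simp: interp_def)
  have hat: "exv A (hat B (Omega FinS A) (Omega_top FinS A) \<phi> u) a m = int (u (Zn m, ?f))"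
    using i by (simp add: hat_eq[OF order_refl \<phi>] u exv_def subst_hom_def)
  obtain v where v: "v \<in> lists B" "v \<noteq> []" "word FinS B v (Zn m, ?f) = u (Zn m, ?f)"
    "\<And>b. b \<in> B \<Longrightarrow> exv B u b m = int (count_list v b) mod int m"
    by (rule Omega_approx[OF B u, of "{(Zn m, ?f)}" "{m}"]) (use j m in auto)
  have "u (Zn m, ?f) = word_prod (Zn m) (map ?f v)"
    using word_component[OF order_refl j v(1,2)] v(3) by simp
  also have "\<dots> = (\<Sum>b\<in>B. count_list v b * ?f b) mod m"
    by (rule word_prod_Zn[OF m _ B v(1,2)]) (use \<phi>m in auto)
  finally have eq: "[int (u (Zn m, ?f)) = (\<Sum>b\<in>B. int (count_list v b) * exv A (\<phi> b) a m)] (mod int m)"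
    by (simp add: cong_def zmod_int exv_def)
  have "[(\<Sum>b\<in>B. int (count_list v b) * exv A (\<phi> b) a m)
      = (\<Sum>b\<in>B. exv B u b m * exv A (\<phi> b) a m)] (mod int m)"
    by (intro cong_sum cong_mult cong_refl) (simp add: v(4) cong_def)
  then show ?thesis unfolding hat by (rule cong_trans[OF eq])
qed

lemma exv_letter:
  assumes "a \<in> A" "b \<in> A" "0 < m" shows "exv A (letter FinS A b) a m = of_bool (b = a) mod int m"
proof -
  have "letter FinS A b (Zn m, unit_at A m a) = (if b = a then 1 mod m else 0)"
    using unit_at_interp[OF assms(3) Zn_FinS[OF assms(3)], of A a] assms(2)
    by (simp add: letter_def unit_at_def)
  then show ?thesis unfolding exv_def
    by (cases "b = a") (simp_all only: if_True if_False of_bool_eq zmod_int of_nat_1 of_nat_0 mod_0 simp_thms)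
qed

lemma hat_letter:
  assumes "\<phi> \<in> A \<rightarrow> carrier (Omega FinS B)" "a \<in> A"
  shows "hat A (Omega FinS B) (Omega_top FinS B) \<phi> (letter FinS A a) = \<phi> a"
  using assms subst_letter[OF order_refl assms] letter_in_Omega[OF order_refl assms(2)]
  by (simp add: hat_eq[OF order_refl])

lemma hat_cont_hom:
  assumes "\<phi> \<in> A \<rightarrow> carrier (Omega FinS B)"
  shows "cont_hom (Omega FinS A) (Omega_top FinS A) (Omega FinS B) (Omega_top FinS B)
           (hat A (Omega FinS B) (Omega_top FinS B) \<phi>)"
proof -
  have s: "cont_hom (Omega FinS A) (Omega_top FinS A) (Omega FinS B) (Omega_top FinS B) (subst_hom A FinS B \<phi>)"
    by (rule subst_cont_hom[OF order_refl assms])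
  have eq: "hat A (Omega FinS B) (Omega_top FinS B) \<phi> x = subst_hom A FinS B \<phi> x"
    if "x \<in> carrier (Omega FinS A)" for x
    using that by (simp add: hat_eq[OF order_refl assms])
  show ?thesis unfolding cont_hom_def
  proof
    show "sg_hom (Omega FinS A) (Omega FinS B) (hat A (Omega FinS B) (Omega_top FinS B) \<phi>)"
      using s Omega_semigroup[OF order_refl, of A]
      by (auto simp: cont_hom_def sg_hom_def eq is_semigroup_def Pi_iff)
    show "continuous_map (Omega_top FinS A) (Omega_top FinS B) (hat A (Omega FinS B) (Omega_top FinS B) \<phi>)"
    proof (rule continuous_map_eq)
      show "continuous_map (Omega_top FinS A) (Omega_top FinS B) (subst_hom A FinS B \<phi>)"
        using s by (simp add: cont_hom_def)
    qed (simp add: eq topspace_Omega_top[OF order_refl])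
  qed
qed

lemma hat_closed:
  assumes "\<phi> \<in> A \<rightarrow> carrier (Omega FinS B)" "w \<in> carrier (Omega FinS A)"
  shows "hat A (Omega FinS B) (Omega_top FinS B) \<phi> w \<in> carrier (Omega FinS B)"
  using hat_cont_hom[OF assms(1)] assms(2) by (auto simp: cont_hom_def sg_hom_def)

lemma cont_hom_eq_hat:
  assumes \<delta>: "cont_hom (Omega FinS A) (Omega_top FinS A) (Omega FinS B) (Omega_top FinS B) \<delta>"
    and w: "w \<in> carrier (Omega FinS A)"
  shows "\<delta> w = hat A (Omega FinS B) (Omega_top FinS B) (\<lambda>a. \<delta> (letter FinS A a)) w"
proof -
  have \<phi>: "(\<lambda>a. \<delta> (letter FinS A a)) \<in> A \<rightarrow> carrier (Omega FinS B)"
    using \<delta> letter_in_Omega[OF order_refl] by (auto simp: cont_hom_def sg_hom_def)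
  show ?thesis
    by (rule cont_hom_unique[OF order_refl \<delta> hat_cont_hom[OF \<phi>] Omega_Hausdorff[OF order_refl] _ w])
       (simp add: hat_letter[OF \<phi>])
qed

lemma sigma_sub_in_Omega:
  assumes "implicit_signature \<sigma>" "w \<in> sigma_sub \<sigma> FinS A" shows "w \<in> carrier (Omega FinS A)"
  using assms(2)
proof induction
  case (gen a)
  then show ?case by (rule letter_in_Omega[OF order_refl])
next
  case (op n w \<phi>)
  then show ?case using assms(1) by (intro hat_closed) (auto simp: implicit_signature_def)
qed

text \<open>Let \<open>C m\<close> be the closure of the words that satisfy \<open>Q m\<close>.
  These sets have the finite intersection property, because a word that is good for a least common
  multiple is good for all its divisors. A common point \<open>w\<close> is the desired pseudoword,
  and approximating it inside \<open>C m\<close> gives back a word with \<open>Q m\<close> and the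
  same exponents modulo \<open>m\<close>. The existence of pseudowords with prescribed exponents is
  always derived in this way.\<close>

lemma compact_choice:
  fixes Q :: "nat \<Rightarrow> nat list \<Rightarrow> bool"
  assumes A: "finite A" and L: "L \<subseteq> lists A"
    and D: "0 \<notin> D" "\<And>M. finite M \<Longrightarrow> M \<subseteq> D \<Longrightarrow> Lcm M \<in> D"
    and mono: "\<And>m n u. m \<in> D \<Longrightarrow> n \<in> D \<Longrightarrow> m dvd n \<Longrightarrow> Q n u \<Longrightarrow> Q m u"
    and ex: "\<And>m. m \<in> D \<Longrightarrow> \<exists>u\<in>L. u \<noteq> [] \<and> Q m u"
  obtains w where "w \<in> carrier (Omega FinS A)" "Some w \<in> Cl A L"
    "\<And>m. m \<in> D \<Longrightarrow> \<exists>u\<in>L. u \<noteq> [] \<and> Q m u \<and> (\<forall>a\<in>A. exv A w a m = int (count_list u a) mod int m)"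
proof -
  let ?X = "Omega_top FinS A"
  define C where "C m = ?X closure_of (word FinS A ` nonempty_words {u \<in> L. Q m u})" for m
  have sub: "word FinS A ` nonempty_words {u \<in> L. Q m u} \<subseteq> topspace ?X" for m
    using words_in_Omega[of "{u \<in> L. Q m u}" A] L by (auto simp: topspace_Omega_top[OF order_refl])
  have "\<Inter>(C ` D) \<noteq> {}"
  proof -
    have closed: "\<forall>T\<in>C ` D. closedin ?X T" by (auto simp: C_def)
    have "\<Inter>\<F> \<noteq> {}" if \<F>: "finite \<F>" "\<F> \<subseteq> C ` D" for \<F>
    proof -
      obtain M where M: "finite M" "M \<subseteq> D" "\<F> = C ` M"
        using finite_subset_image[OF \<F>] by blast
      have l: "Lcm M \<in> D" by (rule D(2)[OF M(1,2)])
      obtain u where u: "u \<in> L" "u \<noteq> []" "Q (Lcm M) u" using ex[OF l] by blast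
      have "word FinS A u \<in> C m" if "m \<in> M" for m
      proof -
        have "Q m u" using mono[OF _ l _ u(3)] M(2) that by (simp add: subset_iff)
        then have "word FinS A u \<in> word FinS A ` nonempty_words {u \<in> L. Q m u}"
          using u by (auto simp: nonempty_words_def)
        then show ?thesis unfolding C_def using closure_of_subset[OF sub] by blast
      qed
      then show ?thesis using M(3) by auto
    qed
    then have fip: "\<forall>\<F>. finite \<F> \<and> \<F> \<subseteq> C ` D \<longrightarrow> \<Inter>\<F> \<noteq> {}" by simp
    show ?thesis
      by (rule mp[OF spec[OF Omega_compact[OF order_refl, of A, unfolded compact_space_fip]]
            conjI[OF closed fip]])
  qed
  then obtain w where w: "\<And>m. m \<in> D \<Longrightarrow> w \<in> C m" by auto
  \<comment> \<open>\<open>Lcm {}\<close> is 1, so \<open>1\<close> belongs to \<open>D\<close>;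
    membership in the closure of \<open>L\<close> is read off \<open>C 1\<close>.\<close>
  have "Lcm {} \<in> D" by (rule D(2)) simp_all
  then have w1: "w \<in> C 1" using w by simp
  have "C 1 \<subseteq> ?X closure_of (word FinS A ` nonempty_words L)"
    unfolding C_def by (intro closure_of_mono) (auto simp: nonempty_words_def)
  then have "w \<in> ?X closure_of (word FinS A ` nonempty_words L)" using w1 by blast
  moreover have "w \<in> carrier (Omega FinS A)"
    using w1 unfolding C_def in_closure_of topspace_Omega_top[OF order_refl] by simp
  ultimately show thesis
  proof (intro that)
    fix m assume m: "m \<in> D"
    have "m \<noteq> 0" using m D(1) by (cases "m = 0") simp_all
    obtain u where "u \<in> {u \<in> L. Q m u}" "u \<noteq> []"
      "\<And>a k. a \<in> A \<Longrightarrow> k \<in> {m} \<Longrightarrow> exv A w a k = int (count_list u a) mod int k"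
      by (rule closure_approx[OF A _ w[OF m, unfolded C_def] finite.emptyI empty_subsetI, of "{m}"])
         (use L \<open>m \<noteq> 0\<close> in auto)
    then show "\<exists>u\<in>L. u \<noteq> [] \<and> Q m u \<and> (\<forall>a\<in>A. exv A w a m = int (count_list u a) mod int m)"
      by auto
  qed (simp_all add: Cl_Some_iff[OF L])
qed

context abelian_pv
begin

text \<open>Every member of \<open>V\<close> has a common exponent \<open>n\<close> in
  \<open>exponents V\<close>. A component of a pseudoword there equals that of an approximating
  word, and by commutativity it depends only on the numbers of occurrences modulo
  \<open>n\<close>.\<close>

lemma satisfies_iff:
  assumes A: "finite A" and v: "v \<in> carrier (Omega FinS A)" and w: "w \<in> carrier (Omega FinS A)"
  shows "satisfies V A v w \<longleftrightarrow> (\<forall>a\<in>A. \<forall>m\<in>exponents V. exv A v a m = exv A w a m)"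
proof -
  have "satisfies V A v w \<longleftrightarrow> restrict v (interp V A) = restrict w (interp V A)"
    unfolding satisfies_def psi_eq[OF V_FinS v] psi_eq[OF V_FinS w] ..
  also have "\<dots> \<longleftrightarrow> (\<forall>i\<in>interp V A. v i = w i)"
    by (auto simp: restrict_def fun_eq_iff)
  also have "\<dots> \<longleftrightarrow> (\<forall>a\<in>A. \<forall>m\<in>exponents V. exv A v a m = exv A w a m)"
  proof
    assume "\<forall>i\<in>interp V A. v i = w i"
    then show "\<forall>a\<in>A. \<forall>m\<in>exponents V. exv A v a m = exv A w a m"
      using unit_at_interp by (auto simp: exponents_def exv_def)
  next
    assume eq: "\<forall>a\<in>A. \<forall>m\<in>exponents V. exv A v a m = exv A w a m"
    show "\<forall>i\<in>interp V A. v i = w i"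
    proof
      fix i assume i: "i \<in> interp V A"
      obtain S \<phi> where S: "i = (S, \<phi>)" "S \<in> V" "\<phi> \<in> A \<rightarrow> carrier S"
        using i by (auto simp: interp_def)
      have iF: "i \<in> interp FinS A" using i V_FinS by (auto simp: interp_def)
      obtain n where n: "n \<in> exponents V" "\<And>x. x \<in> carrier S \<Longrightarrow> x [^]\<^bsub>grp S\<^esub> n = \<one>\<^bsub>grp S\<^esub>"
        using common_exponent[OF S(2)] by blast
      have n0: "0 \<notin> {n}" using exponents_pos[OF n(1)] by simp
      obtain u where u: "u \<in> lists A" "u \<noteq> []" "word FinS A u i = v i"
        "\<And>a. a \<in> A \<Longrightarrow> exv A v a n = int (count_list u a) mod int n"
        by (rule Omega_approx[OF A v, of "{i}" "{n}"]) (use iF n0 in auto)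
      obtain u' where u': "u' \<in> lists A" "u' \<noteq> []" "word FinS A u' i = w i"
        "\<And>a. a \<in> A \<Longrightarrow> exv A w a n = int (count_list u' a) mod int n"
        by (rule Omega_approx[OF A w, of "{i}" "{n}"]) (use iF n0 in auto)
      interpret comm_group "grp S" by (rule comm_group_grp[OF abelian[OF S(2)]])
      have "word_prod S (map \<phi> u) = word_prod S (map \<phi> u')"
        unfolding word_prod_grp[OF abelian[OF S(2)] S(3) A u(1,2)]
          word_prod_grp[OF abelian[OF S(2)] S(3) A u'(1,2)]
      proof (rule finprod_cong')
        fix a assume a: "a \<in> A"
        have "[count_list u a = count_list u' a] (mod n)"
          using u(4)[OF a] u'(4)[OF a] eq a n(1) by (simp add: cong_def zmod_int[symmetric])
        then show "\<phi> a [^]\<^bsub>grp S\<^esub> count_list u a = \<phi> a [^]\<^bsub>grp S\<^esub> count_list u' a"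
          using S(3) a n(2) by (intro pow_cong[of _ n]) auto
      next
        have "\<phi> a \<in> carrier (grp S)" if "a \<in> A" for a using S(3) that by auto
        then show "(\<lambda>a. \<phi> a [^]\<^bsub>grp S\<^esub> count_list u' a) \<in> A \<rightarrow> carrier (grp S)"
          using nat_pow_closed by (simp add: Pi_iff del: grp_simps)
      qed simp
      then show "v i = w i"
        using word_component[OF order_refl iF u(1,2)] word_component[OF order_refl iF u'(1,2)]
          u(3) u'(3) S(1) by simp
    qed
  qed
  finally show ?thesis .
qed

end

section \<open>Arithmetic of a supernatural number\<close>

text \<open>Such a set consists of the natural numbers that divide a supernatural number, a formal
  product of primes with possibly infinite multiplicities.\<close>

locale exponent_set =
  fixes D :: "nat set"
  assumes pos: "n \<in> D \<Longrightarrow> 0 < n" and one: "1 \<in> D"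
    and dvd: "n \<in> D \<Longrightarrow> m dvd n \<Longrightarrow> m \<in> D"
    and lcm: "m \<in> D \<Longrightarrow> n \<in> D \<Longrightarrow> lcm m n \<in> D"
begin

text \<open>Up to \<open>eqv\<close>, these families are the elements of the inverse limit of the
  rings of integers modulo \<open>m\<close>, for \<open>m\<close> in \<open>D\<close>. Integer
  values instead of residues permit ordinary arithmetic at the price of equality up to
  congruence.\<close>

definition compat :: "(nat \<Rightarrow> int) \<Rightarrow> bool" where
  "compat x \<longleftrightarrow> (\<forall>m\<in>D. \<forall>n\<in>D. m dvd n \<longrightarrow> [x n = x m] (mod int m))"

definition eqv :: "(nat \<Rightarrow> int) \<Rightarrow> (nat \<Rightarrow> int) \<Rightarrow> bool" where
  "eqv x y \<longleftrightarrow> (\<forall>m\<in>D. [x m = y m] (mod int m))"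

text \<open>Such a \<open>t\<close> contains, for each of its primes, the full power that occurs in
  \<open>D\<close>. The ring of compatible families is then a product of the integers modulo
  \<open>t\<close> and a part away from \<open>t\<close>.\<close>

definition unitary :: "nat \<Rightarrow> bool" where
  "unitary t \<longleftrightarrow> t \<in> D \<and> (\<forall>m\<in>D. t dvd m \<longrightarrow> coprime t (m div t))"

text \<open>Equivalently, \<open>k\<close> is invertible modulo every member of \<open>D\<close>
  that is coprime to \<open>t\<close>; one direction is \<open>denom_coprime\<close>. So
  \<open>k\<close> can serve as a denominator there.\<close>

definition denom :: "nat \<Rightarrow> nat \<Rightarrow> bool" where
  "denom k t \<longleftrightarrow> 0 < k \<and> (\<forall>d\<in>D. d dvd k \<longrightarrow> coprime d t \<longrightarrow> d = 1)"

text \<open>The code \<open>(k, p, q, t, c)\<close> stands for the element that is \<open>c\<close> modulo \<open>t\<close> and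
  \<open>(p - q) / k\<close> modulo the members of \<open>D\<close> that are coprime to \<open>t\<close>.\<close>

type_synonym code = "nat \<times> nat \<times> nat \<times> nat \<times> nat"

fun valid :: "code \<Rightarrow> bool" where
  "valid (k, p, q, t, c) \<longleftrightarrow> unitary t \<and> denom k t"

text \<open>A code consists of natural numbers, so an integer numerator is a difference
  \<open>p - q\<close>; moving \<open>q\<close> to the other side and multiplying by
  \<open>k\<close> avoids subtraction and inverses.\<close>

fun rep :: "code \<Rightarrow> (nat \<Rightarrow> int) \<Rightarrow> bool" where
  "rep (k, p, q, t, c) x \<longleftrightarrow> unitary t \<and> denom k t \<and> compat x \<and> [x t = int c] (mod int t) \<and>
     (\<forall>m\<in>D. coprime m t \<longrightarrow> [int k * x m + int q = int p] (mod int m))"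

definition rat :: "(nat \<Rightarrow> int) \<Rightarrow> bool" where
  "rat x \<longleftrightarrow> (\<exists>z. rep z x)"

lemma rep_compat: "rep z x \<Longrightarrow> compat x" and rep_valid: "rep z x \<Longrightarrow> valid z"
  by (cases z; simp)+

lemma rat_compat: "rat x \<Longrightarrow> compat x"
  by (auto simp: rat_def rep_compat)

lemma compat_const [intro]: "compat (\<lambda>_. c)"
  by (simp add: compat_def)

lemma compat_add [intro]: "compat x \<Longrightarrow> compat y \<Longrightarrow> compat (\<lambda>m. x m + y m)"
  and compat_diff [intro]: "compat x \<Longrightarrow> compat y \<Longrightarrow> compat (\<lambda>m. x m - y m)"
  and compat_mult [intro]: "compat x \<Longrightarrow> compat y \<Longrightarrow> compat (\<lambda>m. x m * y m)"
  by (auto simp: compat_def intro!: cong_add cong_diff cong_mult)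

lemma compat_sum [intro]: "(\<And>j. j \<in> J \<Longrightarrow> compat (x j)) \<Longrightarrow> compat (\<lambda>m. \<Sum>j\<in>J. x j m)"
  by (induction J rule: infinite_finite_induct) auto

lemma compatD: "compat x \<Longrightarrow> n \<in> D \<Longrightarrow> m dvd n \<Longrightarrow> [x n = x m] (mod int m)"
  using dvd by (auto simp: compat_def)

section \<open>Splitting at a unitary divisor, and arithmetic of codes\<close>

lemma unitary_1: "unitary 1"
  using one by (simp add: unitary_def)

text \<open>The definition of \<open>unitary\<close> is applied to \<open>lcm m t\<close>, which
  lies in \<open>D\<close> and satisfies \<open>lcm m t div t = m div gcd m t\<close>. This gives
  the factorisation of \<open>m\<close> into a part inside \<open>t\<close> and a part prime to
  \<open>t\<close>.\<close>

lemma unitary_split: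
  assumes t: "unitary t" and m: "m \<in> D"
  shows "coprime (m div gcd m t) t" and "coprime (gcd m t) (m div gcd m t)"
    and "m div gcd m t \<in> D" and "gcd m t \<in> D"
proof -
  have "t \<in> D" using t by (simp add: unitary_def)
  then have t0: "0 < t" "0 < m" using pos m by auto
  have "lcm m t \<in> D" by (rule lcm[OF m \<open>t \<in> D\<close>])
  moreover have "lcm m t div t = m div gcd m t"
  proof -
    have "lcm m t = t * (m div gcd m t)" by (simp add: lcm_nat_def div_mult_swap mult.commute)
    then show ?thesis using t0 by simp
  qed
  ultimately show 1: "coprime (m div gcd m t) t"
    using t unfolding unitary_def by (metis coprime_commute dvd_lcm2)
  show "coprime (gcd m t) (m div gcd m t)"
    using coprime_divisors[OF gcd_dvd2[of m t] dvd_refl] 1 by (metis coprime_commute)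
  show "m div gcd m t \<in> D"
    using dvd[OF m] by (metis dvd_div_mult_self dvd_triv_left gcd_dvd1)
  show "gcd m t \<in> D" using dvd[OF m] by simp
qed

lemma denom_coprime:
  assumes "denom k t" "m \<in> D" "coprime m t" shows "coprime k m"
proof -
  have "gcd k m \<in> D" using dvd[OF assms(2)] by simp
  moreover have "coprime (gcd k m) t"
    using assms(3) coprime_divisors[OF gcd_dvd2[of k m] dvd_refl] by blast
  ultimately have "gcd k m = 1" using assms(1) unfolding denom_def by simp
  then show ?thesis by (simp add: coprime_iff_gcd_eq_1)
qed

lemma cong_split:
  assumes t: "unitary t" and m: "m \<in> D"
    and "[a = b] (mod int (gcd m t))" "[a = b] (mod int (m div gcd m t))"
  shows "[a = b] (mod int m)"
proof -
  have "coprime (int (gcd m t)) (int (m div gcd m t))"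
    using unitary_split(2)[OF t m] by simp
  then have "[a = b] (mod int (gcd m t) * int (m div gcd m t))"
    using assms by (intro coprime_cong_mult)
  then show ?thesis by (simp flip: of_nat_mult)
qed

text \<open>By the Chinese remainder theorem for the splitting of \<open>m\<close> at
  \<open>t\<close>, it suffices to compare modulo \<open>t\<close> and modulo the members coprime to
  \<open>t\<close>.\<close>

lemma eqvI:
  assumes t: "unitary t" and x: "compat x" and y: "compat y" and "[x t = y t] (mod int t)"
    and "\<And>m. m \<in> D \<Longrightarrow> coprime m t \<Longrightarrow> [x m = y m] (mod int m)"
  shows "eqv x y"
  unfolding eqv_def
proof
  fix m assume m: "m \<in> D"
  have tD: "t \<in> D" using t by (simp add: unitary_def)
  show "[x m = y m] (mod int m)"
  proof (rule cong_split[OF t m])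
    let ?g = "gcd m t"
    have "[x m = x ?g] (mod int ?g)" "[y m = y ?g] (mod int ?g)"
      "[x t = x ?g] (mod int ?g)" "[y t = y ?g] (mod int ?g)"
      using compatD[OF x] compatD[OF y] m tD by auto
    moreover have "[x t = y t] (mod int ?g)"
      using assms(4) by (rule cong_dvd_modulus) simp
    ultimately show "[x m = y m] (mod int ?g)" by (metis cong_sym cong_trans)
    let ?h = "m div gcd m t"
    have h: "?h \<in> D" "?h dvd m" "coprime ?h t"
      using unitary_split[OF t m] by (auto simp: dvd_div_iff_mult) (metis dvd_div_mult_self dvd_triv_left gcd_dvd1)
    have "[x m = x ?h] (mod int ?h)" "[y m = y ?h] (mod int ?h)"
      using compatD[OF x m h(2)] compatD[OF y m h(2)] by auto
    with assms(5)[OF h(1,3)] show "[x m = y m] (mod int ?h)" by (metis cong_sym cong_trans)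
  qed
qed

text \<open>Modulo \<open>t\<close> the residue is stored in the code, and away from
  \<open>t\<close> the denominator can be cancelled.\<close>

lemma rep_unique:
  assumes "rep z x" "rep z y" shows "eqv x y"
proof -
  obtain k p q t c where z: "z = (k, p, q, t, c)" by (cases z)
  have x: "unitary t" "denom k t" "compat x" "[x t = int c] (mod int t)"
    "\<And>m. m \<in> D \<Longrightarrow> coprime m t \<Longrightarrow> [int k * x m + int q = int p] (mod int m)"
    using assms(1) by (auto simp: z)
  have y: "compat y" "[y t = int c] (mod int t)"
    "\<And>m. m \<in> D \<Longrightarrow> coprime m t \<Longrightarrow> [int k * y m + int q = int p] (mod int m)"
    using assms(2) by (auto simp: z)
  show ?thesis
  proof (rule eqvI[OF x(1,3) y(1)])
    show "[x t = y t] (mod int t)" using x(4) y(2) by (metis cong_sym cong_trans)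
    fix m assume m: "m \<in> D" "coprime m t"
    have "[int k * x m + int q = int k * y m + int q] (mod int m)"
      using x(5)[OF m] y(3)[OF m] by (metis cong_sym cong_trans)
    then have "[int k * x m = int k * y m] (mod int m)" by (simp add: cong_add_rcancel)
    moreover have "coprime (int k) (int m)" using denom_coprime[OF x(2) m] by simp
    ultimately show "[x m = y m] (mod int m)" by (simp add: cong_mult_lcancel)
  qed
qed

lemma rep_eqv:
  assumes "rep z x" "compat y" "eqv x y" shows "rep z y"
proof -
  obtain k p q t c where z: "z = (k, p, q, t, c)" by (cases z)
  have t: "t \<in> D" using assms(1) by (simp add: z unitary_def)
  have "[y m = x m] (mod int m)" if "m \<in> D" for m
    using assms(3) that unfolding eqv_def by (metis cong_sym)
  then have "[y t = int c] (mod int t)"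
    and "[int k * y m + int q = int p] (mod int m)" if "m \<in> D" "coprime m t" for m
    using assms(1) t that unfolding z rep.simps
    by (metis cong_trans, metis cong_add cong_refl cong_scalar_left cong_trans)
  \<comment> \<open>Both preceding facts carry the premises on \<open>m\<close>; the instance
    \<open>m = 1\<close> releases the first of them.\<close>
  then show ?thesis using assms one unfolding z rep.simps by (metis coprime_1_left)
qed

text \<open>Two codes have to be brought to a common \<open>t\<close> before they are added or
  multiplied, and \<open>lift\<close> supplies the residue modulo the larger \<open>T\<close>. The
  disjunct \<open>T \<le> z\<close> stops the search on codes that represent nothing.\<close>

fun lift :: "code \<Rightarrow> nat \<Rightarrow> nat" where
  "lift (k, p, q, t, c) T =
     (LEAST z. T \<le> z \<or> z mod t = c mod t \<and> (k * z + q) mod (T div t) = p mod (T div t))"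

text \<open>Here \<open>T\<close> is \<open>t\<close> times a coprime factor \<open>h\<close> of
  \<open>T\<close> in \<open>D\<close>, and \<open>k\<close> is invertible modulo \<open>h\<close>.
  So the two congruences of the search have exactly one solution modulo \<open>T\<close>, and the
  residue of \<open>x\<close> is a solution.\<close>

lemma lift:
  assumes z: "rep (k, p, q, t, c) x" and T: "unitary T" "t dvd T"
  shows "[x T = int (lift (k, p, q, t, c) T)] (mod int T)"
proof -
  let ?P = "\<lambda>z. z mod t = c mod t \<and> (k * z + q) mod (T div t) = p mod (T div t)"
  have x: "unitary t" "denom k t" "compat x" "[x t = int c] (mod int t)"
    "\<And>m. m \<in> D \<Longrightarrow> coprime m t \<Longrightarrow> [int k * x m + int q = int p] (mod int m)"
    using z by auto
  have TD: "T \<in> D" using T by (simp add: unitary_def)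
  have T0: "0 < T" using pos[OF TD] .
  define h where "h = T div t"
  have Th: "T = t * h" using T(2) by (simp add: h_def)
  have g: "gcd T t = t" using T(2) by (simp add: gcd_nat.absorb2)
  have h: "h \<in> D" "coprime h t" "h dvd T"
    using unitary_split[OF x(1) TD] unfolding g h_def[symmetric] by (simp_all add: Th)
  define z0 where "z0 = nat (x T mod int T)"
  have z0: "int z0 = x T mod int T" "z0 < T" using T0 by (auto simp: z0_def nat_less_iff)
  have z0T: "[int z0 = x T] (mod int T)" by (simp add: z0 cong_def)
  have P0: "?P z0"
  proof
    have "[int z0 = x T] (mod int t)" using z0T by (rule cong_dvd_modulus) (simp add: Th)
    also have "[x T = x t] (mod int t)" by (rule compatD[OF x(3) TD T(2)])
    also have "[x t = int c] (mod int t)" by (rule x(4))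
    finally show "z0 mod t = c mod t" by (simp add: cong_int_iff flip: cong_def)
    have "[int z0 = x T] (mod int h)" using z0T by (rule cong_dvd_modulus) (simp add: Th)
    also have "[x T = x h] (mod int h)" by (rule compatD[OF x(3) TD h(3)])
    finally have "[int k * int z0 + int q = int k * x h + int q] (mod int h)"
      by (intro cong_add cong_mult cong_refl)
    also have "[int k * x h + int q = int p] (mod int h)" by (rule x(5)[OF h(1,2)])
    finally have "[int (k * z0 + q) = int p] (mod int h)" by simp
    then show "(k * z0 + q) mod (T div t) = p mod (T div t)"
      unfolding cong_int_iff h_def[symmetric] by (simp add: cong_def)
  qed
  have uniq: "[int z1 = int z0] (mod int T)" if "?P z1" for z1
  proof -
    have "[z1 = z0] (mod t)" using that P0 by (simp add: cong_def)
    moreover have "[k * z1 + q = k * z0 + q] (mod h)" using that P0 by (simp add: cong_def h_def)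
    then have "[z1 = z0] (mod h)"
      using denom_coprime[OF x(2) h(1,2)] by (simp add: cong_add_rcancel_nat cong_mult_lcancel_nat)
    ultimately have "[z1 = z0] (mod t * h)"
      using h(2) by (intro coprime_cong_mult_nat) (auto simp: coprime_commute)
    then show ?thesis by (simp add: Th cong_int_iff flip: of_nat_mult)
  qed
  let ?l = "lift (k, p, q, t, c) T"
  have "T \<le> ?l \<or> ?P ?l" unfolding lift.simps by (rule LeastI[of _ z0]) (use P0 in simp)
  moreover have "?l \<le> z0" unfolding lift.simps by (rule Least_le) (use P0 in simp)
  ultimately have "?P ?l" using z0(2) by simp
  then show ?thesis using uniq z0T by (metis cong_sym cong_trans)
qed

lemma div_dvd_antimono:
  fixes a b m :: nat
  assumes "a dvd b" "b dvd m" "0 < m" shows "m div b dvd m div a"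
proof -
  obtain u v where "b = a * u" "m = b * v" using assms by (elim dvdE)
  moreover then have "0 < a" "0 < b" using assms(3) by auto
  ultimately show ?thesis by simp
qed

lemma unitary_lcm:
  assumes "unitary s" "unitary t" shows "unitary (lcm s t)"
  unfolding unitary_def
proof (intro conjI ballI impI)
  show "lcm s t \<in> D" using assms lcm by (simp add: unitary_def)
  fix m assume m: "m \<in> D" "lcm s t dvd m"
  have s: "s dvd m" and t: "t dvd m" using m(2) by auto
  have *: "m div lcm s t dvd m div s" "m div lcm s t dvd m div t"
    using div_dvd_antimono[OF _ m(2) pos[OF m(1)]] by simp_all
  have "coprime s (m div lcm s t)"
    using assms(1) m(1) s *(1) unfolding unitary_def by (meson coprime_divisors dvd_refl)
  moreover have "coprime t (m div lcm s t)"
    using assms(2) m(1) t *(2) unfolding unitary_def by (meson coprime_divisors dvd_refl)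
  ultimately have "coprime (s * t) (m div lcm s t)" by simp
  moreover have "lcm s t dvd s * t" by simp
  ultimately show "coprime (lcm s t) (m div lcm s t)" by (meson coprime_divisors dvd_refl)
qed

lemma denom_mult:
  assumes "denom k s" "denom l t" shows "denom (k * l) (lcm s t)"
  unfolding denom_def
proof (intro conjI ballI impI)
  show "0 < k * l" using assms by (simp add: denom_def)
  fix d assume d: "d \<in> D" "d dvd k * l" "coprime d (lcm s t)"
  have ds: "coprime d s" "coprime d t" using d(3) by (meson coprime_divisors dvd_refl dvd_lcm1 dvd_lcm2)+
  have "coprime k d" by (rule denom_coprime[OF assms(1) d(1) ds(1)])
  then have "d dvd l" using d(2) by (simp add: coprime_dvd_mult_right_iff coprime_commute)
  then show "d = 1" using assms(2) d(1) ds(2) by (simp add: denom_def)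
qed

fun code_add :: "code \<Rightarrow> code \<Rightarrow> code" where
  "code_add (k, p, q, s, c) (l, p', q', t, d) =
     (k * l, p * l + p' * k, q * l + q' * k, lcm s t,
      lift (k, p, q, s, c) (lcm s t) + lift (l, p', q', t, d) (lcm s t))"

fun code_mult :: "code \<Rightarrow> code \<Rightarrow> code" where
  "code_mult (k, p, q, s, c) (l, p', q', t, d) =
     (k * l, p * p' + q * q', p * q' + q * p', lcm s t,
      lift (k, p, q, s, c) (lcm s t) * lift (l, p', q', t, d) (lcm s t))"

lemma cong_lin:
  fixes a b :: int
  shows "[k * a + q = p] (mod m) \<longleftrightarrow> [k * a = p - q] (mod m)"
  unfolding cong_iff_dvd_diff by (simp add: algebra_simps)

lemma rep_add: assumes "rep y u" "rep z v" shows "rep (code_add y z) (\<lambda>m. u m + v m)"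
  and rep_mult: "rep (code_mult y z) (\<lambda>m. u m * v m)"
proof -
  obtain k p q s c where y: "y = (k, p, q, s, c)" by (cases y)
  obtain l p' q' t d where z: "z = (l, p', q', t, d)" by (cases z)
  have Y: "unitary s" "denom k s" "compat u"
    "\<And>m. m \<in> D \<Longrightarrow> coprime m s \<Longrightarrow> [int k * u m = int p - int q] (mod int m)"
    using assms(1) by (auto simp: y cong_lin)
  have Z: "unitary t" "denom l t" "compat v"
    "\<And>m. m \<in> D \<Longrightarrow> coprime m t \<Longrightarrow> [int l * v m = int p' - int q'] (mod int m)"
    using assms(2) by (auto simp: z cong_lin)
  let ?T = "lcm s t"
  have T: "unitary ?T" by (rule unitary_lcm[OF Y(1) Z(1)])
  have kl: "denom (k * l) ?T" by (rule denom_mult[OF Y(2) Z(2)])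
  have lu: "[u ?T = int (lift y ?T)] (mod int ?T)"
    unfolding y by (rule lift[OF assms(1)[unfolded y] T]) simp
  have lv: "[v ?T = int (lift z ?T)] (mod int ?T)"
    unfolding z by (rule lift[OF assms(2)[unfolded z] T]) simp
  have cop: "coprime m s" "coprime m t" if "coprime m ?T" for m
    using that by (meson coprime_divisors dvd_refl dvd_lcm1 dvd_lcm2)+
  have "[int (k * l) * (u m + v m) = int (p * l + p' * k) - int (q * l + q' * k)] (mod int m)"
    if m: "m \<in> D" "coprime m ?T" for m
  proof -
    have "[int l * (int k * u m) + int k * (int l * v m)
        = int l * (int p - int q) + int k * (int p' - int q')] (mod int m)"
      by (intro cong_add cong_mult cong_refl Y(4) Z(4) m(1) cop[OF m(2)])
    then show ?thesis by (simp add: algebra_simps)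
  qed
  then show "rep (code_add y z) (\<lambda>m. u m + v m)"
    unfolding y z code_add.simps rep.simps cong_lin
    using T kl Y(3) Z(3) cong_add[OF lu lv] by (auto simp: y z)
  have "[int (k * l) * (u m * v m) = int (p * p' + q * q') - int (p * q' + q * p')] (mod int m)"
    if m: "m \<in> D" "coprime m ?T" for m
  proof -
    have "[(int k * u m) * (int l * v m) = (int p - int q) * (int p' - int q')] (mod int m)"
      by (intro cong_mult Y(4) Z(4) m(1) cop[OF m(2)])
    then show ?thesis by (simp add: algebra_simps)
  qed
  then show "rep (code_mult y z) (\<lambda>m. u m * v m)"
    unfolding y z code_mult.simps rep.simps cong_lin
    using T kl Y(3) Z(3) cong_mult[OF lu lv] by (auto simp: y z)
qed

section \<open>The ring of rational elements and its purity\<close>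

lemma denom_1: "denom 1 t"
  by (simp add: denom_def)

lemma rep_const: "rep (1, p, q, 1, 0) (\<lambda>_. int p - int q)"
  using unitary_1 denom_1 by (auto simp: cong_lin)

lemma rep_of_bool: "rep (1, of_bool b, 0, 1, 0) (\<lambda>_. of_bool b)"
  using rep_const[of "of_bool b" 0] by simp

lemma rat_const: "rat (\<lambda>_. c)"
proof -
  have "int (nat c) - int (nat (- c)) = c" by simp
  then show ?thesis unfolding rat_def using rep_const[of "nat c" "nat (- c)"] by metis
qed

lemma rat_add: "rat x \<Longrightarrow> rat y \<Longrightarrow> rat (\<lambda>m. x m + y m)"
  and rat_mult: "rat x \<Longrightarrow> rat y \<Longrightarrow> rat (\<lambda>m. x m * y m)"
  unfolding rat_def using rep_add rep_mult by blast+

lemma rat_scale: "rat x \<Longrightarrow> rat (\<lambda>m. c * x m)"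
  using rat_mult[OF rat_const] by simp

lemma rat_diff: "rat x \<Longrightarrow> rat y \<Longrightarrow> rat (\<lambda>m. x m - y m)"
  using rat_add[OF _ rat_scale[of y "-1"], of x] by simp

lemma rat_sum: "(\<And>j. j \<in> J \<Longrightarrow> rat (x j)) \<Longrightarrow> rat (\<lambda>m. \<Sum>j\<in>J. x j m)"
  by (induction J rule: infinite_finite_induct) (auto simp: rat_const rat_add)

lemma rat_eqv: "rat x \<Longrightarrow> compat y \<Longrightarrow> eqv x y \<Longrightarrow> rat y"
  unfolding rat_def using rep_eqv by blast

text \<open>The multiplier is \<open>k * t\<close>: the factor \<open>k\<close> clears the
  denominator away from \<open>t\<close>, and \<open>t\<close> annihilates the arbitrary
  residue.\<close>

lemma rat_multiple:
  assumes "rat x"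
  obtains n z where "0 < n" "\<And>m. m \<in> D \<Longrightarrow> [int n * x m = z] (mod int m)"
proof -
  obtain k p q t c where "rep (k, p, q, t, c) x" using assms by (auto simp: rat_def)
  then have x: "unitary t" "denom k t" "compat x" "[x t = int c] (mod int t)"
    "\<And>m. m \<in> D \<Longrightarrow> coprime m t \<Longrightarrow> [int k * x m = int p - int q] (mod int m)"
    by (auto simp: cong_lin)
  have t0: "0 < t" using x(1) pos by (simp add: unitary_def)
  have "eqv (\<lambda>m. int (k * t) * x m) (\<lambda>m. int t * (int p - int q))"
  proof (rule eqvI[OF x(1)])
    show "[int (k * t) * x t = int t * (int p - int q)] (mod int t)"
      by (simp add: cong_def mod_simps mult.assoc)
    show "[int (k * t) * x m = int t * (int p - int q)] (mod int m)" if "m \<in> D" "coprime m t" for m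
      using cong_scalar_left[OF x(5)[OF that], of "int t"] by (simp add: algebra_simps)
  qed (use x(3) in auto)
  then show thesis
    using t0 x(2) by (intro that[of "k * t" "int t * (int p - int q)"]) (auto simp: eqv_def denom_def)
qed

text \<open>The number \<open>t\<close> collects the full powers in \<open>D\<close> of those primes
  of \<open>n\<close> whose powers in \<open>D\<close> are bounded. The other primes of
  \<open>n\<close> either do not belong to \<open>D\<close> or have all their powers in
  \<open>D\<close>.\<close>

lemma unitary_for:
  assumes n: "0 < n"
  obtains t where "unitary t"
    "\<And>p j. prime p \<Longrightarrow> p dvd n \<Longrightarrow> p \<in> D \<Longrightarrow> \<not> p dvd t \<Longrightarrow> p ^ j \<in> D"
proof -
  have ex: "\<exists>t. unitary t \<and> (\<forall>p\<in>P. p \<in> D \<longrightarrow> \<not> p dvd t \<longrightarrow> (\<forall>j. p ^ j \<in> D))"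
    if "finite P" "\<forall>p\<in>P. prime p" for P
    using that
  proof (induction P rule: finite_induct)
    case empty
    then show ?case using unitary_1 by auto
  next
    case (insert p P)
    then obtain t where t: "unitary t" "\<forall>p\<in>P. p \<in> D \<longrightarrow> \<not> p dvd t \<longrightarrow> (\<forall>j. p ^ j \<in> D)" by auto
    show ?case
    proof (cases "p \<in> D \<and> (\<exists>j. p ^ j \<notin> D)")
      case False
      then show ?thesis using t by auto
    next
      case True
      \<comment> \<open>The first power outside \<open>D\<close>; since \<open>D\<close> is closed
        under divisors, \<open>p ^ (j - 1)\<close> is the largest power of \<open>p\<close> in
        \<open>D\<close>.\<close>
      define j where "j = (LEAST j. p ^ j \<notin> D)"
      have j: "p ^ j \<notin> D" unfolding j_def using True by (metis (mono_tags) LeastI)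
      have less: "p ^ i \<in> D" if "i < j" for i
        using not_less_Least[of i "\<lambda>j. p ^ j \<notin> D"] that by (auto simp: j_def)
      have p: "prime p" using insert by simp
      have "j \<noteq> 0" "j \<noteq> 1" using j True one by (auto intro: ccontr)
      then have j2: "j \<ge> 2" by simp
      have "unitary (p ^ (j - 1))"
        unfolding unitary_def
      proof (intro conjI ballI impI)
        show "p ^ (j - 1) \<in> D" using less j2 by simp
        fix m assume m: "m \<in> D" "p ^ (j - 1) dvd m"
        have "\<not> p dvd m div p ^ (j - 1)"
        proof
          assume "p dvd m div p ^ (j - 1)"
          then have "p * p ^ (j - 1) dvd m" using m(2) by (metis dvd_div_mult_self dvd_mult_cancel2 mult_dvd_mono dvd_refl)
          then have "p ^ j dvd m" using j2 by (metis Suc_diff_1 power_Suc less_le_trans zero_less_numeral)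
          then show False using j dvd[OF m(1)] by blast
        qed
        then show "coprime (p ^ (j - 1)) (m div p ^ (j - 1))"
          using p by (metis coprime_power_left_iff prime_imp_coprime)
      qed
      moreover have "p dvd p ^ (j - 1)" using j2 by simp
      ultimately show ?thesis
        using t unitary_lcm by (intro exI[of _ "lcm t (p ^ (j - 1))"]) (auto intro: dvd_lcmI1 dvd_lcmI2)
    qed
  qed
  let ?P = "{p. prime p \<and> p dvd n}"
  have "finite ?P" by (rule finite_subset[OF _ finite_divisors_nat[OF n]]) auto
  then obtain t where "unitary t" "\<forall>p\<in>?P. p \<in> D \<longrightarrow> \<not> p dvd t \<longrightarrow> (\<forall>j. p ^ j \<in> D)"
    using ex[of ?P] by blast
  then show thesis by (intro that[of t]) auto
qed

text \<open>Away from \<open>t\<close> a prime that divides both \<open>n\<close> and a member of \<open>D\<close> occurs in \<open>D\<close> to all powers,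
  so it can be cancelled.\<close>

lemma strip:
  assumes t: "unitary t" and n: "0 < n"
    and inf: "\<And>p j. prime p \<Longrightarrow> p dvd n \<Longrightarrow> p \<in> D \<Longrightarrow> \<not> p dvd t \<Longrightarrow> p ^ j \<in> D"
    and x: "compat x" and nx: "\<And>m. m \<in> D \<Longrightarrow> coprime m t \<Longrightarrow> [int n * x m = z] (mod int m)"
  shows "\<exists>k z' d. 0 < d \<and> denom k t \<and> z = int d * z' \<and>
    (\<forall>m\<in>D. coprime m t \<longrightarrow> [int k * x m = z'] (mod int m))"
  using n inf nx
proof (induction n arbitrary: z rule: less_induct)
  case (less n)
  show ?case
  proof (cases "denom n t")
    case True
    then show ?thesis using less.prems(3) by (intro exI[of _ n] exI[of _ z] exI[of _ 1]) auto
  next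
    case False
    then obtain d where d: "d \<in> D" "d dvd n" "coprime d t" "d \<noteq> 1"
      using less.prems(1) by (auto simp: denom_def)
    then obtain p where p: "prime p" "p dvd d" using prime_factor_nat by blast
    have pD: "p \<in> D" using dvd[OF d(1) p(2)] .
    have pt: "coprime p t" using d(3) p(2) by (meson coprime_divisors dvd_refl)
    have pndt: "\<not> p dvd t" using pt p(1) by (metis coprime_absorb_left not_prime_unit)
    have pn: "p dvd n" using p(2) d(2) by (rule dvd_trans)
    have pj: "p ^ j \<in> D" for j by (rule less.prems(2)[OF p(1) pn pD pndt])
    obtain n' where n': "n = p * n'" using pn by blast
    have p1: "1 < p" using p(1) by (rule prime_gt_1_nat)
    have n'0: "0 < n'" "n' < n" using n' less.prems(1) p1 by auto
    have "[int n * x p = z] (mod int p)" using less.prems(3)[OF pD pt] .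
    then have "int p dvd z" by (simp add: n' cong_def mult.assoc mod_eq_0_iff_dvd)
    then obtain z' where z': "z = int p * z'" by blast
    have "[int n' * x m = z'] (mod int m)" if m: "m \<in> D" "coprime m t" for m
    proof -
      have m0: "0 < m" using pos[OF m(1)] .
      \<comment> \<open>Cancelling \<open>p\<close> costs a factor \<open>p\<close> of the modulus.
        The congruence is therefore taken modulo \<open>p * m\<close>, which stays in
        \<open>D\<close> because all powers of \<open>p\<close> do.\<close>
      have pm: "p * m \<in> D"
      proof -
        obtain a b where ab: "m = p ^ a * b" "\<not> p dvd b"
          using multiplicity_decompose'[of m p] m0 p(1) not_prime_unit by (metis neq0_conv)
        have "lcm m (p ^ Suc a) \<in> D" by (intro lcm m(1) pj)
        moreover have "p * m dvd lcm m (p ^ Suc a)"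
        proof -
          have "coprime (p ^ Suc a) b" using p(1) ab(2) by (metis coprime_power_left_iff prime_imp_coprime)
          then have "p ^ Suc a * b dvd lcm m (p ^ Suc a)"
            by (intro divides_mult) (auto simp: ab(1) intro: dvd_lcmI1)
          then show ?thesis by (simp add: ab(1) mult.assoc)
        qed
        ultimately show ?thesis by (rule dvd)
      qed
      have "coprime (p * m) t" using pt m(2) by simp
      then have "[int n * x (p * m) = z] (mod int (p * m))" by (rule less.prems(3)[OF pm])
      then have "[int p * (int n' * x (p * m)) = int p * z'] (mod int p * int m)"
        by (simp add: n' z' mult.assoc)
      then have "[int n' * x (p * m) = z'] (mod int m)"
        using p1 by (simp add: cong_iff_dvd_diff flip: right_diff_distrib)
      moreover have "[x (p * m) = x m] (mod int m)" by (rule compatD[OF x pm]) simp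
      then have "[int n' * x (p * m) = int n' * x m] (mod int m)" by (rule cong_scalar_left)
      ultimately show ?thesis by (metis cong_sym cong_trans)
    qed
    moreover have "q ^ j \<in> D" if "prime q" "q dvd n'" "q \<in> D" "\<not> q dvd t" for q j
      using less.prems(2)[OF that(1) _ that(3,4)] that(2) by (simp add: n')
    ultimately obtain k z'' d' where "0 < d'" "denom k t" "z' = int d' * z''"
      "\<forall>m\<in>D. coprime m t \<longrightarrow> [int k * x m = z''] (mod int m)"
      using less.IH[OF n'0(2,1)] by blast
    then show ?thesis using p1
      by (intro exI[of _ k] exI[of _ z''] exI[of _ "p * d'"]) (simp add: z' mult.assoc)
  qed
qed

text \<open>Cancelling the primes of \<open>n\<close> by \<open>strip\<close> leaves a denominator
  valid away from some \<open>t\<close>, and modulo \<open>t\<close> any residue is allowed.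
  Together with \<open>rat_multiple\<close> this characterises rational elements by having an
  integral multiple.\<close>

lemma ratI:
  assumes x: "compat x" and n: "0 < n" and nx: "\<And>m. m \<in> D \<Longrightarrow> [int n * x m = z] (mod int m)"
  shows "rat x"
proof -
  obtain t where t: "unitary t"
    "\<And>p j. prime p \<Longrightarrow> p dvd n \<Longrightarrow> p \<in> D \<Longrightarrow> \<not> p dvd t \<Longrightarrow> p ^ j \<in> D"
    using unitary_for[OF n] by blast
  obtain k z' where k: "denom k t" "\<forall>m\<in>D. coprime m t \<longrightarrow> [int k * x m = z'] (mod int m)"
    using strip[OF t(1) n t(2) x nx] by blast
  have t0: "0 < t" using t(1) pos by (simp add: unitary_def)
  have "z' = int (nat z') - int (nat (- z'))" by simp
  then have "rep (k, nat z', nat (- z'), t, nat (x t mod int t)) x"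
    unfolding rep.simps cong_lin using t k x t0 by (auto simp: cong_def)
  then show ?thesis unfolding rat_def by (rule exI)
qed

text \<open>Let \<open>t\<close> come from \<open>unitary_for\<close>. Away from \<open>t\<close>,
  each prime of \<open>n\<close> that occurs in \<open>D\<close> occurs to all powers and can be
  cancelled, so there is no \<open>n\<close>-torsion there. An element annihilated by
  \<open>n\<close> is therefore determined by its residue modulo \<open>t\<close>.\<close>

lemma torsion_detect:
  assumes n: "0 < n"
  obtains t where "t \<in> D"
    "\<And>x. compat x \<Longrightarrow> (\<And>m. m \<in> D \<Longrightarrow> [int n * x m = 0] (mod int m)) \<Longrightarrow>
       [x t = 0] (mod int t) \<Longrightarrow> eqv x (\<lambda>_. 0)"
proof -
  obtain t where t: "unitary t"
    "\<And>p j. prime p \<Longrightarrow> p dvd n \<Longrightarrow> p \<in> D \<Longrightarrow> \<not> p dvd t \<Longrightarrow> p ^ j \<in> D"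
    using unitary_for[OF n] by blast
  show thesis
  proof (rule that[of t])
    show "t \<in> D" using t(1) by (simp add: unitary_def)
    fix x assume x: "compat x" "\<And>m. m \<in> D \<Longrightarrow> [int n * x m = 0] (mod int m)" "[x t = 0] (mod int t)"
    \<comment> \<open>With right-hand side 0 the positive factor \<open>d\<close> forces
      \<open>z' = 0\<close>; this is why \<open>strip\<close> keeps track of
      \<open>d\<close>.\<close>
    obtain k z' d where k: "0 < d" "denom k t" "0 = int d * z'"
      "\<forall>m\<in>D. coprime m t \<longrightarrow> [int k * x m = z'] (mod int m)"
      using strip[OF t(1) n t(2) x(1,2)] by blast
    show "eqv x (\<lambda>_. 0)"
    proof (rule eqvI[OF t(1) x(1) compat_const x(3)])
      fix m assume m: "m \<in> D" "coprime m t"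
      have "[int k * x m = int k * 0] (mod int m)" using k m by simp
      moreover have "coprime (int k) (int m)" using denom_coprime[OF k(2) m] by simp
      ultimately show "[x m = 0] (mod int m)" by (metis cong_mult_lcancel)
    qed
  qed
qed

lemma rat_pure:
  assumes "c \<noteq> 0" "compat x" "rat (\<lambda>m. c * x m)" shows "rat x"
proof -
  obtain n z where n: "0 < n" "\<And>m. m \<in> D \<Longrightarrow> [int n * (c * x m) = z] (mod int m)"
    using rat_multiple[OF assms(3)] by blast
  show ?thesis
  proof (rule ratI[OF assms(2)])
    show "0 < n * nat \<bar>c\<bar>" using n assms by simp
    show "[int (n * nat \<bar>c\<bar>) * x m = sgn c * z] (mod int m)" if "m \<in> D" for m
    proof -
      have "int (n * nat \<bar>c\<bar>) = int n * \<bar>c\<bar>" by simp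
      then have eq: "int (n * nat \<bar>c\<bar>) * x m = sgn c * (int n * (c * x m))"
        using assms(1) by (cases "0 < c") (simp_all add: sgn_if)
      show ?thesis unfolding eq by (rule cong_scalar_left[OF n(2)[OF that]])
    qed
  qed
qed

text \<open>The rational elements form a pure subgroup, hence a direct summand of every finitely generated
  extension of it; the retraction may be prescribed modulo one member of \<open>D\<close>.\<close>

lemma retraction:
  assumes "finite J" "\<And>j. j \<in> J \<Longrightarrow> compat (\<alpha> j)" "t \<in> D"
  shows "\<exists>\<beta>. (\<forall>j\<in>J. rat (\<beta> j) \<and> [\<beta> j t = \<alpha> j t] (mod int t)) \<and>
    (\<forall>c :: 'j \<Rightarrow> int. rat (\<lambda>m. \<Sum>j\<in>J. c j * \<alpha> j m) \<longrightarrow>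
      (\<forall>m. (\<Sum>j\<in>J. c j * \<beta> j m) = (\<Sum>j\<in>J. c j * \<alpha> j m)))" (is "\<exists>\<beta>. ?P J \<alpha> \<beta>")
  using assms(1,2)
proof (induction "card J" arbitrary: J \<alpha> rule: less_induct)
  case (less J)
  \<comment> \<open>Given a nontrivial combination with rational value, elementary operations shrink
    its coefficients until only one is nonzero. Purity then makes the corresponding element
    rational, and it can be split off.\<close>
  have *: "\<exists>\<beta>. ?P J \<alpha> \<beta>"
    if "\<forall>j\<in>J. compat (\<alpha> j)" "\<exists>j\<in>J. c j \<noteq> 0" "rat (\<lambda>m. \<Sum>j\<in>J. c j * \<alpha> j m)" for c :: "'j \<Rightarrow> int" and \<alpha>
    using that
  proof (induction "nat (\<Sum>j\<in>J. \<bar>c j\<bar>)" arbitrary: c \<alpha> rule: less_induct)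
    case inner: less
    obtain i where i: "i \<in> J" "c i \<noteq> 0" using inner.prems by blast
    show ?case
    proof (cases "\<exists>j\<in>J. j \<noteq> i \<and> c j \<noteq> 0")
      case False
      have "(\<Sum>j\<in>J. c j * \<alpha> j m) = c i * \<alpha> i m" for m
        using False i less.prems(1) by (subst sum.remove[of _ i]) (auto intro!: sum.neutral)
      then have "rat (\<lambda>m. c i * \<alpha> i m)" using inner.prems(3) by simp
      then have rati: "rat (\<alpha> i)" using rat_pure i inner.prems(1) by blast
      have "card (J - {i}) < card J" using i(1) less.prems(1) by (intro card_Diff1_less)
      then have "\<exists>\<beta>. ?P (J - {i}) \<alpha> \<beta>"
        by (rule less.hyps) (use less.prems(1) inner.prems(1) in auto)
      then obtain \<beta> where \<beta>: "?P (J - {i}) \<alpha> \<beta>" by blast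
      have "?P J \<alpha> (\<beta>(i := \<alpha> i))"
      proof (intro conjI ballI allI impI)
        fix j assume "j \<in> J"
        then show "rat ((\<beta>(i := \<alpha> i)) j)" "[(\<beta>(i := \<alpha> i)) j t = \<alpha> j t] (mod int t)"
          using \<beta> rati by auto
      next
        fix d :: "'j \<Rightarrow> int" and m assume d: "rat (\<lambda>m. \<Sum>j\<in>J. d j * \<alpha> j m)"
        have split: "(\<Sum>j\<in>J. d j * \<gamma> j m) = d i * \<gamma> i m + (\<Sum>j\<in>J - {i}. d j * \<gamma> j m)" for \<gamma> m
          by (rule sum.remove[OF less.prems(1) i(1)])
        have "rat (\<lambda>m. (\<Sum>j\<in>J. d j * \<alpha> j m) - d i * \<alpha> i m)"
          by (rule rat_diff[OF d rat_scale[OF rati]])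
        then have "rat (\<lambda>m. \<Sum>j\<in>J - {i}. d j * \<alpha> j m)" by (simp add: split)
        then have "(\<Sum>j\<in>J - {i}. d j * \<beta> j m) = (\<Sum>j\<in>J - {i}. d j * \<alpha> j m)" using \<beta> by blast
        moreover have "(\<Sum>j\<in>J - {i}. d j * (\<beta>(i := \<alpha> i)) j m) = (\<Sum>j\<in>J - {i}. d j * \<beta> j m)"
          by (intro sum.cong) auto
        ultimately show "(\<Sum>j\<in>J. d j * (\<beta>(i := \<alpha> i)) j m) = (\<Sum>j\<in>J. d j * \<alpha> j m)"
          unfolding split by simp
      qed
      then show ?thesis by blast
    next
      case True
      then obtain i' where i': "i' \<in> J" "i' \<noteq> i" "c i' \<noteq> 0" by blast
      obtain a b where ab: "a \<in> J" "b \<in> J" "a \<noteq> b" "c a \<noteq> 0" "c b \<noteq> 0" "\<bar>c b\<bar> \<le> \<bar>c a\<bar>"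
        using i i' by (metis linear)
      text \<open>One step of the Euclidean algorithm on the coefficients.\<close>
      define s where "s = sgn (c a) * sgn (c b)"
      define \<gamma> where "\<gamma> = \<alpha>(b := \<lambda>m. \<alpha> b m + s * \<alpha> a m)"
      \<comment> \<open>The operation on the elements is compensated by the inverse operation on the
        coefficients, so the sum does not change. The sign \<open>s\<close> is chosen so that the
        larger coefficient loses the absolute value of the smaller one.\<close>
      have change: "(\<Sum>j\<in>J. d j * \<eta> j m) = (\<Sum>j\<in>J. (d(a := d a - s * d b)) j * (\<eta>(b := \<lambda>m. \<eta> b m + s * \<eta> a m)) j m)"
        for d :: "'j \<Rightarrow> int" and \<eta> :: "'j \<Rightarrow> nat \<Rightarrow> int" and m
      proof -
        have split: "(\<Sum>j\<in>J. f j) = f a + (f b + (\<Sum>j\<in>J - {a} - {b}. f j))" for f :: "'j \<Rightarrow> int"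
          using ab less.prems(1) by (subst sum.remove[of _ a], simp, simp, subst sum.remove[of _ b]) auto
        have "(\<Sum>j\<in>J - {a} - {b}. (d(a := d a - s * d b)) j * (\<eta>(b := \<lambda>m. \<eta> b m + s * \<eta> a m)) j m)
            = (\<Sum>j\<in>J - {a} - {b}. d j * \<eta> j m)" by (intro sum.cong) auto
        then show ?thesis unfolding split using ab(3) by (simp add: algebra_simps)
      qed
      define d where "d = c(a := c a - s * c b)"
      have "\<bar>d a\<bar> < \<bar>c a\<bar>"
        using ab(4-6) by (auto simp: d_def s_def sgn_if split: if_splits)
      then have less': "(\<Sum>j\<in>J. \<bar>d j\<bar>) < (\<Sum>j\<in>J. \<bar>c j\<bar>)"
        using ab(1) less.prems(1) by (intro sum_strict_mono_ex1) (auto simp: d_def)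
      moreover have "0 \<le> (\<Sum>j\<in>J. \<bar>d j\<bar>)" by (intro sum_nonneg) simp
      ultimately have nless: "nat (\<Sum>j\<in>J. \<bar>d j\<bar>) < nat (\<Sum>j\<in>J. \<bar>c j\<bar>)" by linarith
      have "compat (\<lambda>m. \<alpha> b m + s * \<alpha> a m)"
        using inner.prems(1) ab by (intro compat_add compat_mult compat_const) auto
      then have "\<forall>j\<in>J. compat (\<gamma> j)" using inner.prems(1) by (auto simp: \<gamma>_def)
      moreover have "\<exists>j\<in>J. d j \<noteq> 0" using ab by (auto simp: d_def intro!: bexI[of _ b])
      moreover have "rat (\<lambda>m. \<Sum>j\<in>J. d j * \<gamma> j m)"
        using inner.prems(3) unfolding change[of c \<alpha>] d_def \<gamma>_def .
      ultimately obtain \<beta> where \<beta>: "?P J \<gamma> \<beta>" using inner.hyps[OF nless] by blast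
      have cong: "[\<beta> j t = \<gamma> j t] (mod int t)" if "j \<in> J" for j using \<beta> that by blast
      define \<beta>' where "\<beta>' = \<beta>(b := \<lambda>m. \<beta> b m - s * \<beta> a m)"
      have \<beta>'\<beta>: "\<beta>'(b := \<lambda>m. \<beta>' b m + s * \<beta>' a m) = \<beta>"
        using ab(3) by (auto simp: \<beta>'_def fun_eq_iff)
      have "?P J \<alpha> \<beta>'"
      proof (intro conjI ballI allI impI)
        fix j assume j: "j \<in> J"
        show "rat (\<beta>' j)"
          using \<beta> j ab rat_diff[OF _ rat_scale, of "\<beta> b" "\<beta> a" s] by (auto simp: \<beta>'_def)
        show "[\<beta>' j t = \<alpha> j t] (mod int t)"
        proof (cases "j = b")
          case True
          have "[\<beta> b t = \<alpha> b t + s * \<alpha> a t] (mod int t)" "[\<beta> a t = \<alpha> a t] (mod int t)"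
            using cong[of a] cong[of b] ab(1-3) by (simp_all add: \<gamma>_def)
          then have "[\<beta> b t - s * \<beta> a t = \<alpha> b t + s * \<alpha> a t - s * \<alpha> a t] (mod int t)"
            by (intro cong_diff cong_mult cong_refl)
          then show ?thesis using True by (simp add: \<beta>'_def)
        next
          case False
          then show ?thesis using cong[OF j] by (simp add: \<beta>'_def \<gamma>_def)
        qed
      next
        fix e :: "'j \<Rightarrow> int" and m assume "rat (\<lambda>m. \<Sum>j\<in>J. e j * \<alpha> j m)"
        then have "rat (\<lambda>m. \<Sum>j\<in>J. (e(a := e a - s * e b)) j * \<gamma> j m)"
          unfolding change[of e \<alpha>] \<gamma>_def .
        then have "(\<Sum>j\<in>J. (e(a := e a - s * e b)) j * \<beta> j m) = (\<Sum>j\<in>J. (e(a := e a - s * e b)) j * \<gamma> j m)"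
          using \<beta> by blast
        then show "(\<Sum>j\<in>J. e j * \<beta>' j m) = (\<Sum>j\<in>J. e j * \<alpha> j m)"
          unfolding change[of e \<alpha>] change[of e \<beta>'] \<beta>'\<beta> \<gamma>_def .
      qed
      then show ?thesis by blast
    qed
  qed
  show ?case
  proof (cases "\<exists>c :: 'j \<Rightarrow> int. (\<exists>j\<in>J. c j \<noteq> 0) \<and> rat (\<lambda>m. \<Sum>j\<in>J. c j * \<alpha> j m)")
    case True
    then show ?thesis using * less.prems(2) by blast
  next
    case False
    \<comment> \<open>Only the trivial combination is rational here, so every choice respects the
      rational combinations; the constants \<open>\<alpha> j t\<close> also have the prescribed
      residues.\<close>
    have "?P J \<alpha> (\<lambda>j _. \<alpha> j t)"
    proof (intro conjI ballI allI impI)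
      fix c :: "'j \<Rightarrow> int" and m assume "rat (\<lambda>m. \<Sum>j\<in>J. c j * \<alpha> j m)"
      then have "\<forall>j\<in>J. c j = 0" using False by blast
      then show "(\<Sum>j\<in>J. c j * \<alpha> j t) = (\<Sum>j\<in>J. c j * \<alpha> j m)" by simp
    qed (simp_all add: rat_const)
    then show ?thesis by (rule exI[of _ "\<lambda>j _. \<alpha> j t"])
  qed
qed

section \<open>Linear systems over the rational elements\<close>

lemma common_multiple:
  assumes "finite I" "\<And>i. i \<in> I \<Longrightarrow> rat (x i)"
  shows "\<exists>n Z. 0 < n \<and> (\<forall>i\<in>I. \<forall>m\<in>D. [int n * x i m = Z i] (mod int m))"
  using assms
proof (induction I rule: finite_induct)
  case empty
  then show ?case by (intro exI[of _ 1]) auto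
next
  case (insert i I)
  then obtain n Z where n: "0 < n" "\<forall>j\<in>I. \<forall>m\<in>D. [int n * x j m = Z j] (mod int m)" by auto
  obtain n' z where n': "0 < n'" "\<And>m. m \<in> D \<Longrightarrow> [int n' * x i m = z] (mod int m)"
    using rat_multiple insert.prems by blast
  have "[int (n * n') * x j m = ((\<lambda>j. int n' * Z j)(i := int n * z)) j] (mod int m)"
    if "j \<in> insert i I" "m \<in> D" for j m
  proof (cases "j = i")
    case True
    then show ?thesis using cong_scalar_left[OF n'(2)[OF that(2)], of "int n"] by (simp add: mult.assoc)
  next
    case False
    then have "[int n * x j m = Z j] (mod int m)" using n(2) that by simp
    then show ?thesis using False cong_scalar_left[of _ _ _ "int n'"] by (simp add: mult.assoc mult.left_commute)
  qed
  then show ?case using n(1) n'(1)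
    by (intro exI[of _ "n * n'"] exI[of _ "(\<lambda>j. int n' * Z j)(i := int n * z)"]) auto
qed

text \<open>After multiplication by a common \<open>n\<close> the coefficients are integers
  \<open>Z\<close>, and the given solution satisfies integral relations with rational values. The
  retraction preserves these, so for its image \<open>\<beta>\<close> each equation holds up to an
  error annihilated by \<open>n\<close>. Modulo the \<open>t\<close> of
  \<open>torsion_detect\<close> the families \<open>\<beta>\<close> and \<open>\<alpha>\<close>
  agree, so the error is 0 there and hence everywhere.\<close>

lemma linear_system:
  fixes r :: "'e \<Rightarrow> 'j \<Rightarrow> nat \<Rightarrow> int" and b :: "'e \<Rightarrow> nat \<Rightarrow> int"
  assumes J: "finite J" and E: "finite E"
    and r: "\<And>e j. e \<in> E \<Longrightarrow> j \<in> J \<Longrightarrow> rat (r e j)" and b: "\<And>e. e \<in> E \<Longrightarrow> rat (b e)"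
    and \<alpha>: "\<And>j. j \<in> J \<Longrightarrow> compat (\<alpha> j)"
    and eq: "\<And>e. e \<in> E \<Longrightarrow> eqv (\<lambda>m. \<Sum>j\<in>J. r e j m * \<alpha> j m) (b e)"
  obtains \<beta> where "\<And>j. j \<in> J \<Longrightarrow> rat (\<beta> j)"
    "\<And>e. e \<in> E \<Longrightarrow> eqv (\<lambda>m. \<Sum>j\<in>J. r e j m * \<beta> j m) (b e)"
proof -
  let ?x = "\<lambda>i. case i of (e, None) \<Rightarrow> b e | (e, Some j) \<Rightarrow> r e j"
  have "\<exists>n Z. 0 < n \<and> (\<forall>i\<in>E \<times> (insert None (Some ` J)). \<forall>m\<in>D. [int n * ?x i m = Z i] (mod int m))"
    by (rule common_multiple) (use J E r b in auto)
  then obtain n Z where n: "0 < n"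
    and Z: "\<And>i m. i \<in> E \<times> (insert None (Some ` J)) \<Longrightarrow> m \<in> D \<Longrightarrow> [int n * ?x i m = Z i] (mod int m)"
    by blast
  have Zr: "[int n * r e j m = Z (e, Some j)] (mod int m)" if "e \<in> E" "j \<in> J" "m \<in> D" for e j m
    using Z[of "(e, Some j)" m] that by simp
  have Zb: "[int n * b e m = Z (e, None)] (mod int m)" if "e \<in> E" "m \<in> D" for e m
    using Z[of "(e, None)" m] that by simp
  obtain t where t: "t \<in> D"
    "\<And>x. compat x \<Longrightarrow> (\<And>m. m \<in> D \<Longrightarrow> [int n * x m = 0] (mod int m)) \<Longrightarrow>
       [x t = 0] (mod int t) \<Longrightarrow> eqv x (\<lambda>_. 0)"
    using torsion_detect[OF n] by blast
  obtain \<beta> where \<beta>: "\<And>j. j \<in> J \<Longrightarrow> rat (\<beta> j)" "\<And>j. j \<in> J \<Longrightarrow> [\<beta> j t = \<alpha> j t] (mod int t)"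
    "\<And>c m. rat (\<lambda>m. \<Sum>j\<in>J. c j * \<alpha> j m) \<Longrightarrow> (\<Sum>j\<in>J. c j * \<beta> j m) = (\<Sum>j\<in>J. c j * \<alpha> j m)"
    using retraction[OF J _ t(1), of \<alpha>] \<alpha> by blast
  show thesis
  proof (rule that[OF \<beta>(1)])
    fix e assume e: "e \<in> E"
    have scaled: "[int n * (\<Sum>j\<in>J. r e j m * \<eta> j m) = (\<Sum>j\<in>J. Z (e, Some j) * \<eta> j m)] (mod int m)"
      if "m \<in> D" for \<eta> m
      unfolding sum_distrib_left mult.assoc[symmetric]
      by (intro cong_sum cong_mult cong_refl Zr e that)
    have Z\<alpha>: "[(\<Sum>j\<in>J. Z (e, Some j) * \<alpha> j m) = Z (e, None)] (mod int m)" if m: "m \<in> D" for m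
    proof -
      have "[int n * (\<Sum>j\<in>J. r e j m * \<alpha> j m) = int n * b e m] (mod int m)"
        using eq[OF e] m by (intro cong_scalar_left) (simp add: eqv_def)
      then show ?thesis using scaled[OF m, of \<alpha>] Zb[OF e m] by (metis cong_sym cong_trans)
    qed
    have "rat (\<lambda>m. \<Sum>j\<in>J. Z (e, Some j) * \<alpha> j m)"
    proof (rule ratI[of _ 1 "Z (e, None)"])
      show "compat (\<lambda>m. \<Sum>j\<in>J. Z (e, Some j) * \<alpha> j m)"
        by (intro compat_sum compat_mult compat_const \<alpha>)
    qed (use Z\<alpha> in auto)
    from \<beta>(3)[OF this] have same: "(\<Sum>j\<in>J. Z (e, Some j) * \<beta> j m) = (\<Sum>j\<in>J. Z (e, Some j) * \<alpha> j m)" for m .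
    let ?x = "\<lambda>m. (\<Sum>j\<in>J. r e j m * \<beta> j m) - b e m"
    have "eqv ?x (\<lambda>_. 0)"
    proof (rule t(2))
      show "compat ?x"
        by (intro compat_diff compat_sum compat_mult rat_compat r b \<beta>(1) e)
      show "[int n * ?x m = 0] (mod int m)" if m: "m \<in> D" for m
      proof -
        have "[int n * (\<Sum>j\<in>J. r e j m * \<beta> j m) - int n * b e m
            = (\<Sum>j\<in>J. Z (e, Some j) * \<beta> j m) - Z (e, None)] (mod int m)"
          by (intro cong_diff scaled Zb e m)
        also have "[(\<Sum>j\<in>J. Z (e, Some j) * \<beta> j m) - Z (e, None) = Z (e, None) - Z (e, None)] (mod int m)"
          unfolding same by (intro cong_diff cong_refl Z\<alpha> m)
        finally show ?thesis by (simp add: right_diff_distrib)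
      qed
      have "[?x t = (\<Sum>j\<in>J. r e j t * \<alpha> j t) - b e t] (mod int t)"
        by (intro cong_diff cong_sum cong_mult cong_refl \<beta>(2))
      also have "[(\<Sum>j\<in>J. r e j t * \<alpha> j t) - b e t = b e t - b e t] (mod int t)"
        using eq[OF e] t(1) by (intro cong_diff cong_refl) (simp add: eqv_def)
      finally show "[?x t = 0] (mod int t)" by simp
    qed
    then show "eqv (\<lambda>m. \<Sum>j\<in>J. r e j m * \<beta> j m) (b e)"
      by (simp add: eqv_def cong_iff_dvd_diff)
  qed
qed

end

section \<open>Commutative images of rational languages\<close>

fun int_span :: "(nat \<Rightarrow> int) list \<Rightarrow> (nat \<Rightarrow> int) set" where
  "int_span [] = {\<lambda>_. 0}"
| "int_span (h # hs) = {\<lambda>a. c * h a + v a | c v. v \<in> int_span hs}"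

lemma int_span_0: "(\<lambda>_. 0) \<in> int_span hs"
proof (induction hs)
  case (Cons h hs)
  then show ?case by (auto intro!: exI[of _ 0] exI[of _ "\<lambda>_. 0"])
qed simp

lemma int_span_add: "v \<in> int_span hs \<Longrightarrow> w \<in> int_span hs \<Longrightarrow> (\<lambda>a. v a + w a) \<in> int_span hs"
proof (induction hs arbitrary: v w)
  case (Cons h hs)
  then obtain c v' d w' where "v = (\<lambda>a. c * h a + v' a)" "v' \<in> int_span hs"
    "w = (\<lambda>a. d * h a + w' a)" "w' \<in> int_span hs" by auto
  then show ?case using Cons.IH[of v' w']
    by (auto simp: algebra_simps intro!: exI[of _ "c + d"] exI[of _ "\<lambda>a. v' a + w' a"])
qed simp

lemma int_span_mem: "h \<in> set hs \<Longrightarrow> h \<in> int_span hs"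
proof (induction hs)
  case (Cons h' hs)
  show ?case
  proof (cases "h = h'")
    case True
    then show ?thesis using int_span_0[of hs] by (auto intro!: exI[of _ 1] exI[of _ "\<lambda>_. 0"])
  next
    case False
    then show ?thesis using Cons by (auto intro!: exI[of _ 0] exI[of _ h])
  qed
qed simp

lemma int_span_append:
  "v \<in> int_span (hs @ hs') \<longleftrightarrow> (\<exists>x\<in>int_span hs. \<exists>y\<in>int_span hs'. v = (\<lambda>a. x a + y a))"
proof (induction hs arbitrary: v)
  case (Cons h hs)
  show ?case
  proof
    assume "v \<in> int_span ((h # hs) @ hs')"
    then obtain c w where "v = (\<lambda>a. c * h a + w a)" "w \<in> int_span (hs @ hs')" by auto
    then obtain x y where "x \<in> int_span hs" "y \<in> int_span hs'" "v = (\<lambda>a. (c * h a + x a) + y a)"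
      using Cons.IH[of w] by (auto simp: algebra_simps)
    then show "\<exists>x\<in>int_span (h # hs). \<exists>y\<in>int_span hs'. v = (\<lambda>a. x a + y a)"
      by (intro bexI[of _ "\<lambda>a. c * h a + x a"] bexI[of _ y]) auto
  next
    assume "\<exists>x\<in>int_span (h # hs). \<exists>y\<in>int_span hs'. v = (\<lambda>a. x a + y a)"
    then obtain c x y where "x \<in> int_span hs" "y \<in> int_span hs'" "v = (\<lambda>a. c * h a + x a + y a)"
      by auto
    then show "v \<in> int_span ((h # hs) @ hs')"
      using Cons.IH[of "\<lambda>a. x a + y a"]
      by (auto simp: algebra_simps intro!: exI[of _ c] exI[of _ "\<lambda>a. x a + y a"])
  qed
qed simp

lemma int_span_induct:
  assumes "v \<in> int_span hs" "P (\<lambda>_. 0)" "\<And>v w. P v \<Longrightarrow> P w \<Longrightarrow> P (\<lambda>a. v a + w a)"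
    and neg: "\<And>v. P v \<Longrightarrow> P (\<lambda>a. - v a)" and "\<And>h. h \<in> set hs \<Longrightarrow> P h"
  shows "P v"
  using assms(1,5)
proof (induction hs arbitrary: v)
  case Nil
  then show ?case using assms(2) by simp
next
  case (Cons h hs)
  have nat: "P (\<lambda>a. int n * h a)" for n
  proof (induction n)
    case (Suc n)
    then show ?case using assms(3)[OF Cons.prems(2)[of h] Suc] by (simp add: algebra_simps)
  qed (use assms(2) in simp)
  have "P (\<lambda>a. c * h a)" for c
  proof (cases "0 \<le> c")
    case True
    then show ?thesis using nat[of "nat c"] by simp
  next
    case False
    then show ?thesis using neg[OF nat[of "nat (- c)"]] by simp
  qed
  then show ?case using Cons assms(3) by fastforce
qed

lemma int_span_sum: "v \<in> int_span hs \<longleftrightarrow> (\<exists>c. v = (\<lambda>a. \<Sum>i<length hs. c i * (hs ! i) a))"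
proof (induction hs arbitrary: v)
  case (Cons h hs)
  show ?case
  proof
    assume "v \<in> int_span (h # hs)"
    then obtain c d where "v = (\<lambda>a. c * h a + (\<Sum>i<length hs. d i * (hs ! i) a))"
      using Cons.IH by auto
    then show "\<exists>c. v = (\<lambda>a. \<Sum>i<length (h # hs). c i * ((h # hs) ! i) a)"
      by (intro exI[of _ "case_nat c d"]) (simp add: sum.lessThan_Suc_shift del: sum.lessThan_Suc)
  next
    assume "\<exists>c. v = (\<lambda>a. \<Sum>i<length (h # hs). c i * ((h # hs) ! i) a)"
    then obtain c where "v = (\<lambda>a. c 0 * h a + (\<Sum>i<length hs. c (Suc i) * (hs ! i) a))"
      by (auto simp: sum.lessThan_Suc_shift simp del: sum.lessThan_Suc)
    moreover have "(\<lambda>a. \<Sum>i<length hs. c (Suc i) * (hs ! i) a) \<in> int_span hs"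
      unfolding Cons.IH by (intro exI[of _ "\<lambda>i. c (Suc i)"]) simp
    ultimately show "v \<in> int_span (h # hs)" by auto
  qed
qed auto

text \<open>Only profinite closures matter, so cosets of subgroups replace the linear sets of Parikh's theorem.\<close>

definition semilinear :: "nat list set \<Rightarrow> ((nat \<Rightarrow> int) \<times> (nat \<Rightarrow> int) list) set \<Rightarrow> bool" where
  "semilinear L F \<longleftrightarrow> finite F \<and>
     (\<forall>u\<in>nonempty_words L. \<exists>g hs v. (g, hs) \<in> F \<and> v \<in> int_span hs \<and>
        (\<forall>a. int (count_list u a) = g a + v a)) \<and>
     (\<forall>g hs v. \<forall>m>0. (g, hs) \<in> F \<longrightarrow> v \<in> int_span hs \<longrightarrow>
        (\<exists>u\<in>nonempty_words L. \<forall>a. [int (count_list u a) = g a + v a] (mod int m)))"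

lemma semilinear_cover:
  assumes "semilinear L F" "u \<in> nonempty_words L"
  obtains g hs v where "(g, hs) \<in> F" "v \<in> int_span hs" "\<And>a. int (count_list u a) = g a + v a"
  using assms unfolding semilinear_def by meson

lemma semilinear_dense:
  assumes "semilinear L F" "(g, hs) \<in> F" "v \<in> int_span hs" "0 < m"
  obtains u where "u \<in> nonempty_words L" "\<And>a. [int (count_list u a) = g a + v a] (mod int m)"
  using assms unfolding semilinear_def by meson

lemma semilinearI:
  assumes "finite F"
    and "\<And>u. u \<in> nonempty_words L \<Longrightarrow> \<exists>g hs v. (g, hs) \<in> F \<and> v \<in> int_span hs \<and>
        (\<forall>a. int (count_list u a) = g a + v a)"
    and "\<And>g hs v m. 0 < m \<Longrightarrow> (g, hs) \<in> F \<Longrightarrow> v \<in> int_span hs \<Longrightarrow>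
        \<exists>u\<in>nonempty_words L. \<forall>a. [int (count_list u a) = g a + v a] (mod int m)"
  shows "semilinear L F"
  using assms unfolding semilinear_def by blast

lemma semilinear_union:
  assumes K: "semilinear K F" and L: "semilinear L G" shows "semilinear (K \<union> L) (F \<union> G)"
proof (rule semilinearI)
  show "finite (F \<union> G)" using K L by (simp add: semilinear_def)
  fix u assume "u \<in> nonempty_words (K \<union> L)"
  then consider "u \<in> nonempty_words K" | "u \<in> nonempty_words L" by (auto simp: nonempty_words_def)
  then show "\<exists>g hs v. (g, hs) \<in> F \<union> G \<and> v \<in> int_span hs \<and> (\<forall>a. int (count_list u a) = g a + v a)"
  proof cases
    case 1
    show ?thesis by (rule semilinear_cover[OF K 1]) blast
  next
    case 2
    show ?thesis by (rule semilinear_cover[OF L 2]) blast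
  qed
next
  fix g hs v and m :: nat assume m: "0 < m" and g: "(g, hs) \<in> F \<union> G" and v: "v \<in> int_span hs"
  have sub: "nonempty_words K \<subseteq> nonempty_words (K \<union> L)" "nonempty_words L \<subseteq> nonempty_words (K \<union> L)"
    by (auto simp: nonempty_words_def)
  from g consider "(g, hs) \<in> F" | "(g, hs) \<in> G" by blast
  then show "\<exists>u\<in>nonempty_words (K \<union> L). \<forall>a. [int (count_list u a) = g a + v a] (mod int m)"
  proof cases
    case 1
    show ?thesis by (rule semilinear_dense[OF K 1 v m]) (use sub in blast)
  next
    case 2
    show ?thesis by (rule semilinear_dense[OF L 2 v m]) (use sub in blast)
  qed
qed

lemma semilinear_product:
  assumes K: "semilinear K F" and L: "semilinear L G"
  shows "\<exists>H. semilinear {u @ v | u v. u \<in> K \<and> v \<in> L} H"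
proof -
  let ?KL = "{u @ v | u v. u \<in> K \<and> v \<in> L}"
  define H where "H = (\<lambda>((g, hs), (g', hs')). (\<lambda>a. g a + g' a :: int, hs @ hs')) ` (F \<times> G)"
  have H: "(g'', hs'') \<in> H \<longleftrightarrow> (\<exists>g hs g' hs'. (g, hs) \<in> F \<and> (g', hs') \<in> G \<and>
      g'' = (\<lambda>a. g a + g' a) \<and> hs'' = hs @ hs')" for g'' hs''
  proof
    assume "\<exists>g hs g' hs'. (g, hs) \<in> F \<and> (g', hs') \<in> G \<and> g'' = (\<lambda>a. g a + g' a) \<and> hs'' = hs @ hs'"
    then obtain g hs g' hs' where "(g, hs) \<in> F" "(g', hs') \<in> G" "g'' = (\<lambda>a. g a + g' a)" "hs'' = hs @ hs'"
      by blast
    then show "(g'', hs'') \<in> H" unfolding H_def by (intro image_eqI[of _ _ "((g, hs), (g', hs'))"]) auto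
  qed (auto simp: H_def)
  \<comment> \<open>\<open>semilinear\<close> ignores the empty word, so products with one empty
    factor contribute the cosets of the other language on their own.\<close>
  let ?G = "if [] \<in> K then G else {}" and ?F = "if [] \<in> L then F else {}"
  have "semilinear ?KL (H \<union> ?G \<union> ?F)"
  proof (rule semilinearI)
    show "finite (H \<union> ?G \<union> ?F)" using K L by (auto simp: semilinear_def H_def)
    fix w assume "w \<in> nonempty_words ?KL"
    then obtain u v where uv: "w = u @ v" "u \<in> K" "v \<in> L" "u \<noteq> [] \<or> v \<noteq> []"
      by (auto simp: nonempty_words_def)
    consider "u \<noteq> []" "v \<noteq> []" | "u = []" "v \<noteq> []" | "u \<noteq> []" "v = []" using uv by blast
    then show "\<exists>g hs x. (g, hs) \<in> H \<union> ?G \<union> ?F \<and> x \<in> int_span hs \<and> (\<forall>a. int (count_list w a) = g a + x a)"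
    proof cases
      case 1
      then have u: "u \<in> nonempty_words K" and v: "v \<in> nonempty_words L"
        using uv by (auto simp: nonempty_words_def)
      obtain g hs x where 1: "(g, hs) \<in> F" "x \<in> int_span hs" "\<And>a. int (count_list u a) = g a + x a"
        by (rule semilinear_cover[OF K u]) (rule that; blast)
      obtain g' hs' y where 2: "(g', hs') \<in> G" "y \<in> int_span hs'" "\<And>a. int (count_list v a) = g' a + y a"
        by (rule semilinear_cover[OF L v]) (rule that; blast)
      have "(\<lambda>a. g a + g' a, hs @ hs') \<in> H" unfolding H using 1(1) 2(1) by blast
      moreover have "(\<lambda>a. x a + y a) \<in> int_span (hs @ hs')" using 1(2) 2(2) int_span_append by blast
      moreover have "int (count_list w a) = (g a + g' a) + (x a + y a)" for a
        using 1(3) 2(3) uv(1) by simp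
      ultimately show ?thesis by (intro exI[of _ "\<lambda>a. g a + g' a"] exI[of _ "hs @ hs'"] exI[of _ "\<lambda>a. x a + y a"]) simp
    next
      case 2
      then have "v \<in> nonempty_words L" "w = v" "[] \<in> K" using uv by (auto simp: nonempty_words_def)
      then show ?thesis by (auto elim!: semilinear_cover[OF L])
    next
      case 3
      then have "u \<in> nonempty_words K" "w = u" "[] \<in> L" using uv by (auto simp: nonempty_words_def)
      then show ?thesis by (auto elim!: semilinear_cover[OF K])
    qed
  next
    fix g hs z and m :: nat assume m: "0 < m" and g: "(g, hs) \<in> H \<union> ?G \<union> ?F" and z: "z \<in> int_span hs"
    from g consider "(g, hs) \<in> H" | "[] \<in> K" "(g, hs) \<in> G" | "[] \<in> L" "(g, hs) \<in> F"
      by (auto split: if_splits)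
    then show "\<exists>u\<in>nonempty_words ?KL. \<forall>a. [int (count_list u a) = g a + z a] (mod int m)"
    proof cases
      case 1
      then obtain g1 hs1 g2 hs2 where 1: "(g1, hs1) \<in> F" "(g2, hs2) \<in> G"
        "g = (\<lambda>a. g1 a + g2 a)" "hs = hs1 @ hs2" unfolding H by blast
      obtain x y where xy: "x \<in> int_span hs1" "y \<in> int_span hs2" "z = (\<lambda>a. x a + y a)"
        using z 1(4) int_span_append by blast
      obtain u where u: "u \<in> nonempty_words K" "\<And>a. [int (count_list u a) = g1 a + x a] (mod int m)"
        by (rule semilinear_dense[OF K 1(1) xy(1) m]) (rule that; blast)
      obtain v where v: "v \<in> nonempty_words L" "\<And>a. [int (count_list v a) = g2 a + y a] (mod int m)"
        by (rule semilinear_dense[OF L 1(2) xy(2) m]) (rule that; blast)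
      have "[int (count_list (u @ v) a) = g a + z a] (mod int m)" for a
        using cong_add[OF u(2)[of a] v(2)[of a]] by (simp add: 1(3) xy(3) algebra_simps)
      moreover have "u @ v \<in> nonempty_words ?KL" using u(1) v(1) by (auto simp: nonempty_words_def)
      ultimately show ?thesis by blast
    next
      case 2
      obtain v where v: "v \<in> nonempty_words L" "\<And>a. [int (count_list v a) = g a + z a] (mod int m)"
        by (rule semilinear_dense[OF L 2(2) z m]) (rule that; blast)
      moreover have "v \<in> nonempty_words ?KL" using v(1) 2(1) by (force simp: nonempty_words_def)
      ultimately show ?thesis by blast
    next
      case 3
      obtain v where v: "v \<in> nonempty_words K" "\<And>a. [int (count_list v a) = g a + z a] (mod int m)"
        by (rule semilinear_dense[OF K 3(2) z m]) (rule that; blast)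
      moreover have "v \<in> nonempty_words ?KL" using v(1) 3(1) by (force simp: nonempty_words_def)
      ultimately show ?thesis by blast
    qed
  qed
  then show ?thesis by blast
qed

text \<open>Modulo \<open>m\<close> a nonempty set closed under addition is a subgroup. The counts
  of words in the star are therefore dense in the subgroup \<open>H\<close> generated by all base
  points and periods of \<open>L\<close>, and a single coset suffices. If \<open>F\<close> is empty,
  the star has no nonempty word.\<close>

lemma semilinear_star:
  assumes L: "semilinear L F"
  shows "\<exists>G. semilinear {concat us | us. set us \<subseteq> L} G"
proof (cases "F = {}")
  case True
  then have "nonempty_words L = {}" using L by (auto simp: semilinear_def)
  then have "concat us = []" if "set us \<subseteq> L" for us
    using that by (induction us) (auto simp: nonempty_words_def)
  then have "nonempty_words {concat us | us. set us \<subseteq> L} = {}" by (auto simp: nonempty_words_def)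
  then show ?thesis by (intro exI[of _ "{}"]) (simp add: semilinear_def)
next
  case False
  have "finite F" using L by (simp add: semilinear_def)
  then obtain fs where fs: "set fs = F" using finite_list by blast
  define H where "H = concat (map (\<lambda>(g, hs). g # hs) fs)"
  let ?S = "{concat us | us. set us \<subseteq> L}"
  have memH: "g \<in> int_span H" "set hs \<subseteq> int_span H" if "(g, hs) \<in> F" for g hs
    using that int_span_mem[of _ H] by (force simp: H_def fs)+
  have neg: "(\<lambda>a. - v a) \<in> int_span hs" if "v \<in> int_span hs" for v hs
    using that
  proof (induction hs arbitrary: v)
    case (Cons h hs)
    then obtain c w where "v = (\<lambda>a. c * h a + w a)" "w \<in> int_span hs" by auto
    then show ?case using Cons.IH[of w] by (auto intro!: exI[of _ "- c"] exI[of _ "\<lambda>a. - w a"])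
  qed simp
  have subH: "v \<in> int_span H" if "(g, hs) \<in> F" "v \<in> int_span hs" for g hs v
    by (rule int_span_induct[OF that(2)])
       (use int_span_0 int_span_add neg memH(2)[OF that(1)] in auto)
  have in_span: "(\<lambda>a. int (count_list (concat us) a)) \<in> int_span H" if "set us \<subseteq> L" for us
    using that
  proof (induction us)
    case Nil
    then show ?case using int_span_0 by simp
  next
    case (Cons u us)
    have "(\<lambda>a. int (count_list u a)) \<in> int_span H"
    proof (cases "u = []")
      case True
      then show ?thesis using int_span_0 by simp
    next
      case False
      then have "u \<in> nonempty_words L" using Cons.prems by (simp add: nonempty_words_def)
      then obtain g hs v where v: "(g, hs) \<in> F" "v \<in> int_span hs" "\<And>a. int (count_list u a) = g a + v a"
        by (rule semilinear_cover[OF L]) (rule that; blast)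
      then show ?thesis using int_span_add[OF memH(1)[OF v(1)] subH[OF v(1,2)]] by simp
    qed
    then show ?case using int_span_add[OF _ Cons.IH] Cons.prems by simp
  qed
  have dense: "\<exists>u\<in>nonempty_words ?S. \<forall>a. [int (count_list u a) = v a] (mod int m)"
    if v: "v \<in> int_span H" and m: "0 < m" for v and m :: nat
  proof -
    define P where "P = (\<lambda>v :: nat \<Rightarrow> int. \<exists>u\<in>nonempty_words ?S. \<forall>a. [int (count_list u a) = v a] (mod int m))"
    have add: "P (\<lambda>a. v a + w a)" if vw: "P v" "P w" for v w
    proof -
      obtain us ws where u: "set us \<subseteq> L" "concat us \<noteq> []" "\<forall>a. [int (count_list (concat us) a) = v a] (mod int m)"
        and w: "set ws \<subseteq> L" "concat ws \<noteq> []" "\<forall>a. [int (count_list (concat ws) a) = w a] (mod int m)"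
        using vw unfolding P_def nonempty_words_def by blast
      have "concat (us @ ws) \<in> nonempty_words ?S"
        using u(1,2) w(1) unfolding nonempty_words_def by fastforce
      moreover have "[int (count_list (concat (us @ ws)) a) = v a + w a] (mod int m)" for a
        using cong_add[OF u(3)[rule_format, of a] w(3)[rule_format, of a]] by simp
      ultimately show ?thesis unfolding P_def by blast
    qed
    have cong: "P w" if "P v" "\<And>a. [v a = w a] (mod int m)" for v w
      using that unfolding P_def by (meson cong_trans)
    have mult: "P (\<lambda>a. int (Suc n) * v a)" if "P v" for v n
    proof (induction n)
      case (Suc n)
      then show ?case using add[OF that Suc] by (simp add: algebra_simps)
    qed (use that in simp)
    have zero: "P (\<lambda>_. 0)" if "P v" for v
    proof (rule cong[OF mult[OF that, of "m - 1"]])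
      show "[int (Suc (m - 1)) * v a = 0] (mod int m)" for a using m by (simp add: cong_def)
    qed
    \<comment> \<open>\<open>2 * m - 1\<close> copies give the inverse, because
      \<open>2 * m - 1\<close> is positive and congruent to -1 modulo \<open>m\<close>.\<close>
    have neg: "P (\<lambda>a. - v a)" if "P v" for v
    proof (rule cong[OF mult[OF that, of "2 * m - 2"]])
      have "int (Suc (2 * m - 2)) = 2 * int m - 1" using m by linarith
      then show "[int (Suc (2 * m - 2)) * v a = - v a] (mod int m)" for a
        by (simp add: cong_iff_dvd_diff algebra_simps)
    qed
    have base: "P (\<lambda>a. g a + w a)" if gw: "(g, hs) \<in> F" "w \<in> int_span hs" for g hs w
    proof -
      obtain u where u: "u \<in> nonempty_words L" "\<And>a. [int (count_list u a) = g a + w a] (mod int m)"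
        by (rule semilinear_dense[OF L gw m]) (rule that; blast)
      then have "concat [u] \<in> nonempty_words ?S"
        unfolding nonempty_words_def by (intro CollectI conjI exI[of _ "[u]"]) auto
      then show ?thesis using u(2) unfolding P_def by (intro bexI[of _ "concat [u]"]) auto
    qed
    have g: "P g" if "(g, hs) \<in> F" for g hs
      using base[OF that int_span_0] by simp
    \<comment> \<open>A period is the difference of two elements of the coset, \<open>g + h\<close>
      and \<open>g\<close>.\<close>
    have h: "P h" if "(g, hs) \<in> F" "h \<in> set hs" for g hs h
      using add[OF base[OF that(1) int_span_mem[OF that(2)]] neg[OF g[OF that(1)]]] by simp
    have "P v"
    proof (rule int_span_induct[OF v _ add neg])
      obtain g hs where "(g, hs) \<in> F" using False by auto
      then show "P (\<lambda>_. 0)" using zero g by blast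
      show "P x" if "x \<in> set H" for x using that g h by (auto simp: H_def fs)
    qed
    then show ?thesis by (simp only: P_def)
  qed
  have "semilinear ?S {(\<lambda>_. 0, H)}"
  proof (rule semilinearI)
    fix u assume "u \<in> nonempty_words ?S"
    then obtain us where "u = concat us" "set us \<subseteq> L" by (auto simp: nonempty_words_def)
    then show "\<exists>g hs v. (g, hs) \<in> {(\<lambda>_. 0, H)} \<and> v \<in> int_span hs \<and> (\<forall>a. int (count_list u a) = g a + v a)"
      using in_span by auto
  qed (use dense in auto)
  then show ?thesis by blast
qed

lemma rational_semilinear: "rational A L \<Longrightarrow> \<exists>F. semilinear L F"
proof (induction rule: rational.induct)
  case empty
  show ?case by (intro exI[of _ "{}"]) (simp add: semilinear_def nonempty_words_def)
next
  case epsilon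
  show ?case by (intro exI[of _ "{}"]) (simp add: semilinear_def nonempty_words_def)
next
  case (symbol a)
  show ?case
    by (intro exI[of _ "{(\<lambda>b. of_bool (a = b), [])}"]) (simp add: semilinear_def nonempty_words_def)
next
  case (union K L)
  then show ?case using semilinear_union by blast
next
  case (product K L)
  then show ?case by (elim exE) (rule semilinear_product)
next
  case (star L)
  then show ?case by (elim exE) (rule semilinear_star)
qed

lemma rational_subset: "rational A L \<Longrightarrow> L \<subseteq> lists A"
proof (induction rule: rational.induct)
  case (product K L)
  then show ?case by (auto simp: subset_iff in_lists_conv_set)
next
  case (star L)
  have "concat us \<in> lists A" if "set us \<subseteq> L" for us
    using that star.IH by (induction us) auto
  then show ?case by auto
qed auto

section \<open>Computing with codes\<close>

lemma word_with_counts: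
  "finite A \<Longrightarrow> \<exists>u\<in>lists A. \<forall>a\<in>A. count_list u a = (y a :: nat)"
proof (induction A rule: finite_induct)
  case (insert b A)
  then obtain u where u: "u \<in> lists A" "\<forall>a\<in>A. count_list u a = y a" by blast
  have rep: "count_list (replicate n b) a = (if a = b then n else 0)" for n a
    by (induction n) auto
  have "count_list u b = 0" using u(1) insert.hyps(2) by (auto simp: count_list_0_iff in_lists_conv_set)
  then show ?case using u insert.hyps(2)
    by (intro bexI[of _ "replicate (y b) b @ u"]) (auto simp: rep in_lists_conv_set)
qed simp

lemma computable_lcm [comp_intros]:
  assumes "computable k f" "computable k g" shows "computable k (\<lambda>xs. lcm (f xs) (g xs))"
proof -
  have "computable k (\<lambda>xs. LEAST l. f xs = 0 \<or> g xs = 0 \<or> 0 < l \<and> f xs dvd l \<and> g xs dvd l)"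
  proof (rule computable_Least)
    show "decidable (Suc k) (\<lambda>ys. f (tl ys) = 0 \<or> g (tl ys) = 0 \<or>
        0 < hd ys \<and> f (tl ys) dvd hd ys \<and> g (tl ys) dvd hd ys)"
      by (intro comp_intros assms) simp_all
    show "\<exists>l. f xs = 0 \<or> g xs = 0 \<or> 0 < l \<and> f xs dvd l \<and> g xs dvd l" for xs
      by (rule exI[of _ "f xs * g xs"]) auto
  qed
  moreover have "(LEAST l. a = 0 \<or> b = 0 \<or> 0 < l \<and> a dvd l \<and> b dvd l) = lcm a b" for a b :: nat
  proof (cases "a = 0 \<or> b = 0")
    case False
    then show ?thesis
      by (intro Least_equality) (auto intro: dvd_imp_le lcm_least simp: lcm_pos_nat)
  qed auto
  ultimately show ?thesis by simp
qed

lemma decidable_coprime [comp_intros]: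
  assumes "computable k f" "computable k g" shows "decidable k (\<lambda>xs. coprime (f xs) (g xs))"
proof -
  have "decidable k (\<lambda>xs. \<forall>d<Suc (f xs + g xs). d dvd f xs \<longrightarrow> d dvd g xs \<longrightarrow> d = 1)"
    by (intro comp_intros assms) simp_all
  moreover have "(\<forall>d<Suc (a + b). d dvd a \<longrightarrow> d dvd b \<longrightarrow> d = 1) \<longleftrightarrow> coprime a b" for a b :: nat
  proof
    assume *: "\<forall>d<Suc (a + b). d dvd a \<longrightarrow> d dvd b \<longrightarrow> d = 1"
    have "gcd a b \<le> a + b" by (cases "a = 0") (auto intro: order_trans[OF gcd_le1_nat])
    then have "gcd a b = 1" using * by (simp add: less_Suc_eq_le)
    then show "coprime a b" by (simp add: coprime_iff_gcd_eq_1)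
  qed (metis coprime_common_divisor nat_dvd_1_iff_1)
  ultimately show ?thesis by simp
qed

section \<open>Decidability of validity and equality of codes\<close>

context exponent_set
begin

text \<open>The definition quantifies over all of \<open>D\<close>. If it fails at \<open>m\<close>,
  then \<open>d = gcd t (m div t)\<close> is a divisor of \<open>t\<close> with \<open>d * t\<close>
  in \<open>D\<close>, so a check of the divisors of \<open>t\<close> is enough.\<close>

lemma unitary_iff: "unitary t \<longleftrightarrow> t \<in> D \<and> (\<forall>d<Suc t. 1 < d \<longrightarrow> d dvd t \<longrightarrow> d * t \<notin> D)"
proof (intro iffI conjI allI impI notI)
  assume t: "unitary t"
  then show "t \<in> D" by (simp add: unitary_def)
  fix d assume d: "1 < d" "d dvd t" "d * t \<in> D"
  have "0 < t" using pos \<open>t \<in> D\<close> .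
  then have "coprime t d" using t d(3) by (metis unitary_def dvd_triv_right nonzero_mult_div_cancel_right neq0_conv)
  then have "is_unit d" using d(2) by (rule coprime_common_divisor) simp
  then show False using d(1) by simp
next
  assume *: "t \<in> D \<and> (\<forall>d<Suc t. 1 < d \<longrightarrow> d dvd t \<longrightarrow> d * t \<notin> D)"
  show "unitary t"
    unfolding unitary_def
  proof (intro conjI ballI impI)
    fix m assume m: "m \<in> D" "t dvd m"
    have t0: "0 < t" using * pos by blast
    have "gcd t (m div t) * t dvd m"
      using m(2) by (metis dvd_div_mult_self gcd_dvd2 mult_dvd_mono dvd_refl)
    then have "gcd t (m div t) * t \<in> D" using dvd[OF m(1)] by blast
    moreover have "gcd t (m div t) < Suc t" using dvd_imp_le[OF gcd_dvd1 t0, of "m div t"] by simp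
    ultimately have "\<not> 1 < gcd t (m div t)" using * by auto
    moreover have "gcd t (m div t) \<noteq> 0" using t0 by simp
    ultimately have "gcd t (m div t) = 1" by linarith
    then show "coprime t (m div t)" by (simp add: coprime_iff_gcd_eq_1)
  qed (use * in simp)
qed

lemma denom_iff: "denom k t \<longleftrightarrow> 0 < k \<and> (\<forall>d<Suc k. d \<in> D \<longrightarrow> d dvd k \<longrightarrow> coprime d t \<longrightarrow> d = 1)"
  unfolding denom_def by (auto simp: less_Suc_eq_le dvd_imp_le)

text \<open>The conditions of a code, for a single residue \<open>y\<close> modulo \<open>m\<close>.
  Quantification over all divisors \<open>d\<close> of \<open>m\<close> makes the predicate
  monotone, as the compactness argument requires.\<close>

fun sol :: "code \<Rightarrow> nat \<Rightarrow> nat \<Rightarrow> bool" where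
  "sol (k, p, q, t, c) m y \<longleftrightarrow> (\<forall>d\<in>D. d dvd m \<longrightarrow>
     (d dvd t \<longrightarrow> [int y = int c] (mod int d)) \<and>
     (coprime d t \<longrightarrow> [int k * int y = int p - int q] (mod int d)))"

lemma sol_mono: "m dvd n \<Longrightarrow> sol z n y \<Longrightarrow> sol z m y"
  by (cases z) (auto intro: dvd_trans)

text \<open>Adding \<open>m\<close> makes a solution positive, and with positive counts the words
  chosen later are nonempty.\<close>

lemma sol_add: assumes "sol z m y" shows "sol z m (y + m)"
proof -
  obtain k p q t c where z: "z = (k, p, q, t, c)" by (cases z)
  show ?thesis
    unfolding z sol.simps
  proof (intro ballI impI conjI)
    fix d assume d: "d \<in> D" "d dvd m"
    have y: "[int (y + m) = int y] (mod int d)" using d(2) by (simp add: cong_iff_dvd_diff)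
    show "[int (y + m) = int c] (mod int d)" if "d dvd t"
      using assms d that y unfolding z sol.simps by (metis cong_trans)
    show "[int k * int (y + m) = int p - int q] (mod int d)" if "coprime d t"
      using assms d that cong_scalar_left[OF y, of "int k"] unfolding z sol.simps by (metis cong_trans)
  qed
qed

text \<open>The Chinese remainder theorem for \<open>m = g * h\<close>: modulo \<open>g\<close>,
  which divides \<open>t\<close>, the residue is prescribed, and modulo \<open>h\<close>, which is
  prime to \<open>t\<close>, the denominator \<open>k\<close> is invertible.\<close>

lemma sol_exists:
  assumes "valid z" and m: "m \<in> D" shows "\<exists>y. sol z m y"
proof -
  obtain k p q t c where z: "z = (k, p, q, t, c)" by (cases z)
  have t: "unitary t" and k: "denom k t" using assms(1) by (auto simp: z)
  define g where "g = gcd m t"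
  define h where "h = m div g"
  have gh: "coprime h t" "coprime g h" "h \<in> D" using unitary_split[OF t m] by (auto simp: g_def h_def)
  have m_gh: "m = g * h" by (simp add: g_def h_def)
  have "coprime (int k) (int h)" using denom_coprime[OF k gh(3,1)] by simp
  then obtain x where x: "[int k * x = 1] (mod int h)" using cong_solve_coprime_int by blast
  have "coprime (int g) (int h)" using gh(2) by simp
  then obtain y0 where y0: "[y0 = int c] (mod int g)" "[y0 = x * (int p - int q)] (mod int h)"
    using binary_chinese_remainder_int by blast
  define y where "y = nat (y0 mod int m)"
  have m0: "0 < m" using pos[OF m] .
  have y: "[int y = y0] (mod int d)" if "d dvd m" for d
    using that m0 by (simp add: y_def cong_def mod_mod_cancel)
  have "sol z m y"
    unfolding z sol.simps
  proof (intro ballI impI conjI)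
    fix d assume d: "d \<in> D" "d dvd m"
    show "[int y = int c] (mod int d)" if "d dvd t"
    proof -
      have "d dvd g" using that d(2) by (simp add: g_def)
      then have "[y0 = int c] (mod int d)" using cong_dvd_modulus[OF y0(1)] by simp
      with y[OF d(2)] show ?thesis by (rule cong_trans)
    qed
    show "[int k * int y = int p - int q] (mod int d)" if "coprime d t"
    proof -
      have "coprime d g" using that unfolding g_def by (meson coprime_divisors dvd_refl gcd_dvd2)
      then have dh: "d dvd h" using d(2) unfolding m_gh by (simp add: coprime_dvd_mult_right_iff)
      have "[int k * int y = int k * y0] (mod int h)"
        by (intro cong_scalar_left y) (simp add: m_gh)
      also have "[int k * y0 = int k * (x * (int p - int q))] (mod int h)" by (rule cong_scalar_left[OF y0(2)])
      also have "int k * (x * (int p - int q)) = (int k * x) * (int p - int q)" by simp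
      also have "[(int k * x) * (int p - int q) = 1 * (int p - int q)] (mod int h)"
        by (rule cong_scalar_right[OF x])
      finally have "[int k * int y = int p - int q] (mod int h)" by simp
      then show ?thesis by (rule cong_dvd_modulus) (use dh in simp)
    qed
  qed
  then show ?thesis ..
qed

lemma rep_of_sol:
  assumes z: "valid z" and x: "compat x"
    and y: "\<And>m. m \<in> D \<Longrightarrow> \<exists>y. sol z m y \<and> [x m = int y] (mod int m)"
  shows "rep z x"
proof -
  obtain k p q t c where z': "z = (k, p, q, t, c)" by (cases z)
  have t: "unitary t" "denom k t" using z by (auto simp: z')
  have tD: "t \<in> D" using t(1) by (simp add: unitary_def)
  have "[x t = int c] (mod int t)"
  proof -
    obtain y where "sol z t y" "[x t = int y] (mod int t)" using assms(3)[OF tD] by blast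
    moreover from this(1) have "[int y = int c] (mod int t)" using tD by (auto simp: z')
    ultimately show ?thesis by (metis cong_trans)
  qed
  moreover have "[int k * x m = int p - int q] (mod int m)" if m: "m \<in> D" "coprime m t" for m
  proof -
    obtain y where "sol z m y" "[x m = int y] (mod int m)" using assms(3)[OF m(1)] by blast
    moreover from this(1) have "[int k * int y = int p - int q] (mod int m)" using m by (auto simp: z')
    ultimately show ?thesis using cong_scalar_left by (metis cong_trans)
  qed
  ultimately show ?thesis using t x by (simp add: z' cong_lin)
qed

fun enc :: "code \<Rightarrow> nat" where
  "enc (k, p, q, t, c) =
     prod_encode (k, prod_encode (p, prod_encode (q, prod_encode (t, c))))"

definition dec :: "nat \<Rightarrow> code" where
  "dec z = (pfst z, pfst (psnd z), pfst (psnd (psnd z)), pfst (psnd (psnd (psnd z))),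
     psnd (psnd (psnd (psnd z))))"

lemma dec_enc [simp]: "dec (enc z) = z"
  by (cases z) (simp add: dec_def)

lemma computable_lift [comp_intros]:
  assumes "computable k f" "computable k g" shows "computable k (\<lambda>xs. lift (dec (f xs)) (g xs))"
  unfolding dec_def lift.simps
proof (rule computable_Least)
  show "\<exists>z. g xs \<le> z \<or> z mod pfst (psnd (psnd (psnd (f xs)))) = psnd (psnd (psnd (psnd (f xs)))) mod pfst (psnd (psnd (psnd (f xs))))
      \<and> (pfst (f xs) * z + pfst (psnd (psnd (f xs)))) mod (g xs div pfst (psnd (psnd (psnd (f xs)))))
      = pfst (psnd (f xs)) mod (g xs div pfst (psnd (psnd (psnd (f xs)))))" for xs
    by (rule exI[of _ "g xs"]) simp
qed (intro comp_intros assms; simp)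

lemma computable_code_add:
  assumes "computable k f" "computable k g"
  shows "computable k (\<lambda>xs. enc (code_add (dec (f xs)) (dec (g xs))))"
proof -
  have "computable k (\<lambda>xs. lift (dec (f xs)) (lcm (pfst (psnd (psnd (psnd (f xs))))) (pfst (psnd (psnd (psnd (g xs)))))))"
    "computable k (\<lambda>xs. lift (dec (g xs)) (lcm (pfst (psnd (psnd (psnd (f xs))))) (pfst (psnd (psnd (psnd (g xs)))))))"
    by (intro comp_intros assms)+
  then show ?thesis unfolding dec_def code_add.simps enc.simps by (intro comp_intros assms)
qed

lemma computable_code_mult:
  assumes "computable k f" "computable k g"
  shows "computable k (\<lambda>xs. enc (code_mult (dec (f xs)) (dec (g xs))))"
proof -
  have "computable k (\<lambda>xs. lift (dec (f xs)) (lcm (pfst (psnd (psnd (psnd (f xs))))) (pfst (psnd (psnd (psnd (g xs)))))))"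
    "computable k (\<lambda>xs. lift (dec (g xs)) (lcm (pfst (psnd (psnd (psnd (f xs))))) (pfst (psnd (psnd (psnd (g xs)))))))"
    by (intro comp_intros assms)+
  then show ?thesis unfolding dec_def code_mult.simps enc.simps by (intro comp_intros assms)
qed

text \<open>For infinite \<open>D\<close> two codes stand for the same element only if the fractions agree as rational
  numbers; for finite \<open>D\<close> a comparison modulo the largest member suffices.\<close>

lemma decidable_eqv:
  obtains E where "decidable 2 (\<lambda>xs. E (xs ! 0) (xs ! 1))"
    "\<And>z z' x y. rep (dec z) x \<Longrightarrow> rep (dec z') y \<Longrightarrow> E z z' \<longleftrightarrow> eqv x y"
proof (cases "finite D")
  case True
  define N where "N = Lcm D"
  have "finite M \<Longrightarrow> M \<subseteq> D \<Longrightarrow> Lcm M \<in> D" for M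
    by (induction M rule: finite_induct) (use one lcm in auto)
  then have N: "N \<in> D" using True by (simp add: N_def)
  have dvdN: "m dvd N" if "m \<in> D" for m using that by (simp add: N_def)
  \<comment> \<open>Every member of \<open>D\<close> divides \<open>N\<close>, so \<open>N\<close>
    is the only member that \<open>N\<close> divides.\<close>
  have "unitary N"
    unfolding unitary_def using N dvdN by (metis coprime_1_right dvd_antisym div_self pos neq0_conv)
  have l: "[x N = int (lift z N)] (mod int N)" if "rep z x" for z x
  proof -
    obtain k p q t c where z: "z = (k, p, q, t, c)" by (cases z)
    have "t dvd N" using that dvdN by (auto simp: z unitary_def)
    then show ?thesis using lift that \<open>unitary N\<close> unfolding z by blast
  qed
  show thesis
  proof (rule that[of "\<lambda>z z'. lift (dec z) N mod N = lift (dec z') N mod N"])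
    show "decidable 2 (\<lambda>xs. lift (dec (xs ! 0)) N mod N = lift (dec (xs ! 1)) N mod N)"
      by (intro comp_intros) simp_all
    fix z z' x y assume rep: "rep (dec z) x" "rep (dec z') y"
    have "eqv x y \<longleftrightarrow> [x N = y N] (mod int N)"
    proof
      assume xy: "[x N = y N] (mod int N)"
      show "eqv x y"
        unfolding eqv_def
      proof
        fix m assume m: "m \<in> D"
        have "[x N = x m] (mod int m)" "[y N = y m] (mod int m)"
          using compatD[OF rep_compat[OF rep(1)] N dvdN[OF m]] compatD[OF rep_compat[OF rep(2)] N dvdN[OF m]] .
        moreover have "[x N = y N] (mod int m)" using xy by (rule cong_dvd_modulus) (use dvdN[OF m] in simp)
        ultimately show "[x m = y m] (mod int m)" by (metis cong_sym cong_trans)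
      qed
    qed (use N in \<open>simp add: eqv_def\<close>)
    also have "\<dots> \<longleftrightarrow> [int (lift (dec z) N) = int (lift (dec z') N)] (mod int N)"
      using l[OF rep(1)] l[OF rep(2)] by (metis cong_sym cong_trans)
    also have "\<dots> \<longleftrightarrow> lift (dec z) N mod N = lift (dec z') N mod N"
      by (simp add: cong_int_iff) (simp add: cong_def)
    finally show "lift (dec z) N mod N = lift (dec z') N mod N \<longleftrightarrow> eqv x y" by simp
  qed
next
  case False
  define E where "E z z' \<longleftrightarrow> (let T = lcm (pfst (psnd (psnd (psnd z)))) (pfst (psnd (psnd (psnd z')))) in
    lift (dec z) T mod T = lift (dec z') T mod T \<and>
    pfst (psnd z) * pfst z' + pfst (psnd (psnd z')) * pfst z =
    pfst (psnd z') * pfst z + pfst (psnd (psnd z)) * pfst z')" for z z'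
  show thesis
  proof (rule that[of E])
    show "decidable 2 (\<lambda>xs. E (xs ! 0) (xs ! 1))"
      unfolding E_def Let_def by (intro comp_intros) simp_all
    fix z z' x y assume rep: "rep (dec z) x" "rep (dec z') y"
    obtain k p q s c where z: "dec z = (k, p, q, s, c)" by (cases "dec z")
    obtain l p' q' t d where z': "dec z' = (l, p', q', t, d)" by (cases "dec z'")
    have X: "unitary s" "denom k s" "compat x"
      "\<And>m. m \<in> D \<Longrightarrow> coprime m s \<Longrightarrow> [int k * x m = int p - int q] (mod int m)"
      using rep(1) by (auto simp: z cong_lin)
    have Y: "unitary t" "denom l t" "compat y"
      "\<And>m. m \<in> D \<Longrightarrow> coprime m t \<Longrightarrow> [int l * y m = int p' - int q'] (mod int m)"
      using rep(2) by (auto simp: z' cong_lin)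
    define T where "T = lcm s t"
    have T: "unitary T" unfolding T_def by (rule unitary_lcm[OF X(1) Y(1)])
    have TD: "T \<in> D" using T by (simp add: unitary_def)
    have kl: "denom (k * l) T" unfolding T_def by (rule denom_mult[OF X(2) Y(2)])
    have lx: "[x T = int (lift (dec z) T)] (mod int T)"
      using lift[OF rep(1)[unfolded z] T] unfolding z by (simp add: T_def del: lift.simps)
    have ly: "[y T = int (lift (dec z') T)] (mod int T)"
      using lift[OF rep(2)[unfolded z'] T] unfolding z' by (simp add: T_def del: lift.simps)
    define \<Delta> where "\<Delta> = (int p - int q) * int l - (int p' - int q') * int k"
    have diff: "[int (k * l) * (x m - y m) = \<Delta>] (mod int m)" if m: "m \<in> D" "coprime m T" for m
    proof -
      have "coprime m s" "coprime m t" using m(2) unfolding T_def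
        by (meson coprime_divisors dvd_refl dvd_lcm1 dvd_lcm2)+
      then have "[int l * (int k * x m) - int k * (int l * y m)
          = int l * (int p - int q) - int k * (int p' - int q')] (mod int m)"
        by (intro cong_diff cong_scalar_left X(4) Y(4) m(1))
      then show ?thesis by (simp add: \<Delta>_def algebra_simps)
    qed
    have E: "E z z' \<longleftrightarrow> [x T = y T] (mod int T) \<and> \<Delta> = 0"
    proof -
      have "pfst z = k" "pfst (psnd z) = p" "pfst (psnd (psnd z)) = q" "pfst (psnd (psnd (psnd z))) = s"
        "pfst z' = l" "pfst (psnd z') = p'" "pfst (psnd (psnd z')) = q'" "pfst (psnd (psnd (psnd z'))) = t"
        using z z' by (auto simp: dec_def)
      then have "E z z' \<longleftrightarrow> lift (dec z) T mod T = lift (dec z') T mod T \<and> p * l + q' * k = p' * k + q * l"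
        by (simp add: E_def Let_def T_def)
      also have "lift (dec z) T mod T = lift (dec z') T mod T \<longleftrightarrow> [int (lift (dec z) T) = int (lift (dec z') T)] (mod int T)"
        by (simp add: cong_int_iff) (simp add: cong_def)
      also have "\<dots> \<longleftrightarrow> [x T = y T] (mod int T)" using lx ly by (metis cong_sym cong_trans)
      also have "p * l + q' * k = p' * k + q * l \<longleftrightarrow> int (p * l + q' * k) = int (p' * k + q * l)"
        by (simp only: of_nat_eq_iff)
      also have "\<dots> \<longleftrightarrow> \<Delta> = 0" by (auto simp: \<Delta>_def algebra_simps)
      finally show ?thesis .
    qed
    show "E z z' \<longleftrightarrow> eqv x y"
      unfolding E
    proof
      assume *: "[x T = y T] (mod int T) \<and> \<Delta> = 0"
      show "eqv x y"
      proof (rule eqvI[OF T X(3) Y(3) conjunct1[OF *]])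
        fix m assume m: "m \<in> D" "coprime m T"
        have "[int (k * l) * (x m - y m) = int (k * l) * 0] (mod int m)" using diff[OF m] * by simp
        moreover have "coprime (int (k * l)) (int m)" using denom_coprime[OF kl m] by (simp only: coprime_int_iff)
        ultimately have "[x m - y m = 0] (mod int m)" by (metis cong_mult_lcancel)
        then show "[x m = y m] (mod int m)" by (simp add: cong_iff_dvd_diff)
      qed
    next
      assume xy: "eqv x y"
      have "\<Delta> = 0"
      proof (rule ccontr)
        assume "\<Delta> \<noteq> 0"
        \<comment> \<open>Since \<open>gcd m T \<le> T\<close>, a large \<open>m\<close> has a part
          \<open>?h\<close> prime to \<open>T\<close> that exceeds the absolute value of
          \<open>\<Delta>\<close>. It divides \<open>\<Delta>\<close>, so a nonzero
          \<open>\<Delta>\<close> is impossible.\<close>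
        have "\<not> D \<subseteq> {..nat \<bar>\<Delta>\<bar> * T}" using False finite_subset by blast
        then obtain m where m: "m \<in> D" "nat \<bar>\<Delta>\<bar> * T < m" by (meson atMost_iff not_le subsetI)
        let ?h = "m div gcd m T"
        have h: "?h \<in> D" "coprime ?h T" using unitary_split[OF T m(1)] by auto
        have "[int (k * l) * (x ?h - y ?h) = int (k * l) * 0] (mod int ?h)"
          using xy h(1) by (intro cong_scalar_left) (simp add: eqv_def cong_iff_dvd_diff)
        then have "int ?h dvd \<Delta>" using diff[OF h] by (metis cong_0_iff cong_sym cong_trans mult_zero_right)
        then have "?h \<le> nat \<bar>\<Delta>\<bar>" using \<open>\<Delta> \<noteq> 0\<close>
          by (metis dvd_imp_le int_dvd_int_iff nat_abs_int_diff abs_ge_zero dvd_abs_iff int_nat_eq nat_0_iff zero_less_abs_iff not_le neq0_conv zero_less_nat_eq)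
        moreover have "gcd m T \<le> T" using pos[OF TD] by (intro gcd_le2_nat) simp
        ultimately have "?h * gcd m T \<le> nat \<bar>\<Delta>\<bar> * T" by (rule mult_le_mono)
        then show False using m(2) by simp
      qed
      then show "[x T = y T] (mod int T) \<and> \<Delta> = 0" using xy TD by (simp add: eqv_def)
    qed
  qed
qed

text \<open>An index \<open>i\<close> of an operation packs the arity minus one, a list of codes and
  the code of an alphabet with a language. Invalid entries are read as the code of 0, so that every
  number is a legitimate index.\<close>

definition coef :: "nat \<Rightarrow> nat \<Rightarrow> code" where
  "coef i j = (let z = dec (nthc (pfst (psnd i)) j) in if valid z then z else (1, 0, 0, 1, 0))"

lemma valid_coef: "valid (coef i j)"
  using unitary_1 denom_1 by (auto simp: coef_def Let_def)

context
  assumes D: "decidable 1 (\<lambda>xs. hd xs \<in> D)"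
begin

lemma decidable_D: "computable k f \<Longrightarrow> decidable k (\<lambda>xs. f xs \<in> D)"
  using computable_comp1[OF D[unfolded decidable_def]] by (simp add: decidable_def)

lemma decidable_valid:
  assumes "computable k f" shows "decidable k (\<lambda>xs. valid (dec (f xs)))"
  unfolding dec_def valid.simps unitary_iff denom_iff
  by (intro comp_intros decidable_D assms) simp_all

lemma computable_coef:
  assumes "computable k f" "computable k g" shows "computable k (\<lambda>xs. enc (coef (f xs) (g xs)))"
proof (rule computable_cong)
  show "computable k (\<lambda>xs. if valid (dec (nthc (pfst (psnd (f xs))) (g xs)))
      then nthc (pfst (psnd (f xs))) (g xs) else enc (1, 0, 0, 1, 0))"
    by (intro comp_intros decidable_valid assms)
  show "(if valid (dec (nthc (pfst (psnd (f xs))) (g xs)))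
      then nthc (pfst (psnd (f xs))) (g xs) else enc (1, 0, 0, 1, 0)) = enc (coef (f xs) (g xs))" for xs
    by (simp add: coef_def Let_def dec_def del: valid.simps)
qed

text \<open>Substitution is linear on exponents, so the exponent of \<open>a\<close> in an
  application is the sum over the arguments of coefficient times exponent; the recursion evaluates
  this sum on codes.\<close>

lemma computable_term_value:
  obtains v where "computable 1 (\<lambda>xs. v (hd xs))"
    and "\<And>x. v (term_code (Var x)) = enc (1, of_bool (x = a), 0, 1, 0)"
    and "\<And>i ts. v (term_code (App i ts)) = rec_nat (enc (1, 0, 0, 1, 0))
      (\<lambda>j r. enc (code_add (dec r) (code_mult (coef i j) (dec (v (term_code (ts ! j))))))) (length ts)"
proof (rule computable_term_rec)
  show "computable 1 (\<lambda>xs. enc (1, of_bool (hd xs = a), 0, 1, 0))"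
    unfolding enc.simps by (intro comp_intros) simp_all
  show "computable 2 (\<lambda>_. enc (1, 0, 0, 1, 0))" by (rule computable_const)
  have "computable (Suc 3) (\<lambda>xs. enc (code_add (dec (xs ! 3))
      (dec (enc (code_mult (dec (enc (coef (xs ! 0) (xs ! 1)))) (dec (xs ! 2)))))))"
    by (intro computable_code_add computable_code_mult computable_coef comp_intros) simp_all
  then show "computable (Suc 3) (\<lambda>xs. enc (code_add (dec (xs ! 3)) (code_mult (coef (xs ! 0) (xs ! 1)) (dec (xs ! 2)))))"
    by simp
qed (use that in \<open>simp add: numeral_2_eq_2 numeral_3_eq_3\<close>)

end

end

section \<open>Membership in terms of the exponents\<close>

text \<open>Solvability of all equations \<open>x z = y\<close> replaces the search for unit and
  inverses: a solution \<open>e\<close> of \<open>x0 e = x0\<close> is a unit, because every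
  \<open>y\<close> has the form \<open>x0 z\<close>. In this form the condition is a bounded check
  on the table.\<close>

lemma abelian_group_iff:
  assumes S: "S \<in> FinS"
  shows "is_abelian_group S \<longleftrightarrow> (\<forall>x\<in>carrier S. \<forall>y\<in>carrier S. smul S x y = smul S y x) \<and>
    (\<forall>x\<in>carrier S. \<forall>y\<in>carrier S. \<exists>z\<in>carrier S. smul S x z = y)" (is "_ \<longleftrightarrow> ?comm \<and> ?div")
proof
  assume "is_abelian_group S"
  then interpret comm_group "grp S" by (rule comm_group_grp)
  show "?comm \<and> ?div"
  proof (intro conjI ballI)
    fix x y assume xy: "x \<in> carrier S" "y \<in> carrier S"
    then have xy': "x \<in> carrier (grp S)" "y \<in> carrier (grp S)" by simp_all
    show "smul S x y = smul S y x" using m_comm[OF xy'] by simp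
    have "x \<otimes>\<^bsub>grp S\<^esub> (inv\<^bsub>grp S\<^esub> x \<otimes>\<^bsub>grp S\<^esub> y) = y"
      using xy' by (simp add: m_assoc[symmetric] del: grp_simps)
    moreover have "inv\<^bsub>grp S\<^esub> x \<otimes>\<^bsub>grp S\<^esub> y \<in> carrier (grp S)" using xy' by (intro m_closed inv_closed)
    ultimately show "\<exists>z\<in>carrier S. smul S x z = y" by auto
  qed
next
  assume *: "?comm \<and> ?div"
  obtain x0 where x0: "x0 \<in> carrier S" using S by (auto simp: FinS_def)
  obtain e where e: "e \<in> carrier S" "smul S x0 e = x0" using * x0 by blast
  have cl: "smul S x y \<in> carrier S" if "x \<in> carrier S" "y \<in> carrier S" for x y
    using S that by (simp add: FinS_def is_semigroup_def)
  have assoc: "smul S (smul S x y) z = smul S x (smul S y z)"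
    if "x \<in> carrier S" "y \<in> carrier S" "z \<in> carrier S" for x y z
    using S that by (simp add: FinS_def is_semigroup_def)
  have unit: "smul S e y = y" if y: "y \<in> carrier S" for y
  proof -
    obtain z where "z \<in> carrier S" "smul S x0 z = y" using * x0 y by blast
    then show ?thesis using assoc[OF e(1) x0] * e x0 by metis
  qed
  have "\<exists>y\<in>carrier S. smul S y x = e" if "x \<in> carrier S" for x
    using * e(1) that by metis
  then show "is_abelian_group S"
    unfolding is_abelian_group_def
    by (intro exI[of _ e] comm_groupI) (use cl assoc unit * e in auto)
qed

text \<open>This is the power with exponent \<open>k + 1\<close>; a table offers no distinguished
  unit that could serve as the zeroth power.\<close>

definition tpow :: "nat \<Rightarrow> nat \<Rightarrow> nat \<Rightarrow> nat" where
  "tpow c g k = rec_nat g (\<lambda>_ r. tmul c r g) k"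

text \<open>The order is found as the least positive \<open>k\<close> with \<open>g\<close> to the
  power \<open>k + 1\<close> equal to \<open>g\<close>, which avoids naming the unit. The first
  disjunct bounds the search if the table is not one of a group.\<close>

definition tord :: "nat \<Rightarrow> nat \<Rightarrow> nat" where
  "tord c g = (LEAST k. pfst c < k \<or> 0 < k \<and> tpow c g k = g)"

definition tabelian :: "nat \<Rightarrow> bool" where
  "tabelian c \<longleftrightarrow> (\<forall>i<pfst c. \<forall>j<pfst c. tmul c i j = tmul c j i) \<and>
     (\<forall>i<pfst c. \<forall>j<pfst c. \<exists>k<pfst c. tmul c i k = j)"

lemma computable_tpow [comp_intros]:
  "computable k f \<Longrightarrow> computable k g \<Longrightarrow> computable k h \<Longrightarrow> computable k (\<lambda>xs. tpow (f xs) (g xs) (h xs))"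
  unfolding tpow_def by (intro comp_intros) simp_all

lemma computable_tord [comp_intros]:
  assumes "computable k f" "computable k g" shows "computable k (\<lambda>xs. tord (f xs) (g xs))"
  unfolding tord_def
proof (rule computable_Least)
  show "\<exists>n. pfst (f xs) < n \<or> 0 < n \<and> tpow (f xs) (g xs) n = g xs" for xs
    by (rule exI[of _ "Suc (pfst (f xs))"]) simp
qed (intro comp_intros assms; simp)

lemma decidable_tabelian [comp_intros]:
  assumes "computable k f" shows "decidable k (\<lambda>xs. tabelian (f xs))"
  unfolding tabelian_def by (intro comp_intros assms) simp_all

lemma tabelian: assumes c: "table_code c" shows "tabelian c \<longleftrightarrow> is_abelian_group (table_sg c)"
proof -
  have len: "lenc (psnd c) = pfst c * pfst c" using c by (simp add: table_code_iff)
  have S: "table_sg c \<in> FinS" using c by (auto simp: table_code_def split: prod.splits)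
  show ?thesis
    unfolding abelian_group_iff[OF S] tabelian_def carrier_table_sg
    using smul_table_sg[OF len] by (auto simp: Ball_def Bex_def)
qed

lemma tord:
  assumes c: "table_code c" "is_abelian_group (table_sg c)" and g: "g < pfst c"
  shows "tord c g = group.ord (grp (table_sg c)) g"
proof -
  interpret comm_group "grp (table_sg c)" by (rule comm_group_grp[OF c(2)])
  have len: "lenc (psnd c) = pfst c * pfst c" using c by (simp add: table_code_iff)
  have g': "g \<in> carrier (grp (table_sg c))" using g by (simp add: carrier_table_sg)
  have tpow: "tpow c g k = g [^]\<^bsub>grp (table_sg c)\<^esub> Suc k" for k
  proof (induction k)
    case 0
    have "g [^]\<^bsub>grp (table_sg c)\<^esub> Suc 0 = g" using g' by (simp del: grp_simps)
    then show ?case by (simp add: tpow_def)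
  next
    case (Suc k)
    have "g [^]\<^bsub>grp (table_sg c)\<^esub> Suc k < pfst c"
      using nat_pow_closed[OF g', of "Suc k"] by (simp add: carrier_table_sg del: nat_pow_Suc)
    then show ?case using Suc smul_table_sg[OF len _ g] by (simp add: tpow_def)
  qed
  have iff: "tpow c g k = g \<longleftrightarrow> ord g dvd k" for k
  proof -
    have "tpow c g k = g \<longleftrightarrow> g [^]\<^bsub>grp (table_sg c)\<^esub> k \<otimes>\<^bsub>grp (table_sg c)\<^esub> g = g" by (simp add: tpow)
    also have "\<dots> \<longleftrightarrow> g [^]\<^bsub>grp (table_sg c)\<^esub> k = \<one>\<^bsub>grp (table_sg c)\<^esub>"
      using g' nat_pow_closed[OF g'] by (metis l_cancel_one l_one one_closed right_cancel)
    finally show ?thesis by (simp add: pow_eq_id[OF g'])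
  qed
  have fin: "finite (carrier (grp (table_sg c)))" by (simp add: carrier_table_sg)
  have "0 < ord g" using ord_ge_1[OF fin g'] by simp
  moreover have "ord g \<le> pfst c"
    using ord_le_group_order[OF fin g'] by (simp add: order_def carrier_table_sg)
  ultimately show ?thesis
    unfolding tord_def iff by (intro Least_equality) (auto dest: dvd_imp_le)
qed

lemma (in group) ord_eqI:
  assumes "x \<in> carrier G" "\<And>k :: nat. x [^] k = \<one> \<longleftrightarrow> n dvd k" shows "ord x = n"
  using assms pow_eq_id[OF assms(1)] by (metis dvd_antisym dvd_refl)

lemma ord_isomorphic:
  assumes S: "is_abelian_group S" and T: "is_abelian_group T"
    and f: "sg_hom S T f" "inj_on f (carrier S)" and x: "x \<in> carrier S"
  shows "group.ord (grp T) (f x) = group.ord (grp S) x"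
proof -
  interpret S: comm_group "grp S" by (rule comm_group_grp[OF S])
  interpret T: comm_group "grp T" by (rule comm_group_grp[OF T])
  have fT: "f y \<in> carrier (grp T)" if "y \<in> carrier (grp S)" for y using f(1) that by (auto simp: sg_hom_def)
  have f_mult: "f (y \<otimes>\<^bsub>grp S\<^esub> z) = f y \<otimes>\<^bsub>grp T\<^esub> f z"
    if "y \<in> carrier (grp S)" "z \<in> carrier (grp S)" for y z using f(1) that by (simp add: sg_hom_def)
  have x': "x \<in> carrier (grp S)" using x by simp
  have one: "f \<one>\<^bsub>grp S\<^esub> = \<one>\<^bsub>grp T\<^esub>"
    by (metis S.one_closed S.r_one T.l_cancel_one fT f_mult)
  have pow: "f (x [^]\<^bsub>grp S\<^esub> k) = f x [^]\<^bsub>grp T\<^esub> k" for k :: nat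
    by (induction k) (use one f_mult x' in \<open>simp_all del: grp_simps\<close>)
  show ?thesis
  proof (rule T.ord_eqI[OF fT[OF x']])
    fix k :: nat
    have "f x [^]\<^bsub>grp T\<^esub> k = \<one>\<^bsub>grp T\<^esub> \<longleftrightarrow> x [^]\<^bsub>grp S\<^esub> k = \<one>\<^bsub>grp S\<^esub>"
      using f(2) S.nat_pow_closed[OF x'] S.one_closed unfolding pow[symmetric] one[symmetric]
      by (simp add: inj_on_eq_iff)
    then show "f x [^]\<^bsub>grp T\<^esub> k = \<one>\<^bsub>grp T\<^esub> \<longleftrightarrow> S.ord x dvd k" by (simp add: S.pow_eq_id[OF x'])
  qed
qed

sublocale abelian_pv \<subseteq> exponent_set "exponents V"
  by unfold_locales (use exponents_pos exponents_1 exponents_dvd exponents_lcm in auto)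

text \<open>A table of the cyclic group is found by search rather than constructed, so its
  computability is immediate. The disjunct \<open>n = 0\<close> keeps the search total.\<close>

definition zcode :: "nat \<Rightarrow> nat" where
  "zcode n = (LEAST c. n = 0 \<or> pfst c = n \<and> lenc (psnd c) = n * n \<and>
     (\<forall>i<n. \<forall>j<n. tmul c i j = (i + j) mod n))"

lemma zcode_ex: "\<exists>c. n = 0 \<or> pfst c = n \<and> lenc (psnd c) = n * n \<and>
     (\<forall>i<n. \<forall>j<n. tmul c i j = (i + j) mod n)"
proof (intro exI disjI2 conjI allI impI)
  let ?l = "map (\<lambda>q. (q div n + q mod n) mod n) [0..<n * n]"
  let ?c = "prod_encode (n, list_encode ?l)"
  show "pfst ?c = n" "lenc (psnd ?c) = n * n" by (simp_all add: lenc_encode)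
  fix i j assume "i < n" "j < n"
  moreover from this have "i * n + j < n * n" by (rule table_index_less)
  ultimately show "tmul ?c i j = (i + j) mod n"
    by (simp add: tmul_def nthc_encode)
qed

lemma zcode:
  assumes "0 < n" shows "table_code (zcode n)" "sg_isomorphic (Zn n) (table_sg (zcode n))"
    "sg_isomorphic (table_sg (zcode n)) (Zn n)"
proof -
  have z: "pfst (zcode n) = n" "lenc (psnd (zcode n)) = n * n"
    "\<And>i j. i < n \<Longrightarrow> j < n \<Longrightarrow> tmul (zcode n) i j = (i + j) mod n"
    using LeastI_ex[OF zcode_ex[of n]] assms unfolding zcode_def[symmetric] by auto
  show "table_code (zcode n)"
    unfolding table_code_iff using z assms by (auto simp: mod_simps algebra_simps)
  have smul: "smul (table_sg (zcode n)) i j = (i + j) mod n" if "i < n" "j < n" for i j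
    using smul_table_sg[of "zcode n" i j] z that by simp
  show "sg_isomorphic (Zn n) (table_sg (zcode n))" "sg_isomorphic (table_sg (zcode n)) (Zn n)"
    unfolding sg_isomorphic_def
    by (auto intro!: exI[of _ id] simp: sg_hom_def carrier_table_sg z(1) smul)
qed

lemma computable_zcode [comp_intros]:
  assumes "computable k f" shows "computable k (\<lambda>xs. zcode (f xs))"
  unfolding zcode_def
  by (rule computable_Least) (intro comp_intros assms zcode_ex; simp)+

context abelian_pv
begin

lemma table_sg_in_V:
  assumes "table_code c"
  shows "table_sg c \<in> V \<longleftrightarrow> tabelian c \<and> (\<forall>g<pfst c. tord c g \<in> exponents V)"
proof -
  have S: "table_sg c \<in> FinS" using assms by (auto simp: table_code_def split: prod.splits)
  show ?thesis
    unfolding V_iff[OF S] tabelian[OF assms] using tord[OF assms] by (auto simp: carrier_table_sg)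
qed

text \<open>In one direction the table of the cyclic group of order \<open>n\<close> is fed to the
  decision procedure; in the other the orders of all elements of a table are tested. From here on
  algorithms only have to deal with the set of exponents.\<close>

lemma decidable_pv_iff: "decidable_pv V \<longleftrightarrow> decidable 1 (\<lambda>xs. hd xs \<in> exponents V)"
proof
  assume "decidable_pv V"
  then obtain f where f: "recursive_fun 1 f" "\<And>c. table_code c \<Longrightarrow> f [c] = of_bool (table_sg c \<in> V)"
    by (auto simp: decidable_pv_def of_bool_def)
  have "decidable 1 (\<lambda>xs. 0 < hd xs \<and> f [zcode (hd xs)] = 1)"
    by (intro comp_intros computable_comp1[OF computable_recursive[OF f(1)]]) simp_all
  moreover have "0 < n \<and> f [zcode n] = 1 \<longleftrightarrow> n \<in> exponents V" for n
  proof (cases "0 < n")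
    case True
    have "table_sg (zcode n) \<in> FinS" using zcode(1)[OF True] by (auto simp: table_code_def split: prod.splits)
    then have "table_sg (zcode n) \<in> V \<longleftrightarrow> Zn n \<in> V"
      using V_iso zcode(2,3)[OF True] Zn_FinS[OF True] by blast
    then show ?thesis using True f(2)[OF zcode(1)[OF True]] by (simp add: exponents_def)
  qed (simp add: exponents_def)
  ultimately show "decidable 1 (\<lambda>xs. hd xs \<in> exponents V)" by simp
next
  assume D: "decidable 1 (\<lambda>xs. hd xs \<in> exponents V)"
  have D': "decidable k (\<lambda>xs. f xs \<in> exponents V)" if "computable k f" for k f
    by (rule decidable_D[OF D that])
  have "decidable 1 (\<lambda>xs. tabelian (hd xs) \<and> (\<forall>g<pfst (hd xs). tord (hd xs) g \<in> exponents V))"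
    by (intro comp_intros D') simp_all
  then obtain f where f: "recursive_fun 1 f" "\<And>xs. length xs = 1 \<Longrightarrow>
      f xs = of_bool (tabelian (hd xs) \<and> (\<forall>g<pfst (hd xs). tord (hd xs) g \<in> exponents V))"
    by (auto simp: decidable_def computable_def)
  then show "decidable_pv V"
    unfolding decidable_pv_def
    by (intro exI[of _ f]) (auto simp: table_sg_in_V)
qed

text \<open>All numbers are run through, and each one that is not the table of a member is replaced
  by the table of the trivial group.\<close>

lemma rec_enumerable:
  assumes D: "decidable 1 (\<lambda>xs. hd xs \<in> exponents V)" shows "rec_enumerable_pv V"
proof -
  have D': "decidable k (\<lambda>xs. f xs \<in> exponents V)" if "computable k f" for k f
    by (rule decidable_D[OF D that])
  define W where "W c \<longleftrightarrow> table_code c \<and> tabelian c \<and> (\<forall>g<pfst c. tord c g \<in> exponents V)" for c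
  have W: "W c \<longleftrightarrow> table_code c \<and> table_sg c \<in> V" for c
    using table_sg_in_V by (auto simp: W_def)
  have "computable 1 (\<lambda>xs. if W (hd xs) then hd xs else zcode 1)"
    unfolding W_def by (intro comp_intros D') simp_all
  then obtain f where f: "recursive_fun 1 f" "\<And>xs. length xs = 1 \<Longrightarrow> f xs = (if W (hd xs) then hd xs else zcode 1)"
    by (auto simp: computable_def)
  have "Zn 1 \<in> V" using exponents_1 by (simp add: exponents_def)
  moreover have z: "table_code (zcode 1)" by (rule zcode(1)) simp
  ultimately have z1: "W (zcode 1)"
    using V_iso zcode(2)[of 1] unfolding W by (auto simp: table_code_def split: prod.splits)
  have "\<exists>n. sg_isomorphic S (table_sg (f [n]))" if S: "S \<in> V" for S
  proof -
    have SF: "S \<in> FinS" using S V_FinS by blast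
    define N where "N = card (carrier S)"
    have fin: "finite (carrier S)" "carrier S \<noteq> {}" using SF by (auto simp: FinS_def)
    obtain h where h: "bij_betw h (carrier S) {..<N}"
      using ex_bij_betw_finite_nat[OF fin(1)] by (auto simp: atLeast0LessThan N_def)
    define g where "g = the_inv_into (carrier S) h"
    have gh: "g (h x) = x" if "x \<in> carrier S" for x
      using h that by (simp add: g_def bij_betw_def the_inv_into_f_f)
    have g: "g i \<in> carrier S" if "i < N" for i
      using bij_betw_the_inv_into[OF h] that by (auto simp: g_def bij_betw_def)
    have hN: "h x < N" if "x \<in> carrier S" for x using h that by (auto simp: bij_betw_def)
    have cl: "smul S x y \<in> carrier S" if "x \<in> carrier S" "y \<in> carrier S" for x y
      using SF that by (simp add: FinS_def is_semigroup_def)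
    define l where "l = map (\<lambda>q. h (smul S (g (q div N)) (g (q mod N)))) [0..<N * N]"
    define c where "c = prod_encode (N, list_encode l)"
    have c: "pfst c = N" "psnd c = list_encode l" by (simp_all add: c_def)
    have len: "lenc (psnd c) = pfst c * pfst c" by (simp add: c lenc_encode l_def)
    have tm: "tmul c i j = h (smul S (g i) (g j))" if ij: "i < N" "j < N" for i j
      using table_index_less[OF ij] ij by (simp add: tmul_def c nthc_encode l_def)
    have N0: "0 < N" using fin by (simp add: N_def card_gt_0_iff)
    have assoc: "smul S (smul S x y) z = smul S x (smul S y z)"
      if "x \<in> carrier S" "y \<in> carrier S" "z \<in> carrier S" for x y z
      using SF that by (simp add: FinS_def is_semigroup_def)
    have tc: "table_code c"
      unfolding table_code_iff using len N0 tm hN cl g gh assoc by (simp add: c)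
    have iso: "sg_isomorphic S (table_sg c)"
      unfolding sg_isomorphic_def sg_hom_def carrier_table_sg
    proof (intro exI[of _ h] conjI ballI)
      fix x y assume xy: "x \<in> carrier S" "y \<in> carrier S"
      then show "h (smul S x y) = smul (table_sg c) (h x) (h y)"
        using smul_table_sg[OF len, of "h x" "h y"] tm[of "h x" "h y"] hN gh c by simp
    qed (use h hN c in auto)
    have "table_sg c \<in> FinS" using tc by (auto simp: table_code_def split: prod.splits)
    then have "W c" unfolding W using V_iso[OF S _ iso] tc by blast
    then show ?thesis using iso f(2)[of "[c]"] by (intro exI[of _ c]) simp
  qed
  then show ?thesis
    unfolding rec_enumerable_pv_def using f z1 by (intro exI[of _ f]) (auto simp: W)
qed

end

section \<open>Tameness implies decidability\<close>

lemma hat_cong: "(\<And>a. a \<in> A \<Longrightarrow> \<phi> a = \<psi> a) \<Longrightarrow> hat A T Y \<phi> = hat A T Y \<psi>"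
  by (simp add: hat_def cong: ball_cong_simp)

lemma sigma_sub_term:
  assumes \<nu>: "range \<nu> = \<sigma>" and w: "w \<in> sigma_sub \<sigma> FinS A"
  shows "\<exists>t. wf_term \<nu> A t \<and> term_val \<nu> A t = w"
  using w
proof induction
  case (gen a)
  then show ?case by (intro exI[of _ "Var a"]) simp
next
  case (op n w \<phi>)
  then obtain T where T: "\<And>i. i < n \<Longrightarrow> wf_term \<nu> A (T i) \<and> term_val \<nu> A (T i) = \<phi> i" by metis
  obtain i where i: "\<nu> i = (n, w)" using op.hyps(1) \<nu> by auto
  have "hat {..<n} (Omega FinS A) (Omega_top FinS A) (\<lambda>j. map (term_val \<nu> A) (map T [0..<n]) ! j)
      = hat {..<n} (Omega FinS A) (Omega_top FinS A) \<phi>"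
    by (rule hat_cong) (use T in auto)
  then show ?case using T i by (intro exI[of _ "App i (map T [0..<n])"]) (auto simp: o_def)
qed

lemma term_val_sigma_sub:
  assumes \<nu>: "range \<nu> = \<sigma>" shows "wf_term \<nu> A t \<Longrightarrow> term_val \<nu> A t \<in> sigma_sub \<sigma> FinS A"
proof (induction t)
  case (Var x)
  then show ?case by (simp add: sigma_sub.gen)
next
  case (App i ts)
  have "(fst (\<nu> i), snd (\<nu> i)) \<in> \<sigma>" using \<nu> by auto
  then show ?case unfolding term_val.simps
    by (rule sigma_sub.op) (use App in auto)
qed

section \<open>Multiplication and powers as terms\<close>

definition mult_op :: pseudoword where
  "mult_op = word FinS {..<2} [0, 1]"

lemma mult_op_in_Omega: "mult_op \<in> carrier (Omega FinS {..<2})"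
  unfolding mult_op_def by (rule word_in_Omega[OF order_refl]) auto

lemma exv_mult_op: assumes "i < 2" "0 < m" shows "exv {..<2} mult_op i m = 1 mod int m"
proof -
  have "count_list [0, 1] i = 1" using assms(1) by (auto simp: less_2_cases_iff)
  then show ?thesis
    using exv_word[of "{..<2}" i "[0, 1]" m] assms unfolding mult_op_def by simp
qed

lemma hat_mult_op:
  assumes \<phi>: "\<phi> \<in> {..<2} \<rightarrow> carrier (Omega FinS A)"
  shows "hat {..<2} (Omega FinS A) (Omega_top FinS A) \<phi> mult_op = smul (Omega FinS A) (\<phi> 0) (\<phi> 1)"
proof -
  have l: "letter FinS {..<2} 0 \<in> carrier (Omega FinS {..<2})" "letter FinS {..<2} 1 \<in> carrier (Omega FinS {..<2})"
    by (auto intro: letter_in_Omega[OF order_refl])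
  have eq: "mult_op = smul (Omega FinS {..<2}) (letter FinS {..<2} 0) (letter FinS {..<2} 1)"
    by (simp add: mult_op_def word_def smul_Omega[OF order_refl])
  have "sg_hom (Omega FinS {..<2}) (Omega FinS A) (hat {..<2} (Omega FinS A) (Omega_top FinS A) \<phi>)"
    using hat_cont_hom[OF \<phi>] by (simp add: cont_hom_def)
  then have "hat {..<2} (Omega FinS A) (Omega_top FinS A) \<phi> mult_op = smul (Omega FinS A)
      (hat {..<2} (Omega FinS A) (Omega_top FinS A) \<phi> (letter FinS {..<2} 0))
      (hat {..<2} (Omega FinS A) (Omega_top FinS A) \<phi> (letter FinS {..<2} 1))"
    unfolding eq sg_hom_def using l by blast
  then show ?thesis using hat_letter[OF \<phi>, of 0] hat_letter[OF \<phi>, of 1] by simp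
qed

lemma word_sigma_sub:
  assumes \<sigma>: "(2, mult_op) \<in> \<sigma>" and u: "u \<in> lists A" "u \<noteq> []"
  shows "word FinS A u \<in> sigma_sub \<sigma> FinS A"
  using u
proof (induction u rule: list.induct)
  case (Cons a u)
  have a: "a \<in> A" using Cons.prems by auto
  show ?case
  proof (cases "u = []")
    case True
    then show ?thesis using sigma_sub.gen[OF a] by (simp add: word_def)
  next
    case False
    have u: "u \<in> lists A" using Cons.prems by auto
    let ?\<phi> = "\<lambda>i :: nat. if i = 0 then letter FinS A a else word FinS A u"
    have "?\<phi> \<in> {..<2} \<rightarrow> carrier (Omega FinS A)"
      using letter_in_Omega[OF order_refl a] word_in_Omega[OF order_refl u False] by auto
    then have "hat {..<2} (Omega FinS A) (Omega_top FinS A) ?\<phi> mult_op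
        = smul (Omega FinS A) (letter FinS A a) (word FinS A u)" by (simp add: hat_mult_op)
    also have "\<dots> = word FinS A (a # u)"
      using False by (simp add: word_def smul_Omega[OF order_refl] word_prod_Cons)
    finally have eq: "hat {..<2} (Omega FinS A) (Omega_top FinS A) ?\<phi> mult_op = word FinS A (a # u)" .
    show ?thesis
      unfolding eq[symmetric]
      by (rule sigma_sub.op[OF \<sigma>]) (use sigma_sub.gen[OF a] Cons.IH u False in auto)
  qed
qed simp

text \<open>The power with exponent \<open>k + 1\<close>, formed with the symbol \<open>i\<close> of
  multiplication; hence the exponents \<open>n - 1\<close> and \<open>d - 1\<close> below.\<close>

fun pow_term :: "nat \<Rightarrow> sigma_term \<Rightarrow> nat \<Rightarrow> sigma_term" where
  "pow_term i t 0 = t"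
| "pow_term i t (Suc k) = App i [pow_term i t k, t]"

definition pow_code :: "nat \<Rightarrow> nat \<Rightarrow> nat \<Rightarrow> nat" where
  "pow_code i c k = rec_nat c (\<lambda>_ r. appc i (consc r (consc c 0))) k"

lemma pow_code: "pow_code i (term_code t) k = term_code (pow_term i t k)"
  by (induction k) (simp_all add: pow_code_def term_code_App consc_def)

lemma computable_pow_code [comp_intros]:
  "computable k f \<Longrightarrow> computable k g \<Longrightarrow> computable k (\<lambda>xs. pow_code i (f xs) (g xs))"
  unfolding pow_code_def by (intro comp_intros) simp_all

lemma pow_term:
  assumes \<sigma>: "implicit_signature \<sigma>" and \<nu>: "range \<nu> = \<sigma>" and i: "\<nu> i = (2, mult_op)" and A: "finite A" "a \<in> A"
    and t: "wf_term \<nu> A t"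
  shows "wf_term \<nu> A (pow_term i t k)"
    and "0 < m \<Longrightarrow> [exv A (term_val \<nu> A (pow_term i t k)) a m = int (Suc k) * exv A (term_val \<nu> A t) a m] (mod int m)"
proof -
  show wf: "wf_term \<nu> A (pow_term i t k)" for k
    by (induction k) (use t i in auto)
  have in_Omega: "term_val \<nu> A s \<in> carrier (Omega FinS A)" if "wf_term \<nu> A s" for s
    using sigma_sub_in_Omega[OF \<sigma> term_val_sigma_sub[OF \<nu> that]] .
  show "[exv A (term_val \<nu> A (pow_term i t k)) a m = int (Suc k) * exv A (term_val \<nu> A t) a m] (mod int m)"
    if m: "0 < m"
  proof (induction k)
    case (Suc k)
    let ?s = "[pow_term i t k, t]"
    let ?\<phi> = "\<lambda>j. map (term_val \<nu> A) ?s ! j"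
    have \<phi>: "?\<phi> \<in> {..<2} \<rightarrow> carrier (Omega FinS A)"
      using in_Omega[OF wf[of k]] in_Omega[OF t] by (auto simp: less_2_cases_iff)
    have "[exv A (term_val \<nu> A (pow_term i t (Suc k))) a m
        = (\<Sum>j\<in>{..<2}. exv {..<2} mult_op j m * exv A (?\<phi> j) a m)] (mod int m)"
      using exv_hat[OF A _ \<phi> mult_op_in_Omega m] by (simp add: i)
    also have "[(\<Sum>j\<in>{..<2}. exv {..<2} mult_op j m * exv A (?\<phi> j) a m)
        = (\<Sum>j\<in>{..<2}. 1 * exv A (?\<phi> j) a m)] (mod int m)"
      by (intro cong_sum cong_mult cong_refl) (simp add: exv_mult_op m cong_def)
    also have "(\<Sum>j\<in>{..<2}. 1 * exv A (?\<phi> j) a m) = exv A (term_val \<nu> A (pow_term i t k)) a m + exv A (term_val \<nu> A t) a m"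
      by (simp add: numeral_2_eq_2)
    also have "[\<dots> = int (Suc k) * exv A (term_val \<nu> A t) a m + exv A (term_val \<nu> A t) a m] (mod int m)"
      by (intro cong_add cong_refl Suc)
    finally show ?case by (simp add: algebra_simps)
  qed simp
qed

lemma rational_lists: "a \<in> A \<Longrightarrow> rational A {concat us | us. set us \<subseteq> {[a]}}"
  by (intro rational.star rational.symbol)

context abelian_pv
begin

lemma exponents_compact_choice:
  assumes "finite A" "L \<subseteq> lists A"
    and "\<And>m n u. m \<in> exponents V \<Longrightarrow> n \<in> exponents V \<Longrightarrow> m dvd n \<Longrightarrow> Q n u \<Longrightarrow> Q m u"
    and "\<And>m. m \<in> exponents V \<Longrightarrow> \<exists>u\<in>L. u \<noteq> [] \<and> Q m u"
  obtains w where "w \<in> carrier (Omega FinS A)" "Some w \<in> Cl A L"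
    "\<And>m. m \<in> exponents V \<Longrightarrow> \<exists>u\<in>L. u \<noteq> [] \<and> Q m u \<and> (\<forall>a\<in>A. exv A w a m = int (count_list u a) mod int m)"
proof (rule compact_choice[OF assms(1,2), of "exponents V" Q])
  show "0 \<notin> exponents V" using exponents_pos by blast
  show "Lcm M \<in> exponents V" if "finite M" "M \<subseteq> exponents V" for M by (rule exponents_Lcm[OF that])
  show "Q m u" if "m \<in> exponents V" "n \<in> exponents V" "m dvd n" "Q n u" for m n u
    by (rule assms(3)[OF that])
  show "\<exists>u\<in>L. u \<noteq> [] \<and> Q m u" if "m \<in> exponents V" for m by (rule assms(4)[OF that])
qed (rule that; assumption)

lemma pow_term_satisfies_iff:
  assumes \<sigma>: "implicit_signature \<sigma>" and \<nu>: "range \<nu> = \<sigma>" and i: "\<nu> i = (2, mult_op)"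
    and t: "wf_term \<nu> {0} t" and n: "0 < n" and d: "0 < d"
  shows "satisfies V {0} (term_val \<nu> {0} (pow_term i t (n - 1))) (term_val \<nu> {0} (pow_term i (Var 0) (d - 1)))
    \<longleftrightarrow> (\<forall>m\<in>exponents V. [int n * exv {0} (term_val \<nu> {0} t) 0 m = int d] (mod int m))"
proof -
  note pt = pow_term[OF \<sigma> \<nu> i, of "{0}" 0]
  have a: "wf_term \<nu> {0} (Var 0)" by simp
  have in_Omega: "term_val \<nu> {0} s \<in> carrier (Omega FinS {0})" if "wf_term \<nu> {0} s" for s
    using sigma_sub_in_Omega[OF \<sigma> term_val_sigma_sub[OF \<nu> that]] .
  have "satisfies V {0} (term_val \<nu> {0} (pow_term i t (n - 1))) (term_val \<nu> {0} (pow_term i (Var 0) (d - 1)))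
    \<longleftrightarrow> (\<forall>m\<in>exponents V. exv {0} (term_val \<nu> {0} (pow_term i t (n - 1))) 0 m
      = exv {0} (term_val \<nu> {0} (pow_term i (Var 0) (d - 1))) 0 m)"
    using satisfies_iff[OF _ in_Omega in_Omega] pt(1)[OF _ _ t] pt(1)[OF _ _ a] by simp
  also have "\<dots> \<longleftrightarrow> (\<forall>m\<in>exponents V. [int n * exv {0} (term_val \<nu> {0} t) 0 m = int d] (mod int m))"
  proof (rule ball_cong[OF refl])
    fix m assume m: "m \<in> exponents V"
    have m0: "0 < m" by (rule exponents_pos[OF m])
    have "exv {0} (term_val \<nu> {0} (pow_term i t (n - 1))) 0 m = exv {0} (term_val \<nu> {0} (pow_term i (Var 0) (d - 1))) 0 m
      \<longleftrightarrow> [exv {0} (term_val \<nu> {0} (pow_term i t (n - 1))) 0 m = exv {0} (term_val \<nu> {0} (pow_term i (Var 0) (d - 1))) 0 m] (mod int m)"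
      using exv_bounds[OF _ _ in_Omega[OF pt(1)[OF _ _ t]] m0, of 0] exv_bounds[OF _ _ in_Omega[OF pt(1)[OF _ _ a]] m0, of 0]
      by (simp add: cong_def)
    also have "\<dots> \<longleftrightarrow> [int n * exv {0} (term_val \<nu> {0} t) 0 m = int d * exv {0} (term_val \<nu> {0} (Var 0)) 0 m] (mod int m)"
      using pt(2)[OF _ _ t m0, of "n - 1"] pt(2)[OF _ _ a m0, of "d - 1"] n d unfolding cong_def by simp
    also have "\<dots> \<longleftrightarrow> [int n * exv {0} (term_val \<nu> {0} t) 0 m = int d] (mod int m)"
      using m0 by (simp add: exv_letter cong_def mod_mult_right_eq)
    finally show "exv {0} (term_val \<nu> {0} (pow_term i t (n - 1))) 0 m = exv {0} (term_val \<nu> {0} (pow_term i (Var 0) (d - 1))) 0 m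
      \<longleftrightarrow> [int n * exv {0} (term_val \<nu> {0} t) 0 m = int d] (mod int m)" .
  qed
  finally show ?thesis .
qed

text \<open>The pair of \<open>t\<close> and \<open>d\<close> is a finite certificate against
  \<open>n\<close>: if \<open>n\<close> were an exponent, the identity modulo \<open>n\<close> would
  say that \<open>n\<close> divides \<open>d\<close>. Reducibility is what turns a solution in
  pseudowords into such a term.\<close>

lemma not_exponent_term:
  assumes \<sigma>: "implicit_signature \<sigma>" and \<nu>: "range \<nu> = \<sigma>" and i: "\<nu> i = (2, mult_op)"
    and red: "\<And>E. is_system \<sigma> E \<Longrightarrow> reducible_for \<sigma> V E" and n: "0 < n" "n \<notin> exponents V"
  obtains t d where "wf_term \<nu> {0} t" "0 < d" "d < n"
    "satisfies V {0} (term_val \<nu> {0} (pow_term i t (n - 1))) (term_val \<nu> {0} (pow_term i (Var 0) (d - 1)))"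
proof -
  text \<open>The system \<open>x\<^sup>n = a\<^sup>d\<close> for the greatest common divisor \<open>d\<close> of \<open>n\<close> and the members of
    \<open>exponents V\<close> has a solution modulo \<open>V\<close>.\<close>
  define G where "G = (\<lambda>m. gcd n m) ` exponents V"
  have G: "finite G" "G \<noteq> {}"
    using exponents_1 n(1) by (auto simp: G_def intro: finite_subset[of _ "{..n}"])
  define d where "d = Max G"
  have "d \<in> G" unfolding d_def by (rule Max_in[OF G])
  then obtain m0 where m0: "m0 \<in> exponents V" "d = gcd n m0" by (auto simp: G_def)
  have d0: "0 < d" using n(1) m0 by simp
  have dn: "d < n"
  proof (rule ccontr)
    assume "\<not> d < n"
    then have "gcd n m0 = n" using m0(2) n(1) by (simp add: not_less dual_order.antisym dvd_imp_le)
    then have "n dvd m0" by (metis gcd_dvd2)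
    then show False using n(2) exponents_dvd[OF m0(1)] by blast
  qed
  \<comment> \<open>The largest gcd is a multiple of all others: replacing \<open>m0\<close> by
    \<open>lcm m m0\<close> gives a gcd that is a multiple of \<open>d\<close> and, by maximality,
    equal to \<open>d\<close>.\<close>
  have gcd_d: "gcd n m dvd d" if m: "m \<in> exponents V" for m
  proof -
    have "gcd n (lcm m m0) \<in> G" using exponents_lcm[OF m m0(1)] by (auto simp: G_def)
    then have le: "gcd n (lcm m m0) \<le> d" unfolding d_def by (rule Max_ge[OF G(1)])
    have "d dvd gcd n (lcm m m0)" unfolding m0(2) by (auto intro: dvd_lcmI2)
    moreover have "0 < gcd n (lcm m m0)" using n(1) by simp
    ultimately have "d = gcd n (lcm m m0)" using le dvd_imp_le by (metis antisym)
    then show ?thesis by (auto intro: dvd_lcmI1)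
  qed
  \<comment> \<open>The letter \<open>a\<close> is the letter 0 of the alphabet and enters the
    equation as the value of the parameter 1. The language of all powers of \<open>a\<close> is the
    whole free monoid on this alphabet, so the constraint excludes nothing.\<close>
  define E where "E = \<lparr>variables = {0}, parameters = {1}, alphabet = {0},
    equations = {(word FinS {0, 1} (replicate n 0), word FinS {0, 1} (replicate d 1))},
    constraint = \<lambda>_. {concat us | us. set us \<subseteq> {[0]}}, param_value = \<lambda>_. letter FinS {0} 0\<rparr>"
  have E: "variables E = {0}" "parameters E = {1}" "alphabet E = {0}"
    "equations E = {(word FinS {0, 1} (replicate n 0), word FinS {0, 1} (replicate d 1))}"
    "constraint E x = {concat us | us. set us \<subseteq> {[0]}}" "param_value E x = letter FinS {0} 0" for x
    by (auto simp: E_def)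
  have U: "unknowns E = {0, 1}" unfolding E by auto
  have sys: "is_system \<sigma> E"
  proof -
    have mult: "(2, mult_op) \<in> \<sigma>" using \<sigma> by (simp add: implicit_signature_def mult_op_def)
    have "word FinS {0, 1} (replicate n 0) \<in> sigma_sub \<sigma> FinS {0, 1}"
      "word FinS {0, 1} (replicate d 1) \<in> sigma_sub \<sigma> FinS {0, 1}"
      by (rule word_sigma_sub[OF mult]; use n(1) d0 in \<open>auto simp: in_lists_conv_set\<close>)+
    then show ?thesis
      unfolding is_system_def U unfolding E using rational_lists[of 0 "{0}"] by (auto intro: sigma_sub.gen)
  qed
  have eq_iff: "satisfies V {0} (\<delta> (word FinS {0, 1} (replicate n 0))) (\<delta> (word FinS {0, 1} (replicate d 1)))
      \<longleftrightarrow> (\<forall>m\<in>exponents V. [int n * exv {0} (\<delta> (letter FinS {0, 1} 0)) 0 m = int d] (mod int m))"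
    if \<delta>: "cont_hom (Omega FinS {0, 1}) (Omega_top FinS {0, 1}) (Omega FinS {0}) (Omega_top FinS {0}) \<delta>"
      and \<delta>1: "\<delta> (letter FinS {0, 1} 1) = letter FinS {0} 0" for \<delta>
  proof -
    let ?\<phi> = "\<lambda>a. \<delta> (letter FinS {0, 1} a)"
    have wO: "word FinS {0, 1} (replicate k b) \<in> carrier (Omega FinS {0, 1})" if "0 < k" "b \<in> {0, 1}" for k b
      using that by (intro word_in_Omega[OF order_refl]) (auto simp: in_lists_conv_set)
    have \<phi>: "?\<phi> \<in> {0, 1} \<rightarrow> carrier (Omega FinS {0})"
      using \<delta> letter_in_Omega[OF order_refl, of _ "{0, 1}"] by (auto simp: cont_hom_def sg_hom_def)
    have ev: "[exv {0} (\<delta> (word FinS {0, 1} (replicate k b))) 0 m = int k * exv {0} (?\<phi> b) 0 m] (mod int m)"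
      if kb: "0 < k" "b \<in> {0, 1}" and m: "m \<in> exponents V" for k b m
    proof -
      have m0: "0 < m" by (rule exponents_pos[OF m])
      have cnt: "count_list (replicate k b) c = (if c = b then k else 0)" for c by (induction k) auto
      have ex: "[exv {0, 1} (word FinS {0, 1} (replicate k b)) c m = int (if c = b then k else 0)] (mod int m)"
        if c: "c \<in> {0, 1}" for c
      proof -
        have "exv {0, 1} (word FinS {0, 1} (replicate k b)) c m = int (count_list (replicate k b) c) mod int m"
          by (rule exv_word[OF _ c _ _ m0]) (use kb in \<open>auto simp: in_lists_conv_set\<close>)
        then show ?thesis unfolding cnt cong_def by simp
      qed
      have "[exv {0} (\<delta> (word FinS {0, 1} (replicate k b))) 0 m
        = (\<Sum>c\<in>{0, 1}. exv {0, 1} (word FinS {0, 1} (replicate k b)) c m * exv {0} (?\<phi> c) 0 m)] (mod int m)"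
        unfolding cont_hom_eq_hat[OF \<delta> wO[OF kb]] by (rule exv_hat[OF _ _ _ \<phi> wO[OF kb] m0]) auto
      also have "[(\<Sum>c\<in>{0, 1}. exv {0, 1} (word FinS {0, 1} (replicate k b)) c m * exv {0} (?\<phi> c) 0 m)
        = (\<Sum>c\<in>{0, 1}. int (if c = b then k else 0) * exv {0} (?\<phi> c) 0 m)] (mod int m)"
        by (intro cong_sum cong_mult cong_refl ex)
      also have "(\<Sum>c\<in>{0, 1}. int (if c = b then k else 0) * exv {0} (?\<phi> c) 0 m) = int k * exv {0} (?\<phi> b) 0 m"
        using kb(2) by auto
      finally show ?thesis .
    qed
    have \<delta>O: "\<delta> (word FinS {0, 1} (replicate k b)) \<in> carrier (Omega FinS {0})" if "0 < k" "b \<in> {0, 1}" for k b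
      using \<delta> wO[OF that] by (auto simp: cont_hom_def sg_hom_def)
    have one: "[int d * exv {0} (?\<phi> 1) 0 m = int d] (mod int m)" if "m \<in> exponents V" for m
    proof -
      have "exv {0} (?\<phi> 1) 0 m = 1 mod int m"
        unfolding \<delta>1 using exv_letter[of 0 "{0}" 0 m] exponents_pos[OF that] by simp
      then show ?thesis by (simp only: cong_def mod_mult_right_eq mult_1_right)
    qed
    have b1: "exv {0} (\<delta> (word FinS {0, 1} (replicate k b))) 0 m mod int m
      = exv {0} (\<delta> (word FinS {0, 1} (replicate k b))) 0 m"
      if "0 < k" "b \<in> {0, 1}" "m \<in> exponents V" for k b m
      using exv_bounds[OF _ _ \<delta>O[OF that(1,2)] exponents_pos[OF that(3)], of 0] by simp
    have "satisfies V {0} (\<delta> (word FinS {0, 1} (replicate n 0))) (\<delta> (word FinS {0, 1} (replicate d 1))) \<longleftrightarrow>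
      (\<forall>m\<in>exponents V. [exv {0} (\<delta> (word FinS {0, 1} (replicate n 0))) 0 m
        = exv {0} (\<delta> (word FinS {0, 1} (replicate d 1))) 0 m] (mod int m))"
      using satisfies_iff[OF _ \<delta>O[OF n(1)] \<delta>O[OF d0], of 0 1] b1 n(1) d0 by (simp add: cong_def)
    also have "\<dots> \<longleftrightarrow> (\<forall>m\<in>exponents V. [int n * exv {0} (?\<phi> 0) 0 m = int d] (mod int m))"
    proof (rule ball_cong[OF refl])
      fix m assume m: "m \<in> exponents V"
      show "[exv {0} (\<delta> (word FinS {0, 1} (replicate n 0))) 0 m
        = exv {0} (\<delta> (word FinS {0, 1} (replicate d 1))) 0 m] (mod int m)
        \<longleftrightarrow> [int n * exv {0} (?\<phi> 0) 0 m = int d] (mod int m)"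
        using ev[OF n(1) _ m, of 0] ev[OF d0 _ m, of 1] one[OF m] unfolding cong_def by simp
    qed
    finally show ?thesis .
  qed
  have L: "{concat us | us. set us \<subseteq> {[0]}} \<subseteq> lists {0 :: nat}"
    by (rule rational_subset[OF rational_lists]) simp
  have "\<exists>\<delta>. solution V E \<delta>"
  proof -
    obtain w where w: "w \<in> carrier (Omega FinS {0})" "Some w \<in> Cl {0} {concat us | us. set us \<subseteq> {[0]}}"
      "\<And>m. m \<in> exponents V \<Longrightarrow> \<exists>u\<in>{concat us | us. set us \<subseteq> {[0]}}. u \<noteq> [] \<and>
        [int n * int (count_list u 0) = int d] (mod int m) \<and>
        (\<forall>a\<in>{0}. exv {0} w a m = int (count_list u a) mod int m)"
    proof (rule exponents_compact_choice[OF _ L, of "\<lambda>m u. [int n * int (count_list u 0) = int d] (mod int m)"])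
      show "[int n * int (count_list u 0) = int d] (mod int m)"
        if "[int n * int (count_list u 0) = int d] (mod int k)" "m dvd k" for m k u
        using that(1) by (rule cong_dvd_modulus) (use that(2) in simp)
      fix m assume m: "m \<in> exponents V"
      have m0: "0 < m" by (rule exponents_pos[OF m])
      obtain y where y: "[int n * y = int d] (mod int m)"
      proof -
        obtain e where e: "d = gcd n m * e" using gcd_d[OF m] by blast
        obtain x where "[int n * x = gcd (int n) (int m)] (mod int m)" using cong_solve_int by blast
        then have "[int n * x * int e = gcd (int n) (int m) * int e] (mod int m)" by (rule cong_scalar_right)
        then show thesis using that[of "x * int e"] by (simp add: e mult.assoc)
      qed
      \<comment> \<open>Adding \<open>m\<close> makes the exponent positive, so the word is
        nonempty.\<close>
      define k where "k = nat (y mod int m) + m"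
      have "[int k = y] (mod int m)" using m0 by (simp add: k_def cong_def)
      then have "[int n * int k = int d] (mod int m)" using y by (metis cong_scalar_left cong_trans)
      moreover have "count_list (replicate k (0 :: nat)) 0 = k" by (induction k) auto
      moreover have "replicate k (0 :: nat) \<in> {concat us | us. set us \<subseteq> {[0]}}"
      proof (intro CollectI exI conjI)
        show "replicate k (0 :: nat) = concat (replicate k [0])" by (induction k) auto
      qed auto
      moreover have "replicate k (0 :: nat) \<noteq> []" using m0 by (simp add: k_def)
      ultimately show "\<exists>u\<in>{concat us | us. set us \<subseteq> {[0 :: nat]}}. u \<noteq> [] \<and> [int n * int (count_list u 0) = int d] (mod int m)"
        by (intro bexI[of _ "replicate k (0 :: nat)"] conjI) (simp_all only: not_False_eq_True)
    next
      fix w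
      assume "w \<in> carrier (Omega FinS {0})" "Some w \<in> Cl {0} {concat us | us. set us \<subseteq> {[0]}}"
        and "\<And>m. m \<in> exponents V \<Longrightarrow> \<exists>u\<in>{concat us | us. set us \<subseteq> {[0]}}. u \<noteq> [] \<and>
          [int n * int (count_list u 0) = int d] (mod int m) \<and>
          (\<forall>a\<in>{0}. exv {0} w a m = int (count_list u a) mod int m)"
      then show thesis by (rule that)
    qed simp_all
    let ?\<phi> = "\<lambda>x :: nat. if x = 0 then w else letter FinS {0} 0"
    let ?\<delta> = "hat {0, 1} (Omega FinS {0}) (Omega_top FinS {0}) ?\<phi>"
    have \<phi>: "?\<phi> \<in> {0, 1} \<rightarrow> carrier (Omega FinS {0})"
      using w(1) letter_in_Omega[OF order_refl, of 0 "{0}"] by auto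
    have \<delta>l: "?\<delta> (letter FinS {0, 1} 0) = w" "?\<delta> (letter FinS {0, 1} 1) = letter FinS {0} 0"
      using hat_letter[OF \<phi>] by simp_all
    have "[int n * exv {0} w 0 m = int d] (mod int m)" if m: "m \<in> exponents V" for m
    proof -
      obtain u :: "nat list" where "[int n * int (count_list u 0) = int d] (mod int m)" "exv {0} w 0 m = int (count_list u 0) mod int m"
        using w(3)[OF m] by blast
      then show ?thesis by (simp add: cong_def mod_mult_right_eq)
    qed
    then have "satisfies V {0} (?\<delta> (word FinS {0, 1} (replicate n 0))) (?\<delta> (word FinS {0, 1} (replicate d 1)))"
      using eq_iff[OF hat_cont_hom[OF \<phi>] \<delta>l(2)] \<delta>l(1) by simp
    then have "solution V E ?\<delta>"
      unfolding solution_def U unfolding E using hat_cont_hom[OF \<phi>] \<delta>l w(2) by simp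
    then show ?thesis by blast
  qed
  then obtain \<delta> where \<delta>: "solution V E \<delta>" "\<delta> (letter FinS {0, 1} 0) \<in> sigma_sub \<sigma> FinS {0}"
    using red[OF sys] unfolding reducible_for_def U unfolding E by blast
  obtain t where t: "wf_term \<nu> {0} t" "term_val \<nu> {0} t = \<delta> (letter FinS {0, 1} 0)"
    using sigma_sub_term[OF \<nu> \<delta>(2)] by blast
  have hom: "cont_hom (Omega FinS {0, 1}) (Omega_top FinS {0, 1}) (Omega FinS {0}) (Omega_top FinS {0}) \<delta>"
    and \<delta>1: "\<delta> (letter FinS {0, 1} 1) = letter FinS {0} 0"
    and sat: "satisfies V {0} (\<delta> (word FinS {0, 1} (replicate n 0))) (\<delta> (word FinS {0, 1} (replicate d 1)))"
    using \<delta>(1) unfolding solution_def U unfolding E by simp_all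
  have "\<forall>m\<in>exponents V. [int n * exv {0} (term_val \<nu> {0} t) 0 m = int d] (mod int m)"
    using eq_iff[OF hom \<delta>1] sat unfolding t(2) by (rule iffD1)
  moreover have a: "wf_term \<nu> {0} (Var 0)" by simp
  ultimately have "satisfies V {0} (term_val \<nu> {0} (pow_term i t (n - 1))) (term_val \<nu> {0} (pow_term i (Var 0) (d - 1)))"
    using pow_term_satisfies_iff[OF \<sigma> \<nu> i t(1) n(1) d0] by simp
  then show thesis using that t(1) d0 dn by blast
qed

text \<open>Two kinds of certificates are searched simultaneously: an element of order
  \<open>n\<close> in an enumerated member of \<open>V\<close>, and a term with a number
  \<open>d\<close> as in \<open>not_exponent_term\<close>. Every positive \<open>n\<close> has a
  certificate of exactly one kind, so the kind of the first one found decides.\<close>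

lemma tame_imp_decidable:
  assumes "completely_tame V" shows "decidable_pv V"
proof -
  obtain \<sigma> where \<sigma>: "implicit_signature \<sigma>" and tame: "completely_sigma_tame \<sigma> V"
    using assms by (auto simp: completely_tame_def)
  have red: "reducible_for \<sigma> V E" if "is_system \<sigma> E" for E
    using tame that unfolding completely_sigma_tame_def sigma_tame_def by blast
  have "decidable_word_problem \<sigma> V" and "rec_enumerable_pv V"
    using tame unfolding completely_sigma_tame_def sigma_tame_def by blast+
  then obtain \<nu> e f ar where \<nu>: "range \<nu> = \<sigma>" and ar: "recursive_fun 1 ar" "\<And>i. ar [i] = fst (\<nu> i)"
    and f: "recursive_fun 2 f" "\<And>s t. wf_term \<nu> {0} s \<Longrightarrow> wf_term \<nu> {0} t \<Longrightarrow>
      f [term_code s, term_code t] = of_bool (satisfies V {0} (term_val \<nu> {0} s) (term_val \<nu> {0} t))"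
    and e: "recursive_fun 1 e" "\<And>n. table_code (e [n])" "\<And>n. table_sg (e [n]) \<in> V"
      "\<And>S. S \<in> V \<Longrightarrow> \<exists>n. sg_isomorphic S (table_sg (e [n]))"
    unfolding decidable_word_problem_def effective_enumeration_def rec_enumerable_pv_def of_bool_def
    by (metis finite.emptyI finite.insertI)
  have "(2, mult_op) \<in> \<sigma>" using \<sigma> by (simp add: implicit_signature_def mult_op_def)
  then obtain i where i: "\<nu> i = (2, mult_op)" using \<nu> by (metis rangeE)
  have "computable 1 (\<lambda>xs. fst (\<nu> (hd xs)))"
    by (rule computable_cong[OF computable_recursive[OF ar(1)]]) (use ar(2) in \<open>auto simp: length_Suc_conv\<close>)
  moreover have "decidable 1 (\<lambda>xs. hd xs \<in> {0 :: nat})" unfolding singleton_iff by (intro comp_intros) simp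
  ultimately obtain W where W: "decidable 1 (\<lambda>xs. W (hd xs))" "\<And>t. W (term_code t) \<longleftrightarrow> wf_term \<nu> {0} t"
    using decidable_wf_term by blast
  define P where "P y n \<longleftrightarrow> psnd y < pfst (e [pfst y]) \<and> tord (e [pfst y]) (psnd y) = n" for y n
  \<comment> \<open>The argument \<open>0\<close> of \<open>pow_code\<close> is the code of the term
    \<open>Var 0\<close>, that is, of the letter \<open>a\<close>.\<close>
  define N where "N y n \<longleftrightarrow> W (pfst y) \<and> 0 < psnd y \<and> psnd y < n \<and>
    f [pow_code i (pfst y) (n - 1), pow_code i 0 (psnd y - 1)] = 1" for y n
  have W': "decidable k (\<lambda>xs. W (g xs))" if "computable k g" for k g
    using computable_comp1[OF W(1)[unfolded decidable_def] that] by (simp add: decidable_def)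
  have decP: "decidable k (\<lambda>xs. P (g xs) (h xs))" if "computable k g" "computable k h" for k g h
    unfolding P_def by (intro comp_intros computable_comp1[OF computable_recursive[OF e(1)]] that)
  have decN: "decidable k (\<lambda>xs. N (g xs) (h xs))" if "computable k g" "computable k h" for k g h
    unfolding N_def by (intro comp_intros W' computable_comp2[OF computable_recursive[OF f(1)]] that)
  have P: "n \<in> exponents V" if "P y n" for y n
    using table_sg_in_V[OF e(2)] e(3) that unfolding P_def by blast
  have N: "n \<notin> exponents V" if "N y n" for y n
  proof
    assume n: "n \<in> exponents V"
    obtain t where t: "term_code t = pfst y" using term_code_surj by blast
    define d where "d = psnd y"
    have d: "0 < d" "d < n" "wf_term \<nu> {0} t" using that t W(2) unfolding N_def d_def by metis+
    have "term_code (Var 0) = 0" by (simp add: term_code_Var)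
    then have "f [term_code (pow_term i t (n - 1)), term_code (pow_term i (Var 0) (d - 1))] = 1"
      using that t pow_code[of i t] pow_code[of i "Var 0"] by (simp add: N_def d_def)
    moreover have "wf_term \<nu> {0} (Var 0)" by simp
    ultimately have "of_bool (satisfies V {0} (term_val \<nu> {0} (pow_term i t (n - 1)))
        (term_val \<nu> {0} (pow_term i (Var 0) (d - 1)))) = (1 :: nat)"
      using f(2)[of "pow_term i t (n - 1)" "pow_term i (Var 0) (d - 1)"] pow_term(1)[OF \<sigma> \<nu> i, of "{0}" 0] d(3)
      by (simp only: finite.intros singleton_iff simp_thms)
    then have "[int n * exv {0} (term_val \<nu> {0} t) 0 n = int d] (mod int n)"
      using pow_term_satisfies_iff[OF \<sigma> \<nu> i d(3)] d n by (simp only: of_bool_eq_1_iff)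
    then have "int n dvd int d" by (metis cong_dvd_iff dvd_triv_left)
    then show False using d by (auto dest: dvd_imp_le)
  qed
  have ex: "\<exists>y. n = 0 \<or> P y n \<or> N y n" for n
  proof (cases "n = 0 \<or> n \<in> exponents V")
    case True
    show ?thesis
    proof (cases "n = 0")
      case False
      then have n: "0 < n" "Zn n \<in> V" using True by (auto simp: exponents_def)
      obtain m where "sg_isomorphic (Zn n) (table_sg (e [m]))" using e(4)[OF n(2)] by blast
      then obtain g where g: "sg_hom (Zn n) (table_sg (e [m])) g" "bij_betw g (carrier (Zn n)) (carrier (table_sg (e [m])))"
        by (auto simp: sg_isomorphic_def)
      have x: "1 mod n \<in> carrier (Zn n)" using n by simp
      then have gx: "g (1 mod n) < pfst (e [m])" using g(1) by (auto simp: sg_hom_def carrier_table_sg)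
      have "tord (e [m]) (g (1 mod n)) = group.ord (grp (table_sg (e [m]))) (g (1 mod n))"
        by (rule tord[OF e(2) abelian[OF e(3)] gx])
      also have "\<dots> = group.ord (grp (Zn n)) (1 mod n)"
        by (rule ord_isomorphic[OF Zn_abelian[OF n(1)] abelian[OF e(3)] g(1) bij_betw_imp_inj_on[OF g(2)] x])
      also have "\<dots> = n" by (rule ord_Zn_1[OF n(1)])
      finally have "P (prod_encode (m, g (1 mod n))) n" using gx by (simp add: P_def)
      then show ?thesis by blast
    qed simp
  next
    case False
    then have n: "0 < n" "n \<notin> exponents V" by auto
    obtain t d where t: "wf_term \<nu> {0} t" "0 < d" "d < n"
      "satisfies V {0} (term_val \<nu> {0} (pow_term i t (n - 1))) (term_val \<nu> {0} (pow_term i (Var 0) (d - 1)))"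
      by (rule not_exponent_term[OF \<sigma> \<nu> i red n])
    have "term_code (Var 0) = 0" by (simp add: term_code_Var)
    moreover have "wf_term \<nu> {0} (Var 0)" by simp
    ultimately have "N (prod_encode (term_code t, d)) n"
      using t W(2) pow_code[of i t] pow_code[of i "Var 0"] pow_term(1)[OF \<sigma> \<nu> i, of "{0}" 0]
        f(2)[of "pow_term i t (n - 1)" "pow_term i (Var 0) (d - 1)"] by (simp add: N_def)
    then show ?thesis by blast
  qed
  have "computable 1 (\<lambda>xs. LEAST y. hd xs = 0 \<or> P y (hd xs) \<or> N y (hd xs))"
    by (rule computable_Least) (intro comp_intros decP decN ex; simp)+
  then have "decidable 1 (\<lambda>xs. 0 < hd xs \<and> P (LEAST y. hd xs = 0 \<or> P y (hd xs) \<or> N y (hd xs)) (hd xs))"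
    by (intro comp_intros decP) simp_all
  moreover have "0 < n \<and> P (LEAST y. n = 0 \<or> P y n \<or> N y n) n \<longleftrightarrow> n \<in> exponents V" for n
    using LeastI_ex[OF ex[of n]] P N exponents_pos by blast
  ultimately show ?thesis unfolding decidable_pv_iff by simp
qed

end

section \<open>Decidability implies tameness\<close>

text \<open>Indices of operations are natural numbers and have to name every rational language;
  expressions show that there are only countably many.\<close>

datatype rexp = RZero | ROne | RAtom nat | RPlus rexp rexp | RTimes rexp rexp | RStar rexp

instance rexp :: countable
  by countable_datatype

fun rlang :: "rexp \<Rightarrow> nat list set" where
  "rlang RZero = {}"
| "rlang ROne = {[]}"
| "rlang (RAtom a) = {[a]}"
| "rlang (RPlus r s) = rlang r \<union> rlang s"
| "rlang (RTimes r s) = {u @ v | u v. u \<in> rlang r \<and> v \<in> rlang s}"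
| "rlang (RStar r) = {concat us | us. set us \<subseteq> rlang r}"

lemma rational_rlang: "rational A L \<Longrightarrow> \<exists>r. rlang r = L"
proof (induction rule: rational.induct)
  case empty show ?case by (rule exI[of _ RZero]) simp
next
  case epsilon show ?case by (rule exI[of _ ROne]) simp
next
  case (symbol a) show ?case by (rule exI[of _ "RAtom a"]) simp
next
  case (union K L)
  then obtain r s where "rlang r = K" "rlang s = L" by blast
  then show ?case by (intro exI[of _ "RPlus r s"]) simp
next
  case (product K L)
  then obtain r s where "rlang r = K" "rlang s = L" by blast
  then show ?case by (intro exI[of _ "RTimes r s"]) simp
next
  case (star L)
  then obtain r where "rlang r = L" by blast
  then show ?case by (intro exI[of _ "RStar r"]) simp
qed

text \<open>The list of letters matches the argument positions of an operation with the alphabet of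
  the language.\<close>

definition lang_of :: "nat \<Rightarrow> nat list \<times> nat list set" where
  "lang_of e = (list_decode (pfst e), rlang (from_nat (psnd e)))"

lemma lang_of_surj:
  assumes "rational A L" obtains e where "lang_of e = (as, L)"
proof -
  obtain r where "rlang r = L" using rational_rlang[OF assms] by blast
  then show thesis by (intro that[of "prod_encode (list_encode as, to_nat r)"]) (simp add: lang_of_def)
qed

lemma Cl_in_Omega: "L \<subseteq> lists A \<Longrightarrow> Some w \<in> Cl A L \<Longrightarrow> w \<in> carrier (Omega FinS A)"
  by (simp add: Cl_Some_iff in_closure_of topspace_Omega_top[OF order_refl])

text \<open>Both sides are continuous homomorphisms in \<open>w\<close> that agree on letters. The
  lemma serves to rename an alphabet to an initial segment of the natural numbers and back.\<close>

lemma hat_hat: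
  assumes \<phi>: "\<phi> \<in> A \<rightarrow> carrier (Omega FinS B)" and \<psi>: "\<psi> \<in> B \<rightarrow> carrier (Omega FinS A)"
    and id: "\<And>a. a \<in> A \<Longrightarrow> hat B (Omega FinS A) (Omega_top FinS A) \<psi> (\<phi> a) = letter FinS A a"
    and w: "w \<in> carrier (Omega FinS A)"
  shows "hat B (Omega FinS A) (Omega_top FinS A) \<psi> (hat A (Omega FinS B) (Omega_top FinS B) \<phi> w) = w"
proof -
  let ?f = "hat A (Omega FinS B) (Omega_top FinS B) \<phi>" and ?g = "hat B (Omega FinS A) (Omega_top FinS A) \<psi>"
  have "cont_hom (Omega FinS A) (Omega_top FinS A) (Omega FinS A) (Omega_top FinS A) (?g \<circ> ?f)"
    using hat_cont_hom[OF \<phi>] hat_cont_hom[OF \<psi>] sg_hom_compose continuous_map_compose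
    unfolding cont_hom_def by blast
  moreover have "cont_hom (Omega FinS A) (Omega_top FinS A) (Omega FinS A) (Omega_top FinS A) id"
    by (simp add: cont_hom_def sg_hom_def)
  ultimately have "(?g \<circ> ?f) w = id w"
    by (rule cont_hom_unique[OF order_refl _ _ Omega_Hausdorff[OF order_refl] _ w])
       (simp add: hat_letter[OF \<phi>] id)
  then show ?thesis by simp
qed

text \<open>Each coordinate of \<open>w\<close> is approximated by words of the language, and there
  is only one.\<close>

lemma Cl_singleton:
  assumes u: "u \<in> lists A" "u \<noteq> []" and w: "Some w \<in> Cl A {u}"
  shows "w = word FinS A u"
proof -
  have L: "{u} \<subseteq> lists A" using u by simp
  have ext: "w \<in> carrier (big_product FinS A)" "word FinS A u \<in> carrier (big_product FinS A)"
    using Cl_in_Omega[OF L w] Omega_subset[OF order_refl] word_in_product[OF order_refl u] by auto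
  have "w i = word FinS A u i" if "i \<in> interp FinS A" for i
    using Omega_closure_approx[of w A "word FinS A ` nonempty_words {u}" "{i}"] w that
    unfolding Cl_Some_iff[OF L] by (auto simp: nonempty_words_def)
  then show ?thesis
    using ext by (intro PiE_ext[of w "interp FinS A" "\<lambda>i. carrier (fst i)"]) (auto simp: big_product_def)
qed

lemma Cl_mem: assumes "L \<subseteq> lists A" "u \<in> L" "u \<noteq> []" shows "Some (word FinS A u) \<in> Cl A L"
proof -
  have "word FinS A ` nonempty_words L \<subseteq> topspace (Omega_top FinS A)"
    using words_in_Omega[OF assms(1)] by (simp add: topspace_Omega_top[OF order_refl])
  moreover have "word FinS A u \<in> word FinS A ` nonempty_words L" using assms by (simp add: nonempty_words_def)
  ultimately show ?thesis unfolding Cl_Some_iff[OF assms(1)] using closure_of_subset by blast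
qed

context abelian_pv
begin

lemma eqv_sym: "eqv x y \<Longrightarrow> eqv y x"
  by (simp add: eqv_def cong_sym_eq)

lemma eqv_trans: "eqv x y \<Longrightarrow> eqv y z \<Longrightarrow> eqv x z"
  unfolding eqv_def by (blast intro: cong_trans)

lemma compat_exv:
  assumes "finite A" "a \<in> A" "w \<in> carrier (Omega FinS A)" shows "compat (exv A w a)"
  unfolding compat_def
  using exv_mod[OF assms] exponents_pos by (auto simp: cong_def)

lemma exv_hat_eqv:
  assumes "finite A" "a \<in> A" "finite B" "\<phi> \<in> B \<rightarrow> carrier (Omega FinS A)" "u \<in> carrier (Omega FinS B)"
  shows "eqv (exv A (hat B (Omega FinS A) (Omega_top FinS A) \<phi> u) a)
    (\<lambda>m. \<Sum>b\<in>B. exv B u b m * exv A (\<phi> b) a m)"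
  unfolding eqv_def using exv_hat[OF assms exponents_pos] by blast

section \<open>The signature of operations with rational exponents\<close>

definition good :: "nat \<Rightarrow> pseudoword \<Rightarrow> bool" where
  "good i w \<longleftrightarrow> w \<in> carrier (Omega FinS {..<Suc (pfst i)}) \<and>
     (\<forall>j<Suc (pfst i). rep (coef i j) (exv {..<Suc (pfst i)} w j))"

text \<open>The operation lives on the letters given by its argument positions; substituting the
  list \<open>as\<close> moves it to the alphabet of \<open>L\<close>, where its membership in the
  closure can be required.\<close>

definition special :: "nat \<Rightarrow> pseudoword \<Rightarrow> bool" where
  "special i w \<longleftrightarrow> good i w \<and> (case lang_of (psnd (psnd i)) of (as, L) \<Rightarrow>
     Some (hat {..<Suc (pfst i)} (Omega FinS (set as)) (Omega_top FinS (set as))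
       (\<lambda>j. letter FinS (set as) (as ! j)) w) \<in> Cl (set as) L)"

text \<open>The signature has, for every rational language \<open>L\<close> and every list of codes, an operation with
  these exponents modulo \<open>V\<close> that lies in the closure of \<open>L\<close>, provided that there is one.  The
  enumeration need not be constructive; only the exponents are read off the index by an algorithm.\<close>

definition op_of :: "nat \<Rightarrow> pseudoword" where
  "op_of i = (SOME w. good i w \<and> ((\<exists>v. special i v) \<longrightarrow> special i w))"

definition ops :: "nat \<Rightarrow> implicit_op" where
  "ops i = (Suc (pfst i), op_of i)"

text \<open>Modulo each exponent the codes have solutions, and words with the corresponding numbers
  of letters exist; compactness combines them. So every index denotes an operation with the coded
  exponents, even if the closure condition cannot be met.\<close>

lemma good_exists: "\<exists>w. good i w"
proof -
  let ?A = "{..<Suc (pfst i)}"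
  let ?Q = "\<lambda>m u. \<forall>j\<in>?A. sol (coef i j) m (count_list u j)"
  obtain w where w: "w \<in> carrier (Omega FinS ?A)"
    "\<And>m. m \<in> exponents V \<Longrightarrow> \<exists>u\<in>lists ?A. u \<noteq> [] \<and> ?Q m u \<and> (\<forall>a\<in>?A. exv ?A w a m = int (count_list u a) mod int m)"
  proof (rule exponents_compact_choice[of ?A "lists ?A" ?Q])
    show "?Q m u" if "m dvd n" "?Q n u" for m n u using sol_mono[OF that(1)] that(2) by blast
    fix m assume m: "m \<in> exponents V"
    have "\<forall>j. \<exists>y. sol (coef i j) m y" using sol_exists[OF valid_coef m] by blast
    then obtain y where y: "\<And>j. sol (coef i j) m (y j)" by metis
    obtain u where u: "u \<in> lists ?A" "\<forall>j\<in>?A. count_list u j = y j + m"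
      using word_with_counts[of ?A "\<lambda>j. y j + m"] by blast
    have "count_list u 0 \<noteq> 0" using u(2) exponents_pos[OF m] by simp
    then have "u \<noteq> []" by auto
    moreover have "?Q m u" using u(2) sol_add[OF y] by simp
    ultimately show "\<exists>u\<in>lists ?A. u \<noteq> [] \<and> ?Q m u" using u(1) by blast
  qed auto
  have "rep (coef i j) (exv ?A w j)" if j: "j < Suc (pfst i)" for j
  proof (rule rep_of_sol[OF valid_coef compat_exv[OF _ _ w(1)]])
    fix m assume "m \<in> exponents V"
    then obtain u where "?Q m u" "\<forall>a\<in>?A. exv ?A w a m = int (count_list u a) mod int m" using w(2) by blast
    then show "\<exists>y. sol (coef i j) m y \<and> [exv ?A w j m = int y] (mod int m)"
      using j by (intro exI[of _ "count_list u j"]) (auto simp: cong_def)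
  qed (use j in auto)
  then show ?thesis using w(1) unfolding good_def by blast
qed

lemma op_of: "good i (op_of i)" "special i v \<Longrightarrow> special i (op_of i)"
proof -
  have "\<exists>w. good i w \<and> ((\<exists>v. special i v) \<longrightarrow> special i w)"
    using good_exists[of i] by (cases "\<exists>v. special i v") (auto simp: special_def)
  then have *: "good i (op_of i) \<and> ((\<exists>v. special i v) \<longrightarrow> special i (op_of i))"
    unfolding op_of_def by (rule someI_ex)
  then show "good i (op_of i)" "special i v \<Longrightarrow> special i (op_of i)" by blast+
qed

lemma op_of_in_Omega: "op_of i \<in> carrier (Omega FinS {..<Suc (pfst i)})"
  using op_of(1) by (simp add: good_def)

lemma op_of_rep: "j < Suc (pfst i) \<Longrightarrow> rep (coef i j) (exv {..<Suc (pfst i)} (op_of i) j)"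
  using op_of(1) by (simp add: good_def)

lemma coef_index:
  assumes "j < length zs" "valid (zs ! j)"
  shows "coef (prod_encode (n, prod_encode (list_encode (map enc zs), e))) j = zs ! j"
  using assms by (simp add: coef_def nthc_encode Let_def)

text \<open>Although \<open>op_of\<close> is an arbitrary choice, the closure of
  \<open>{[0, 1]}\<close> contains only that word. The index with this language and both
  coefficients 1 must therefore denote multiplication.\<close>

lemma mult_in_ops: "(2, mult_op) \<in> range ops"
proof -
  have rat: "rational {0, 1} {[0, 1]}"
    using rational.product[OF rational.symbol[of 0 "{0, 1}"] rational.symbol[of 1 "{0, 1}"]] by simp
  obtain e where e: "lang_of e = ([0, 1], {[0, 1]})" using lang_of_surj[OF rat] by blast
  let ?z = "(1, 1, 0, 1, 0) :: nat \<times> nat \<times> nat \<times> nat \<times> nat"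
  define i where "i = prod_encode (1, prod_encode (list_encode (map enc [?z, ?z]), e))"
  have i: "Suc (pfst i) = 2" "psnd (psnd i) = e" by (simp_all add: i_def)
  have z: "rep ?z (\<lambda>_. 1)" using rep_const[of 1 0] by simp
  have set: "set [0, 1] = {..<2 :: nat}" by auto
  have coef: "coef i j = ?z" if "j < 2" for j
  proof -
    have "[?z, ?z] ! j = ?z" using that by (auto simp: less_2_cases_iff)
    then show ?thesis
      using coef_index[of j "[?z, ?z]" 1 e] rep_valid[OF z] that unfolding i_def by simp
  qed
  have "rep (coef i j) (exv {..<2} mult_op j)" if j: "j < 2" for j
  proof -
    have "eqv (\<lambda>_. 1) (exv {..<2} mult_op j)"
      unfolding eqv_def using exv_mult_op[OF j] exponents_pos by (simp add: cong_def)
    then show ?thesis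
      unfolding coef[OF j] using rep_eqv[OF z compat_exv[OF _ _ mult_op_in_Omega]] j by simp
  qed
  then have good: "good i mult_op" unfolding good_def i(1) using mult_op_in_Omega by simp
  let ?h = "hat {..<2} (Omega FinS {..<2}) (Omega_top FinS {..<2}) (\<lambda>j. letter FinS {..<2} ([0, 1] ! j))"
  have h: "?h w = w" if w: "w \<in> carrier (Omega FinS {..<2})" for w
  proof -
    have l: "(\<lambda>j. letter FinS {..<2} ([0, 1] ! j)) \<in> {..<2} \<rightarrow> carrier (Omega FinS {..<2})"
      using letter_in_Omega[OF order_refl, of _ "{..<2}"] by (auto simp: less_2_cases_iff)
    have "?h w = id w"
    proof (rule cont_hom_unique[OF order_refl hat_cont_hom[OF l] _ Omega_Hausdorff[OF order_refl] _ w])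
      show "cont_hom (Omega FinS {..<2}) (Omega_top FinS {..<2}) (Omega FinS {..<2}) (Omega_top FinS {..<2}) id"
        by (simp add: cont_hom_def sg_hom_def)
      show "?h (letter FinS {..<2} a) = id (letter FinS {..<2} a)" if "a \<in> {..<2}" for a
        using hat_letter[OF l that] that by (auto simp: less_2_cases_iff)
    qed
    then show ?thesis by simp
  qed
  have special_iff: "special i w \<longleftrightarrow> good i w \<and> Some (?h w) \<in> Cl {..<2} {[0, 1]}" for w
    unfolding special_def i e prod.case set ..
  have L: "{[0, 1]} \<subseteq> lists {..<2 :: nat}" by auto
  have "special i mult_op"
    unfolding special_iff h[OF mult_op_in_Omega]
    using good Cl_mem[OF L, of "[0, 1]"] by (simp add: mult_op_def)
  then have "special i (op_of i)" by (rule op_of(2))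
  moreover have "op_of i \<in> carrier (Omega FinS {..<2})" using op_of_in_Omega[of i] by (simp only: i(1))
  ultimately have "Some (op_of i) \<in> Cl {..<2} {[0, 1]}" unfolding special_iff by (simp only: h)
  then have "op_of i = mult_op"
    unfolding mult_op_def using L by (intro Cl_singleton) auto
  then have "ops i = (2, mult_op)" by (simp add: ops_def i(1) del: One_nat_def)
  then show ?thesis by (metis rangeI)
qed

lemma ops_signature: "implicit_signature (range ops)"
  unfolding implicit_signature_def using op_of_in_Omega mult_in_ops by (auto simp: ops_def mult_op_def)

lemma ops_effective: "effective_enumeration (range ops) ops"
proof -
  have "computable 1 (\<lambda>xs. Suc (pfst (hd xs)))" by (intro comp_intros) simp
  then obtain f where "recursive_fun 1 f" "\<And>xs. length xs = 1 \<Longrightarrow> f xs = Suc (pfst (hd xs))"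
    by (auto simp: computable_def)
  then show ?thesis unfolding effective_enumeration_def ops_def by (auto intro!: exI[of _ f])
qed

text \<open>Letters have exponents 0 or 1, operations act linearly with rational coefficients, and
  rational elements form a ring. In particular the linear systems that arise below have rational
  coefficients.\<close>

lemma rat_sigma_sub:
  assumes A: "finite A" "a \<in> A" and w: "w \<in> sigma_sub (range ops) FinS A"
  shows "rat (exv A w a)"
  using w
proof induction
  case (gen b)
  have "eqv (\<lambda>_. of_bool (b = a)) (exv A (letter FinS A b) a)"
    unfolding eqv_def using exv_letter[OF A(2) gen] exponents_pos by (simp add: cong_def)
  then show ?case
    by (rule rat_eqv[OF rat_const compat_exv[OF A letter_in_Omega[OF order_refl gen]]])
next
  case (op n w \<phi>)
  then obtain i where i: "n = Suc (pfst i)" "w = op_of i" by (auto simp: ops_def)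
  have \<phi>: "\<phi> \<in> {..<n} \<rightarrow> carrier (Omega FinS A)"
    using op.IH sigma_sub_in_Omega[OF ops_signature] by auto
  have w: "w \<in> carrier (Omega FinS {..<n})" unfolding i by (rule op_of_in_Omega)
  have "rat (exv {..<n} w b)" if "b < n" for b
    using op_of_rep[of b i] that unfolding rat_def i by blast
  then have "rat (\<lambda>m. \<Sum>b\<in>{..<n}. exv {..<n} w b m * exv A (\<phi> b) a m)"
    using op.IH by (intro rat_sum rat_mult) auto
  then show ?case
  proof (rule rat_eqv[OF _ compat_exv[OF A hat_closed[OF \<phi> w]]])
    show "eqv (\<lambda>m. \<Sum>b\<in>{..<n}. exv {..<n} w b m * exv A (\<phi> b) a m)
      (exv A (hat {..<n} (Omega FinS A) (Omega_top FinS A) \<phi> w) a)"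
      using exv_hat_eqv[OF A _ \<phi> w] unfolding eqv_def by (simp add: cong_sym)
  qed
qed

text \<open>Satisfaction means equality of the exponents of each letter. Codes of these are computed
  from the terms and compared by \<open>decidable_eqv\<close>, for the finitely many letters in
  turn.\<close>

lemma ops_word_problem:
  assumes D: "decidable 1 (\<lambda>xs. hd xs \<in> exponents V)"
  shows "decidable_word_problem (range ops) V"
  unfolding decidable_word_problem_def
proof (intro exI[of _ ops] conjI allI impI ops_effective)
  fix A :: "nat set" assume A: "finite A"
  have in_Omega: "term_val ops A t \<in> carrier (Omega FinS A)" if "wf_term ops A t" for t
    using sigma_sub_in_Omega[OF ops_signature term_val_sigma_sub[OF refl that]] .
  obtain E where E: "decidable 2 (\<lambda>xs. E (xs ! 0) (xs ! 1))"
    "\<And>z z' x y. rep (dec z) x \<Longrightarrow> rep (dec z') y \<Longrightarrow> E z z' \<longleftrightarrow> eqv x y"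
    using decidable_eqv by blast
  have "\<exists>P. decidable 2 P \<and> (\<forall>s t. wf_term ops A s \<and> wf_term ops A t \<longrightarrow>
      P [term_code s, term_code t] = eqv (exv A (term_val ops A s) a) (exv A (term_val ops A t) a))"
    if a: "a \<in> A" for a
  proof -
    obtain v where v: "computable 1 (\<lambda>xs. v (hd xs))"
      and vVar: "\<And>x. v (term_code (Var x)) = enc (1, of_bool (x = a), 0, 1, 0)"
      and vApp: "\<And>i ts. v (term_code (App i ts)) = rec_nat (enc (1, 0, 0, 1, 0))
        (\<lambda>j r. enc (code_add (dec r) (code_mult (coef i j) (dec (v (term_code (ts ! j))))))) (length ts)"
      using computable_term_value[OF D] by blast
    have rep: "rep (dec (v (term_code t))) (exv A (term_val ops A t) a)" if "wf_term ops A t" for t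
      using that
    proof (induction t)
      case (Var x)
      have "eqv (\<lambda>_. of_bool (x = a)) (exv A (letter FinS A x) a)"
        unfolding eqv_def using exv_letter[OF a, of x] Var.prems exponents_pos by (simp add: cong_def)
      then show ?case
        unfolding vVar dec_enc using rep_eqv[OF rep_of_bool compat_exv[OF A a in_Omega[OF Var.prems]]]
        unfolding term_val.simps by blast
    next
      case (App i ts)
      let ?n = "Suc (pfst i)"
      have len: "length ts = ?n" using App.prems by (simp add: ops_def)
      let ?\<phi> = "\<lambda>j. map (term_val ops A) ts ! j"
      have \<phi>: "?\<phi> \<in> {..<?n} \<rightarrow> carrier (Omega FinS A)"
        using App.prems in_Omega by (auto simp: len)
      let ?r = "rec_nat (enc (1, 0, 0, 1, 0))
        (\<lambda>j r. enc (code_add (dec r) (code_mult (coef i j) (dec (v (term_code (ts ! j)))))))"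
      have partial: "rep (dec (?r k)) (\<lambda>m. \<Sum>j<k. exv {..<?n} (op_of i) j m * exv A (?\<phi> j) a m)" if "k \<le> ?n" for k
        using that
      proof (induction k)
        case 0
        have "rep (1, 0, 0, 1, 0) (\<lambda>m. 0)" using rep_const[of 0 0] by (simp del: rep.simps)
        then show ?case by (simp del: enc.simps rep.simps)
      next
        case (Suc k)
        have k: "k < length ts" using Suc.prems len by simp
        then have "rep (dec (v (term_code (ts ! k)))) (exv A (?\<phi> k) a)"
          using App.IH[of "ts ! k"] App.prems by simp
        then have "rep (code_mult (coef i k) (dec (v (term_code (ts ! k)))))
            (\<lambda>m. exv {..<?n} (op_of i) k m * exv A (?\<phi> k) a m)"
          using op_of_rep[of k i] Suc.prems by (intro rep_mult) auto
        then show ?case using rep_add[OF Suc.IH] Suc.prems by (simp del: code_add.simps code_mult.simps)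
      qed
      have "rep (dec (v (term_code (App i ts)))) (\<lambda>m. \<Sum>j<?n. exv {..<?n} (op_of i) j m * exv A (?\<phi> j) a m)"
        unfolding vApp len by (rule partial[OF order_refl])
      then show ?case
      proof (rule rep_eqv[OF _ compat_exv[OF A a in_Omega[OF App.prems]]])
        show "eqv (\<lambda>m. \<Sum>j<?n. exv {..<?n} (op_of i) j m * exv A (?\<phi> j) a m) (exv A (term_val ops A (App i ts)) a)"
          using exv_hat_eqv[OF A a _ \<phi> op_of_in_Omega] unfolding eqv_def by (simp add: ops_def cong_sym)
      qed
    qed
    have v': "computable k (\<lambda>xs. v (f xs))" if "computable k f" for k f
      using computable_comp1[OF v that] by simp
    have E': "decidable k (\<lambda>xs. E (f xs) (g xs))" if "computable k f" "computable k g" for k f g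
      using computable_comp2[OF E(1)[unfolded decidable_def] that] by (simp add: decidable_def)
    have "decidable 2 (\<lambda>xs. E (v (xs ! 0)) (v (xs ! 1)))"
      by (intro E' v' comp_intros) simp_all
    then show ?thesis using E(2) rep by (intro exI[of _ "\<lambda>xs. E (v (xs ! 0)) (v (xs ! 1))"]) simp
  qed
  then obtain P where P: "\<And>a. a \<in> A \<Longrightarrow> decidable 2 (P a)"
    "\<And>a s t. a \<in> A \<Longrightarrow> wf_term ops A s \<Longrightarrow> wf_term ops A t \<Longrightarrow>
      P a [term_code s, term_code t] = eqv (exv A (term_val ops A s) a) (exv A (term_val ops A t) a)"
    by metis
  have "finite B \<Longrightarrow> B \<subseteq> A \<Longrightarrow> decidable 2 (\<lambda>xs. \<forall>a\<in>B. P a xs)" for B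
  proof (induction B rule: finite_induct)
    case (insert b B)
    then show ?case using decidable_conj[of 2 "P b"] P(1) by simp
  qed (simp add: decidable_const)
  then have "decidable 2 (\<lambda>xs. \<forall>a\<in>A. P a xs)" using A by blast
  then obtain f where f: "recursive_fun 2 f" "\<And>xs. length xs = 2 \<Longrightarrow> f xs = of_bool (\<forall>a\<in>A. P a xs)"
    by (auto simp: decidable_def computable_def)
  show "\<exists>f. recursive_fun 2 f \<and> (\<forall>s t. wf_term ops A s \<and> wf_term ops A t \<longrightarrow>
      f [term_code s, term_code t] = (if satisfies V A (term_val ops A s) (term_val ops A t) then 1 else 0))"
  proof (intro exI[of _ f] conjI f(1) allI impI)
    fix s t assume st: "wf_term ops A s \<and> wf_term ops A t"
    then have s: "term_val ops A s \<in> carrier (Omega FinS A)" and t: "term_val ops A t \<in> carrier (Omega FinS A)"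
      using in_Omega by auto
    have "satisfies V A (term_val ops A s) (term_val ops A t) \<longleftrightarrow>
      (\<forall>a\<in>A. eqv (exv A (term_val ops A s) a) (exv A (term_val ops A t) a))"
      unfolding satisfies_iff[OF A s t] eqv_def cong_def
      using exv_bounds[OF A _ s exponents_pos] exv_bounds[OF A _ t exponents_pos] by simp
    also have "\<dots> \<longleftrightarrow> (\<forall>a\<in>A. P a [term_code s, term_code t])" using P(2) st by simp
    finally show "f [term_code s, term_code t] = (if satisfies V A (term_val ops A s) (term_val ops A t) then 1 else 0)"
      using f(2)[of "[term_code s, term_code t]"] by simp
  qed
qed

section \<open>Reducibility\<close>

lemma closure_coset:
  assumes A: "finite A" and L: "L \<subseteq> lists A" and F: "semilinear L F" and y: "Some y \<in> Cl A L"
  obtains g hs \<alpha> where "(g, hs) \<in> F" "\<And>i. i < length hs \<Longrightarrow> compat (\<alpha> i)"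
    "\<And>a. a \<in> A \<Longrightarrow> eqv (exv A y a) (\<lambda>m. g a + (\<Sum>i<length hs. \<alpha> i m * (hs ! i) a))"
proof -
  have yO: "y \<in> carrier (Omega FinS A)" by (rule Cl_in_Omega[OF L y])
  define P where "P p m \<longleftrightarrow> (\<exists>v\<in>int_span (snd p). \<forall>a\<in>A. [exv A y a m = fst p a + v a] (mod int m))" for p m
  have down: "[exv A y a m = c] (mod int m)"
    if "a \<in> A" "n \<in> exponents V" "m dvd n" "[exv A y a n = c] (mod int n)" for a m n c
  proof -
    have "exv A y a m = exv A y a n mod int m"
      by (rule exv_mod[OF A that(1) yO that(3) exponents_pos[OF that(2)]])
    moreover have "[exv A y a n = c] (mod int m)" using that(4) by (rule cong_dvd_modulus) (use that(3) in simp)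
    ultimately show ?thesis by (simp add: cong_def)
  qed
  have some: "\<exists>p\<in>F. P p m" if m: "m \<in> exponents V" for m
  proof -
    obtain u where u: "u \<in> L" "u \<noteq> []" "\<And>a k. a \<in> A \<Longrightarrow> k \<in> {m} \<Longrightarrow> exv A y a k = int (count_list u a) mod int k"
      by (rule closure_approx[OF A L y[unfolded Cl_Some_iff[OF L]] finite.emptyI empty_subsetI, of "{m}"])
         (use exponents_pos[OF m] in auto)
    have "u \<in> nonempty_words L" using u by (simp add: nonempty_words_def)
    then obtain g hs v where "(g, hs) \<in> F" "v \<in> int_span hs" "\<And>a. int (count_list u a) = g a + v a"
      by (rule semilinear_cover[OF F]) (rule that; blast)
    then show ?thesis using u(3) unfolding P_def by (intro bexI[of _ "(g, hs)"] bexI[of _ v]) (auto simp: cong_def)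
  qed
  \<comment> \<open>If each of the finitely many cosets failed at some modulus, all would fail at
    the least common multiple of these moduli.\<close>
  have "\<exists>p\<in>F. \<forall>m\<in>exponents V. P p m"
  proof (rule ccontr)
    assume "\<not> ?thesis"
    then obtain M where M: "\<And>p. p \<in> F \<Longrightarrow> M p \<in> exponents V \<and> \<not> P p (M p)" by metis
    have n: "Lcm (M ` F) \<in> exponents V" using M F by (intro exponents_Lcm) (auto simp: semilinear_def)
    obtain p where p: "p \<in> F" "P p (Lcm (M ` F))" using some[OF n] by blast
    then have "P p (M p)"
      unfolding P_def using down[OF _ n, of _ "M p"] by (meson dvd_Lcm imageI)
    then show False using M p(1) by blast
  qed
  then obtain g hs where gh: "(g, hs) \<in> F" "\<And>m. m \<in> exponents V \<Longrightarrow> P (g, hs) m" by auto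
  \<comment> \<open>The coefficients of the \<open>k\<close> periods are realised as exponents of an
    auxiliary pseudoword, which makes compactness available for choosing them compatibly. The extra
    letter \<open>k\<close> keeps the approximating words nonempty.\<close>
  define k where "k = length hs"
  let ?Q = "\<lambda>m u. \<forall>a\<in>A. [exv A y a m = g a + (\<Sum>i<k. int (count_list u i) * (hs ! i) a)] (mod int m)"
  have A': "finite {..<Suc k}" by simp
  obtain w where w: "w \<in> carrier (Omega FinS {..<Suc k})"
    "\<And>m. m \<in> exponents V \<Longrightarrow> \<exists>u\<in>lists {..<Suc k}. u \<noteq> [] \<and> ?Q m u \<and>
      (\<forall>a\<in>{..<Suc k}. exv {..<Suc k} w a m = int (count_list u a) mod int m)"
  proof (rule exponents_compact_choice[OF A' order_refl, of ?Q])
    show "?Q m u" if "n \<in> exponents V" "m dvd n" "?Q n u" for m n u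
      using down[OF _ that(1,2)] that(3) by blast
    fix m assume m: "m \<in> exponents V"
    obtain c where c: "\<forall>a\<in>A. [exv A y a m = g a + (\<Sum>i<k. c i * (hs ! i) a)] (mod int m)"
      using gh(2)[OF m] unfolding P_def k_def by (auto simp: int_span_sum)
    obtain u where u: "u \<in> lists {..<Suc k}" "\<forall>i\<in>{..<Suc k}. count_list u i = (if i = k then 1 else nat (c i mod int m))"
      using word_with_counts[OF A', of "\<lambda>i. if i = k then 1 else nat (c i mod int m)"] by blast
    have "count_list u k \<noteq> 0" using u(2) by simp
    then have "u \<noteq> []" by auto
    moreover have "?Q m u"
    proof
      fix a assume "a \<in> A"
      then have "[exv A y a m = g a + (\<Sum>i<k. c i * (hs ! i) a)] (mod int m)" using c by blast
      also have "[g a + (\<Sum>i<k. c i * (hs ! i) a) = g a + (\<Sum>i<k. int (count_list u i) * (hs ! i) a)] (mod int m)"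
        using u(2) exponents_pos[OF m]
        by (intro cong_add cong_sum cong_mult cong_refl) (simp add: cong_def)
      finally show "[exv A y a m = g a + (\<Sum>i<k. int (count_list u i) * (hs ! i) a)] (mod int m)" .
    qed
    ultimately show "\<exists>u\<in>lists {..<Suc k}. u \<noteq> [] \<and> ?Q m u" using u(1) by blast
  next
    fix w assume "w \<in> carrier (Omega FinS {..<Suc k})"
      "\<And>m. m \<in> exponents V \<Longrightarrow> \<exists>u\<in>lists {..<Suc k}. u \<noteq> [] \<and> ?Q m u \<and>
        (\<forall>a\<in>{..<Suc k}. exv {..<Suc k} w a m = int (count_list u a) mod int m)"
    then show thesis by (rule that)
  qed
  show thesis
  proof (rule that[OF gh(1)])
    show "compat (exv {..<Suc k} w i)" if "i < length hs" for i
      by (rule compat_exv[OF A' _ w(1)]) (use that in \<open>simp add: k_def\<close>)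
    fix a assume a: "a \<in> A"
    show "eqv (exv A y a) (\<lambda>m. g a + (\<Sum>i<length hs. exv {..<Suc k} w i m * (hs ! i) a))"
      unfolding eqv_def k_def[symmetric]
    proof
      fix m assume m: "m \<in> exponents V"
      obtain u where u: "?Q m u" "\<forall>a\<in>{..<Suc k}. exv {..<Suc k} w a m = int (count_list u a) mod int m"
        using w(2)[OF m] by blast
      have "[exv A y a m = g a + (\<Sum>i<k. int (count_list u i) * (hs ! i) a)] (mod int m)" using u(1) a by blast
      also have "[g a + (\<Sum>i<k. int (count_list u i) * (hs ! i) a)
          = g a + (\<Sum>i<k. exv {..<Suc k} w i m * (hs ! i) a)] (mod int m)"
        using u(2) by (intro cong_add cong_sum cong_mult cong_refl) (simp add: cong_def)
      finally show "[exv A y a m = g a + (\<Sum>i<k. exv {..<Suc k} w i m * (hs ! i) a)] (mod int m)" .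
    qed
  qed
qed

text \<open>This is the converse of \<open>closure_coset\<close>: modulo each exponent the density
  part of \<open>semilinear\<close> provides a word of \<open>L\<close> with the prescribed counts,
  and compactness gives a pseudoword in the closure.\<close>

lemma coset_realised:
  assumes A: "finite A" and L: "L \<subseteq> lists A" and F: "semilinear L F" and gh: "(g, hs) \<in> F"
    and \<beta>: "\<And>i. i < length hs \<Longrightarrow> compat (\<beta> i)"
  obtains w where "w \<in> carrier (Omega FinS A)" "Some w \<in> Cl A L"
    "\<And>a. a \<in> A \<Longrightarrow> eqv (exv A w a) (\<lambda>m. g a + (\<Sum>i<length hs. \<beta> i m * (hs ! i) a))"
proof -
  let ?y = "\<lambda>a m. g a + (\<Sum>i<length hs. \<beta> i m * (hs ! i) a)"
  have y: "compat (?y a)" for a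
    by (intro compat_add compat_sum compat_mult compat_const \<beta>) simp
  let ?Q = "\<lambda>m u. \<forall>a. [int (count_list u a) = ?y a m] (mod int m)"
  obtain w where w: "w \<in> carrier (Omega FinS A)" "Some w \<in> Cl A L"
    "\<And>m. m \<in> exponents V \<Longrightarrow> \<exists>u\<in>L. u \<noteq> [] \<and> ?Q m u \<and> (\<forall>a\<in>A. exv A w a m = int (count_list u a) mod int m)"
  proof (rule exponents_compact_choice[OF A L, of ?Q])
    show "?Q m u" if "n \<in> exponents V" "m dvd n" "?Q n u" for m n u
    proof
      fix a
      have "[int (count_list u a) = ?y a n] (mod int n)" using that(3) by blast
      then have "[int (count_list u a) = ?y a n] (mod int m)"
        by (rule cong_dvd_modulus) (use that(2) in simp)
      then show "[int (count_list u a) = ?y a m] (mod int m)"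
        using compatD[OF y that(1,2), of a] by (rule cong_trans)
    qed
    fix m assume m: "m \<in> exponents V"
    have "(\<lambda>a. \<Sum>i<length hs. \<beta> i m * (hs ! i) a) \<in> int_span hs"
      unfolding int_span_sum by (intro exI[of _ "\<lambda>i. \<beta> i m"]) simp
    then obtain u where "u \<in> nonempty_words L" "\<And>a. [int (count_list u a) = ?y a m] (mod int m)"
      by (rule semilinear_dense[OF F gh _ exponents_pos[OF m]]) (rule that; blast)
    then show "\<exists>u\<in>L. u \<noteq> [] \<and> ?Q m u" by (auto simp: nonempty_words_def)
  next
    fix w assume "w \<in> carrier (Omega FinS A)" "Some w \<in> Cl A L"
      "\<And>m. m \<in> exponents V \<Longrightarrow> \<exists>u\<in>L. u \<noteq> [] \<and> ?Q m u \<and> (\<forall>a\<in>A. exv A w a m = int (count_list u a) mod int m)"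
    then show thesis by (rule that)
  qed
  show thesis
  proof (rule that[OF w(1,2)])
    fix a assume a: "a \<in> A"
    show "eqv (exv A w a) (?y a)"
      unfolding eqv_def
    proof
      fix m assume m: "m \<in> exponents V"
      obtain u where "?Q m u" "\<forall>a\<in>A. exv A w a m = int (count_list u a) mod int m" using w(3)[OF m] by blast
      then show "[exv A w a m = ?y a m] (mod int m)" using a by (simp add: cong_def)
    qed
  qed
qed

text \<open>The codes of the exponents of \<open>w0\<close>, together with \<open>L\<close>, form an
  index for which \<open>w0\<close>, with its letters renamed, is a witness of
  \<open>special\<close>. The operation selected for this index is then special as well, so it lies
  in the closure of \<open>L\<close> and has the same exponents modulo \<open>V\<close>.\<close>

lemma sigma_choice:
  assumes A: "finite A" "A \<noteq> {}" and L: "rational A L" and w0: "Some w0 \<in> Cl A L"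
    and rat: "\<And>a. a \<in> A \<Longrightarrow> rat (exv A w0 a)"
  obtains w where "w \<in> sigma_sub (range ops) FinS A" "Some w \<in> Cl A L"
    "\<And>a. a \<in> A \<Longrightarrow> eqv (exv A w a) (exv A w0 a)"
proof -
  have w0O: "w0 \<in> carrier (Omega FinS A)" by (rule Cl_in_Omega[OF rational_subset[OF L] w0])
  obtain al where al: "set al = A" "distinct al" using finite_distinct_list[OF A(1)] by blast
  \<comment> \<open>Indices store the arity minus one, as there are no operations without
    arguments.\<close>
  define n where "n = length al - 1"
  have n: "length al = Suc n" using A(2) al(1) by (cases al) (auto simp: n_def)
  obtain Z where Z: "\<And>a. a \<in> A \<Longrightarrow> rep (Z a) (exv A w0 a)" using rat unfolding rat_def by metis
  obtain e where e: "lang_of e = (al, L)" by (rule lang_of_surj[OF L])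
  define i where "i = prod_encode (n, prod_encode (list_encode (map enc (map Z al)), e))"
  have i: "pfst i = n" "psnd (psnd i) = e" by (simp_all add: i_def)
  have asA: "al ! j \<in> A" if "j < Suc n" for j using al(1) n that nth_mem by metis
  have coef: "coef i j = Z (al ! j)" if "j < Suc n" for j
    using coef_index[of j "map Z al" n e] that n rep_valid[OF Z[OF asA[OF that]]] unfolding i_def by simp
  define idx where "idx a = (SOME j. j < Suc n \<and> al ! j = a)" for a
  have idx: "idx a < Suc n" "al ! idx a = a" if "a \<in> A" for a
    using someI_ex[of "\<lambda>j. j < Suc n \<and> al ! j = a"] that al(1) n unfolding idx_def
    by (metis in_set_conv_nth)+
  have idx_nth: "idx (al ! j) = j" if "j < Suc n" for j
    using idx[OF asA[OF that]] al(2) n that by (metis nth_eq_iff_index_eq)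
  let ?N = "{..<Suc n}"
  let ?\<phi> = "\<lambda>a. letter FinS ?N (idx a)" and ?\<psi> = "\<lambda>j. letter FinS A (al ! j)"
  have \<phi>: "?\<phi> \<in> A \<rightarrow> carrier (Omega FinS ?N)" using idx letter_in_Omega[OF order_refl] by auto
  have \<psi>: "?\<psi> \<in> ?N \<rightarrow> carrier (Omega FinS A)" using asA letter_in_Omega[OF order_refl] by auto
  let ?g = "hat ?N (Omega FinS A) (Omega_top FinS A) ?\<psi>"
  define w1 where "w1 = hat A (Omega FinS ?N) (Omega_top FinS ?N) ?\<phi> w0"
  have w1O: "w1 \<in> carrier (Omega FinS ?N)" unfolding w1_def by (rule hat_closed[OF \<phi> w0O])
  have w1_back: "?g w1 = w0"
    unfolding w1_def by (rule hat_hat[OF \<phi> \<psi> _ w0O]) (use idx hat_letter[OF \<psi>] in auto)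
  have "rep (coef i j) (exv ?N w1 j)" if j: "j < Suc n" for j
  proof -
    have 1: "eqv (exv ?N w1 j) (\<lambda>m. \<Sum>b\<in>A. exv A w0 b m * exv ?N (?\<phi> b) j m)"
      unfolding w1_def by (rule exv_hat_eqv[OF _ _ A(1) \<phi> w0O]) (use j in auto)
    have 2: "[(\<Sum>b\<in>A. exv A w0 b m * exv ?N (?\<phi> b) j m) = exv A w0 (al ! j) m] (mod int m)"
      if m: "m \<in> exponents V" for m
    proof -
      have "[(\<Sum>b\<in>A. exv A w0 b m * exv ?N (?\<phi> b) j m) = (\<Sum>b\<in>A. exv A w0 b m * of_bool (b = al ! j))] (mod int m)"
      proof (intro cong_sum cong_mult cong_refl)
        fix b assume b: "b \<in> A"
        have "idx b = j \<longleftrightarrow> b = al ! j" using idx[OF b] idx_nth[OF j] by auto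
        then show "[exv ?N (?\<phi> b) j m = of_bool (b = al ! j)] (mod int m)"
          using exv_letter[of j ?N "idx b" m] idx(1)[OF b] j exponents_pos[OF m] by (simp add: cong_def)
      qed
      also have "(\<Sum>b\<in>A. exv A w0 b m * of_bool (b = al ! j)) = exv A w0 (al ! j) m"
        using A(1) asA[OF j] by (simp add: of_bool_def if_distrib sum.delta cong: if_cong)
      finally show ?thesis .
    qed
    have eq: "eqv (exv A w0 (al ! j)) (exv ?N w1 j)"
      by (rule eqv_sym[OF eqv_trans[OF 1]]) (unfold eqv_def, rule ballI, rule 2)
    show ?thesis
      unfolding coef[OF j] by (rule rep_eqv[OF Z[OF asA[OF j]] compat_exv[OF _ _ w1O] eq]) (use j in auto)
  qed
  then have "good i w1" unfolding good_def i using w1O by blast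
  then have "special i w1"
    unfolding special_def i e prod.case al(1) w1_back using w0 by (rule conjI)
  then have sp: "special i (op_of i)" by (rule op_of(2))
  then have Cl: "Some (?g (op_of i)) \<in> Cl A L"
    unfolding special_def i e prod.case al(1) by (rule conjunct2)
  have opO: "op_of i \<in> carrier (Omega FinS ?N)" using op_of_in_Omega[of i] by (simp only: i)
  show thesis
  proof (rule that[of "?g (op_of i)"])
    show "?g (op_of i) \<in> sigma_sub (range ops) FinS A"
    proof (rule sigma_sub.op)
      show "(Suc n, op_of i) \<in> range ops" by (rule range_eqI[of _ _ i]) (simp add: ops_def i)
      show "\<forall>j<Suc n. ?\<psi> j \<in> sigma_sub (range ops) FinS A" using asA sigma_sub.gen by blast
    qed
    show "Some (?g (op_of i)) \<in> Cl A L" by (rule Cl)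
    fix a assume a: "a \<in> A"
    let ?j = "idx a"
    have 1: "eqv (exv A (?g (op_of i)) a) (\<lambda>m. \<Sum>b\<in>?N. exv ?N (op_of i) b m * exv A (?\<psi> b) a m)"
      by (rule exv_hat_eqv[OF A(1) a _ \<psi> opO]) simp
    have 2: "[(\<Sum>b\<in>?N. exv ?N (op_of i) b m * exv A (?\<psi> b) a m) = exv ?N (op_of i) ?j m] (mod int m)"
      if m: "m \<in> exponents V" for m
    proof -
      have "[(\<Sum>b\<in>?N. exv ?N (op_of i) b m * exv A (?\<psi> b) a m) = (\<Sum>b\<in>?N. exv ?N (op_of i) b m * of_bool (b = ?j))] (mod int m)"
      proof (intro cong_sum cong_mult cong_refl)
        fix b assume b: "b \<in> ?N"
        have "al ! b = a \<longleftrightarrow> b = ?j" using idx(2)[OF a] idx_nth[of b] b by auto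
        then show "[exv A (?\<psi> b) a m = of_bool (b = ?j)] (mod int m)"
          using exv_letter[OF a asA, of b m] b exponents_pos[OF m] by (simp add: cong_def)
      qed
      also have "(\<Sum>b\<in>?N. exv ?N (op_of i) b m * of_bool (b = ?j)) = exv ?N (op_of i) ?j m"
        using idx(1)[OF a] by (simp add: of_bool_def if_distrib sum.delta cong: if_cong)
      finally show ?thesis .
    qed
    have 3: "eqv (exv A (?g (op_of i)) a) (exv ?N (op_of i) ?j)"
      by (rule eqv_trans[OF 1]) (unfold eqv_def, rule ballI, rule 2)
    have "rep (Z a) (exv ?N (op_of i) ?j)"
      using op_of_rep[of ?j i] coef[OF idx(1)[OF a]] idx[OF a] by (simp add: i)
    then have "eqv (exv ?N (op_of i) ?j) (exv A w0 a)" by (rule rep_unique[OF _ Z[OF a]])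
    with 3 show "eqv (exv A (?g (op_of i)) a) (exv A w0 a)" by (rule eqv_trans)
  qed
qed

lemma cong_cong_iff:
  fixes a b :: int
  assumes "[a = a'] (mod m)" "[b = b'] (mod m)" shows "[a = b] (mod m) \<longleftrightarrow> [a' = b'] (mod m)"
  using assms by (simp add: cong_def)

text \<open>By linearity of substitution, equality of the exponents of both sides is a linear
  condition on those of the \<open>\<phi> x\<close> and \<open>\<phi> p\<close>. Base points
  \<open>g\<close> and parameters go to the right-hand side, and the unknowns left are the
  coefficients of the periods, indexed by a variable and a position.\<close>

lemma satisfies_system_iff:
  fixes hs :: "nat \<Rightarrow> (nat \<Rightarrow> int) list" and g :: "nat \<Rightarrow> nat \<Rightarrow> int"
  assumes A: "finite A" and X: "finite X" and P: "finite P" and XP: "X \<inter> P = {}"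
    and u: "u \<in> carrier (Omega FinS (X \<union> P))" and v: "v \<in> carrier (Omega FinS (X \<union> P))"
    and \<phi>: "\<phi> \<in> X \<union> P \<rightarrow> carrier (Omega FinS A)"
    and coset: "\<And>x a. x \<in> X \<Longrightarrow> a \<in> A \<Longrightarrow>
      eqv (exv A (\<phi> x) a) (\<lambda>m. g x a + (\<Sum>i<length (hs x). \<gamma> (x, i) m * (hs x ! i) a))"
  shows "satisfies V A (hat (X \<union> P) (Omega FinS A) (Omega_top FinS A) \<phi> u)
      (hat (X \<union> P) (Omega FinS A) (Omega_top FinS A) \<phi> v) \<longleftrightarrow>
    (\<forall>a\<in>A. eqv (\<lambda>m. \<Sum>(x, i)\<in>Sigma X (\<lambda>x. {..<length (hs x)}).
        ((exv (X \<union> P) u x m - exv (X \<union> P) v x m) * (hs x ! i) a) * \<gamma> (x, i) m)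
      (\<lambda>m. - (\<Sum>x\<in>X. (exv (X \<union> P) u x m - exv (X \<union> P) v x m) * g x a)
           - (\<Sum>p\<in>P. (exv (X \<union> P) u p m - exv (X \<union> P) v p m) * exv A (\<phi> p) a m)))"
proof -
  let ?B = "X \<union> P" and ?h = "hat (X \<union> P) (Omega FinS A) (Omega_top FinS A) \<phi>"
  let ?J = "Sigma X (\<lambda>x. {..<length (hs x)})"
  have B: "finite ?B" using X P by simp
  have hu: "?h u \<in> carrier (Omega FinS A)" and hv: "?h v \<in> carrier (Omega FinS A)"
    using hat_closed[OF \<phi>] u v by auto
  have "exv A (?h u) a m = exv A (?h v) a m \<longleftrightarrow>
    [(\<Sum>(x, i)\<in>?J. ((exv ?B u x m - exv ?B v x m) * (hs x ! i) a) * \<gamma> (x, i) m)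
      = - (\<Sum>x\<in>X. (exv ?B u x m - exv ?B v x m) * g x a)
        - (\<Sum>p\<in>P. (exv ?B u p m - exv ?B v p m) * exv A (\<phi> p) a m)] (mod int m)"
    if a: "a \<in> A" and m: "m \<in> exponents V" for a m
  proof -
    define c where "c b = exv ?B u b m - exv ?B v b m" for b
    have m0: "0 < m" by (rule exponents_pos[OF m])
    have "exv A (?h u) a m = exv A (?h v) a m \<longleftrightarrow> [exv A (?h u) a m = exv A (?h v) a m] (mod int m)"
      using exv_bounds[OF A a hu m0] exv_bounds[OF A a hv m0] by (simp add: cong_def)
    also have "\<dots> \<longleftrightarrow> [(\<Sum>b\<in>?B. exv ?B u b m * exv A (\<phi> b) a m) = (\<Sum>b\<in>?B. exv ?B v b m * exv A (\<phi> b) a m)] (mod int m)"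
      by (rule cong_cong_iff[OF exv_hat[OF A a B \<phi> u m0] exv_hat[OF A a B \<phi> v m0]])
    also have "\<dots> \<longleftrightarrow> [(\<Sum>b\<in>?B. c b * exv A (\<phi> b) a m) = 0] (mod int m)"
      unfolding c_def by (simp add: cong_iff_dvd_diff left_diff_distrib sum_subtractf)
    also have "\<dots> \<longleftrightarrow> [(\<Sum>x\<in>X. c x * (g x a + (\<Sum>i<length (hs x). \<gamma> (x, i) m * (hs x ! i) a)))
        + (\<Sum>p\<in>P. c p * exv A (\<phi> p) a m) = 0] (mod int m)"
    proof -
      have "(\<Sum>b\<in>?B. c b * exv A (\<phi> b) a m) = (\<Sum>x\<in>X. c x * exv A (\<phi> x) a m) + (\<Sum>p\<in>P. c p * exv A (\<phi> p) a m)"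
        by (rule sum.union_disjoint[OF X P XP])
      moreover have "[(\<Sum>x\<in>X. c x * exv A (\<phi> x) a m)
          = (\<Sum>x\<in>X. c x * (g x a + (\<Sum>i<length (hs x). \<gamma> (x, i) m * (hs x ! i) a)))] (mod int m)"
        by (intro cong_sum cong_mult cong_refl bspec[OF coset[OF _ a, unfolded eqv_def] m])
      ultimately have "[(\<Sum>b\<in>?B. c b * exv A (\<phi> b) a m) = (\<Sum>x\<in>X. c x * (g x a + (\<Sum>i<length (hs x). \<gamma> (x, i) m * (hs x ! i) a)))
        + (\<Sum>p\<in>P. c p * exv A (\<phi> p) a m)] (mod int m)" by (simp add: cong_add_rcancel)
      then show ?thesis by (rule cong_cong_iff[OF _ cong_refl])
    qed
    also have "(\<Sum>x\<in>X. c x * (g x a + (\<Sum>i<length (hs x). \<gamma> (x, i) m * (hs x ! i) a)))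
      = (\<Sum>x\<in>X. c x * g x a) + (\<Sum>x\<in>X. \<Sum>i<length (hs x). (c x * (hs x ! i) a) * \<gamma> (x, i) m)"
      by (simp add: distrib_left sum.distrib sum_distrib_left ac_simps)
    also have "(\<Sum>x\<in>X. \<Sum>i<length (hs x). (c x * (hs x ! i) a) * \<gamma> (x, i) m)
      = (\<Sum>(x, i)\<in>?J. (c x * (hs x ! i) a) * \<gamma> (x, i) m)"
      using X by (intro sum.Sigma) auto
    finally have *: "exv A (?h u) a m = exv A (?h v) a m \<longleftrightarrow>
        [(\<Sum>x\<in>X. c x * g x a) + (\<Sum>(x, i)\<in>?J. (c x * (hs x ! i) a) * \<gamma> (x, i) m)
          + (\<Sum>p\<in>P. c p * exv A (\<phi> p) a m) = 0] (mod int m)" .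
    have shift: "[s + t + q = 0] (mod int m) \<longleftrightarrow> [t = - s - q] (mod int m)" for s t q
    proof -
      have "t - (- s - q) = s + t + q - 0" by simp
      then show ?thesis by (simp only: cong_iff_dvd_diff)
    qed
    show ?thesis
      using * unfolding shift c_def .
  qed
  then show ?thesis unfolding satisfies_iff[OF A hu hv] eqv_def by simp
qed

text \<open>Each variable keeps the coset in which its value lies, so that only the coefficients of
  the periods vary. They are replaced by rational ones through \<open>linear_system\<close>;
  \<open>coset_realised\<close> returns to the closure of the constraint and
  \<open>sigma_choice\<close> to the signature.\<close>

lemma ops_reducible:
  assumes E: "is_system (range ops) E" shows "reducible_for (range ops) V E"
  unfolding reducible_for_def
proof
  assume "\<exists>\<delta>. solution V E \<delta>"
  then obtain \<delta> where \<delta>: "solution V E \<delta>" by blast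
  define X where "X = variables E"
  define P where "P = parameters E"
  define A where "A = alphabet E"
  define L where "L = constraint E"
  have fin: "finite X" "finite P" "finite A" "X \<inter> P = {}" "finite (equations E)"
    using E by (auto simp: is_system_def X_def P_def A_def)
  have eqs: "u \<in> sigma_sub (range ops) FinS (X \<union> P)" "v \<in> sigma_sub (range ops) FinS (X \<union> P)"
    if "(u, v) \<in> equations E" for u v
    using E that by (auto simp: is_system_def X_def P_def)
  have L: "rational A (L x)" if "x \<in> X" for x using E that by (auto simp: is_system_def X_def A_def L_def)
  have pv: "param_value E p \<in> sigma_sub (range ops) FinS A" if "p \<in> P" for p
    using E that by (auto simp: is_system_def P_def A_def)
  have hom: "cont_hom (Omega FinS (X \<union> P)) (Omega_top FinS (X \<union> P)) (Omega FinS A) (Omega_top FinS A) \<delta>"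
    and \<delta>X: "\<And>x. x \<in> X \<Longrightarrow> Some (\<delta> (letter FinS (X \<union> P) x)) \<in> Cl A (L x)"
    and \<delta>P: "\<And>p. p \<in> P \<Longrightarrow> \<delta> (letter FinS (X \<union> P) p) = param_value E p"
    and \<delta>E: "\<And>u v. (u, v) \<in> equations E \<Longrightarrow> satisfies V A (\<delta> u) (\<delta> v)"
    using \<delta> unfolding solution_def X_def P_def A_def L_def by auto
  show "\<exists>\<delta>. solution V E \<delta> \<and>
    (\<forall>x\<in>variables E. \<delta> (letter FinS (unknowns E) x) \<in> sigma_sub (range ops) FinS (alphabet E))"
  proof (cases "X = {}")
    case True
    then show ?thesis using \<delta> by (auto simp: X_def)
  next
    case False
    then obtain x0 where x0: "x0 \<in> X" by blast
    \<comment> \<open>Over the empty alphabet the only word is empty, and its image is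
      \<open>None\<close>; a value of a variable would have no approximating word.\<close>
    have "A \<noteq> {}"
    proof
      assume "A = {}"
      then have "nonempty_words (L x0) = {}"
        using rational_subset[OF L[OF x0]] by (auto simp: nonempty_words_def)
      then show False
        using \<delta>X[OF x0] unfolding Cl_Some_iff[OF rational_subset[OF L[OF x0]]] by simp
    qed
    let ?y = "\<lambda>b. \<delta> (letter FinS (X \<union> P) b)"
    have y: "?y \<in> X \<union> P \<rightarrow> carrier (Omega FinS A)"
      using hom letter_in_Omega[OF order_refl] by (auto simp: cont_hom_def sg_hom_def)
    have "\<forall>x\<in>X. \<exists>F. semilinear (L x) F" using rational_semilinear[OF L] by blast
    then obtain F where F: "\<And>x. x \<in> X \<Longrightarrow> semilinear (L x) (F x)" by metis
    define R where "R x g hs \<alpha> \<longleftrightarrow> (g, hs) \<in> F x \<and> (\<forall>i<length hs. compat (\<alpha> i)) \<and>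
      (\<forall>a\<in>A. eqv (exv A (?y x) a) (\<lambda>m. g a + (\<Sum>i<length hs. \<alpha> i m * (hs ! i) a)))"
      for x :: nat and g :: "nat \<Rightarrow> int" and hs :: "(nat \<Rightarrow> int) list" and \<alpha> :: "nat \<Rightarrow> nat \<Rightarrow> int"
    have "\<exists>g hs \<alpha>. R x g hs \<alpha>" if x: "x \<in> X" for x
      unfolding R_def
      by (rule closure_coset[OF fin(3) rational_subset[OF L[OF x]] F[OF x] \<delta>X[OF x]]) blast
    then obtain g hs \<alpha> where R: "\<And>x. x \<in> X \<Longrightarrow> R x (g x) (hs x) (\<alpha> x)" by metis
    have gh: "(g x, hs x) \<in> F x" if "x \<in> X" for x
      using R[OF that] by (simp add: R_def)
    have \<alpha>: "compat (\<alpha> x i)" if "x \<in> X" "i < length (hs x)" for x i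
      using R[OF that(1)] that(2) by (simp add: R_def)
    have y_eqv: "eqv (exv A (?y x) a) (\<lambda>m. g x a + (\<Sum>i<length (hs x). \<alpha> x i m * (hs x ! i) a))"
      if "x \<in> X" "a \<in> A" for x a
      using R[OF that(1)] that(2) by (simp add: R_def)
    let ?J = "Sigma X (\<lambda>x. {..<length (hs x)})"
    let ?c = "\<lambda>u v b m. exv (X \<union> P) u b m - exv (X \<union> P) v b m"
    define r where "r = (\<lambda>((u, v), a) (x, i) m. ?c u v x m * (hs x ! i) a)"
    define b where "b = (\<lambda>((u, v), a) m. - (\<Sum>x\<in>X. ?c u v x m * g x a) - (\<Sum>p\<in>P. ?c u v p m * exv A (param_value E p) a m))"
    have sat_iff: "satisfies V A (hat (X \<union> P) (Omega FinS A) (Omega_top FinS A) \<phi> u) (hat (X \<union> P) (Omega FinS A) (Omega_top FinS A) \<phi> v)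
      \<longleftrightarrow> (\<forall>a\<in>A. eqv (\<lambda>m. \<Sum>j\<in>?J. r ((u, v), a) j m * \<gamma> j m) (b ((u, v), a)))"
      if uv: "(u, v) \<in> equations E" and \<phi>: "\<phi> \<in> X \<union> P \<rightarrow> carrier (Omega FinS A)"
        and \<phi>P: "\<And>p. p \<in> P \<Longrightarrow> \<phi> p = param_value E p"
        and coset: "\<And>x a. x \<in> X \<Longrightarrow> a \<in> A \<Longrightarrow>
          eqv (exv A (\<phi> x) a) (\<lambda>m. g x a + (\<Sum>i<length (hs x). \<gamma> (x, i) m * (hs x ! i) a))"
      for u v \<phi> \<gamma>
    proof -
      have uO: "u \<in> carrier (Omega FinS (X \<union> P))" and vO: "v \<in> carrier (Omega FinS (X \<union> P))"
        using eqs[OF uv] sigma_sub_in_Omega[OF ops_signature] by auto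
      have "(\<Sum>j\<in>?J. r ((u, v), a) j m * \<gamma> j m) = (\<Sum>(x, i)\<in>?J. (?c u v x m * (hs x ! i) a) * \<gamma> (x, i) m)" for a m
        by (intro sum.cong) (auto simp: r_def)
      moreover have "(\<Sum>p\<in>P. ?c u v p m * exv A (\<phi> p) a m) = (\<Sum>p\<in>P. ?c u v p m * exv A (param_value E p) a m)" for a m
        by (intro sum.cong) (simp_all add: \<phi>P)
      ultimately show ?thesis
        using satisfies_system_iff[where g = g and hs = hs and \<gamma> = \<gamma>, OF fin(3,1,2,4) uO vO \<phi> coset]
        by (simp add: b_def)
    qed
    obtain \<beta> where \<beta>: "\<And>j. j \<in> ?J \<Longrightarrow> rat (\<beta> j)"
      "\<And>e. e \<in> equations E \<times> A \<Longrightarrow> eqv (\<lambda>m. \<Sum>j\<in>?J. r e j m * \<beta> j m) (b e)"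
    proof (rule linear_system[of ?J "equations E \<times> A" r b "\<lambda>(x, i). \<alpha> x i"])
      show "finite ?J" "finite (equations E \<times> A)" using fin by auto
      have rat_c: "rat (\<lambda>m. ?c u v z m)" if "(u, v) \<in> equations E" "z \<in> X \<union> P" for u v z
        using eqs[OF that(1)] that(2) fin by (intro rat_diff rat_sigma_sub) auto
      show "rat (r e j)" if "e \<in> equations E \<times> A" "j \<in> ?J" for e j
        using that rat_mult[OF rat_c rat_const] by (auto simp: r_def)
      show "rat (b e)" if e: "e \<in> equations E \<times> A" for e
      proof -
        obtain u v a where uv: "e = ((u, v), a)" "(u, v) \<in> equations E" "a \<in> A" using e by auto
        have "rat (\<lambda>m. 0 - (\<Sum>x\<in>X. ?c u v x m * g x a) - (\<Sum>p\<in>P. ?c u v p m * exv A (param_value E p) a m))"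
          using uv fin pv by (intro rat_diff rat_const rat_sum rat_mult rat_c rat_sigma_sub) auto
        then show ?thesis by (simp add: b_def uv(1))
      qed
      show "compat ((\<lambda>(x, i). \<alpha> x i) j)" if "j \<in> ?J" for j using that \<alpha> by auto
      show "eqv (\<lambda>m. \<Sum>j\<in>?J. r e j m * (\<lambda>(x, i). \<alpha> x i) j m) (b e)" if e: "e \<in> equations E \<times> A" for e
      proof -
        obtain u v a where uv: "e = ((u, v), a)" "(u, v) \<in> equations E" "a \<in> A" using e by auto
        have uO: "u \<in> carrier (Omega FinS (X \<union> P))" and vO: "v \<in> carrier (Omega FinS (X \<union> P))"
          using eqs[OF uv(2)] sigma_sub_in_Omega[OF ops_signature] by auto
        have "satisfies V A (hat (X \<union> P) (Omega FinS A) (Omega_top FinS A) ?y u) (hat (X \<union> P) (Omega FinS A) (Omega_top FinS A) ?y v)"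
          using \<delta>E[OF uv(2)] unfolding cont_hom_eq_hat[OF hom uO] cont_hom_eq_hat[OF hom vO] .
        then show ?thesis
          using sat_iff[OF uv(2) y \<delta>P, of "\<lambda>(x, i). \<alpha> x i"] y_eqv uv(1,3) by simp
      qed
    next
      fix \<beta> assume "\<And>j. j \<in> ?J \<Longrightarrow> rat (\<beta> j)"
        "\<And>e. e \<in> equations E \<times> A \<Longrightarrow> eqv (\<lambda>m. \<Sum>j\<in>?J. r e j m * \<beta> j m) (b e)"
      then show thesis by (rule that)
    qed
    define Q where "Q x w \<longleftrightarrow> w \<in> sigma_sub (range ops) FinS A \<and> Some w \<in> Cl A (L x) \<and>
      (\<forall>a\<in>A. eqv (exv A w a) (\<lambda>m. g x a + (\<Sum>i<length (hs x). \<beta> (x, i) m * (hs x ! i) a)))" for x w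
    have "\<exists>w. Q x w" if x: "x \<in> X" for x
    proof -
      have \<beta>x: "rat (\<beta> (x, i))" if "i < length (hs x)" for i using \<beta>(1) x that by auto
      obtain w0 where w0: "w0 \<in> carrier (Omega FinS A)" "Some w0 \<in> Cl A (L x)"
        "\<And>a. a \<in> A \<Longrightarrow> eqv (exv A w0 a) (\<lambda>m. g x a + (\<Sum>i<length (hs x). \<beta> (x, i) m * (hs x ! i) a))"
        by (rule coset_realised[OF fin(3) rational_subset[OF L[OF x]] F[OF x] gh[OF x], of "\<lambda>i. \<beta> (x, i)"])
           (use rat_compat[OF \<beta>x] in auto)
      have rat_w0: "rat (exv A w0 a)" if a: "a \<in> A" for a
      proof (rule rat_eqv[OF _ compat_exv[OF fin(3) a w0(1)]])
        show "rat (\<lambda>m. g x a + (\<Sum>i<length (hs x). \<beta> (x, i) m * (hs x ! i) a))"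
          by (intro rat_add rat_const rat_sum rat_mult \<beta>x) simp
        show "eqv (\<lambda>m. g x a + (\<Sum>i<length (hs x). \<beta> (x, i) m * (hs x ! i) a)) (exv A w0 a)"
          by (rule eqv_sym[OF w0(3)[OF a]])
      qed
      obtain w where w: "w \<in> sigma_sub (range ops) FinS A" "Some w \<in> Cl A (L x)"
        "\<And>a. a \<in> A \<Longrightarrow> eqv (exv A w a) (exv A w0 a)"
        using sigma_choice[OF fin(3) \<open>A \<noteq> {}\<close> L[OF x] w0(2) rat_w0] by blast
      have "eqv (exv A w a) (\<lambda>m. g x a + (\<Sum>i<length (hs x). \<beta> (x, i) m * (hs x ! i) a))" if "a \<in> A" for a
        using w(3)[OF that] w0(3)[OF that] by (rule eqv_trans)
      then show ?thesis using w(1,2) unfolding Q_def by blast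
    qed
    then obtain W where Q: "\<And>x. x \<in> X \<Longrightarrow> Q x (W x)" by metis
    have W: "W x \<in> sigma_sub (range ops) FinS A" "Some (W x) \<in> Cl A (L x)"
      and W_eqv: "a \<in> A \<Longrightarrow>
        eqv (exv A (W x) a) (\<lambda>m. g x a + (\<Sum>i<length (hs x). \<beta> (x, i) m * (hs x ! i) a))"
      if "x \<in> X" for x a
      using Q[OF that] by (simp_all add: Q_def)
    define \<phi> where "\<phi> z = (if z \<in> X then W z else param_value E z)" for z
    have \<phi>: "\<phi> \<in> X \<union> P \<rightarrow> carrier (Omega FinS A)"
      using W(1) pv sigma_sub_in_Omega[OF ops_signature] by (auto simp: \<phi>_def)
    have \<phi>P: "\<phi> p = param_value E p" if "p \<in> P" for p using that fin(4) by (auto simp: \<phi>_def)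
    let ?\<delta> = "hat (X \<union> P) (Omega FinS A) (Omega_top FinS A) \<phi>"
    have "solution V E ?\<delta>"
      unfolding solution_def X_def[symmetric] P_def[symmetric] A_def[symmetric] L_def[symmetric]
    proof (intro conjI ballI)
      show "cont_hom (Omega FinS (X \<union> P)) (Omega_top FinS (X \<union> P)) (Omega FinS A) (Omega_top FinS A) ?\<delta>"
        by (rule hat_cont_hom[OF \<phi>])
      show "Some (?\<delta> (letter FinS (X \<union> P) x)) \<in> Cl A (L x)" if "x \<in> X" for x
        using hat_letter[OF \<phi>, of x] W(2) that by (simp add: \<phi>_def)
      show "?\<delta> (letter FinS (X \<union> P) p) = param_value E p" if "p \<in> P" for p
        using hat_letter[OF \<phi>, of p] \<phi>P that by simp
      fix e assume e: "e \<in> equations E"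
      obtain u v where uv: "e = (u, v)" by (cases e)
      have W_eqv': "eqv (exv A (\<phi> x) a) (\<lambda>m. g x a + (\<Sum>i<length (hs x). \<beta> (x, i) m * (hs x ! i) a))"
        if "x \<in> X" "a \<in> A" for x a
        using W_eqv[OF that] that(1) by (simp add: \<phi>_def)
      have "satisfies V A (?\<delta> u) (?\<delta> v)"
      proof (rule iffD2[OF sat_iff[where \<gamma> = \<beta>, OF e[unfolded uv] \<phi> \<phi>P W_eqv']], assumption+, rule ballI)
        fix a assume "a \<in> A"
        then have "((u, v), a) \<in> equations E \<times> A" using e uv by simp
        then show "eqv (\<lambda>m. \<Sum>j\<in>?J. r ((u, v), a) j m * \<beta> j m) (b ((u, v), a))" by (rule \<beta>(2))
      qed
      then show "case e of (u, v) \<Rightarrow> satisfies V A (?\<delta> u) (?\<delta> v)" by (simp add: uv)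
    qed
    moreover have "?\<delta> (letter FinS (X \<union> P) x) \<in> sigma_sub (range ops) FinS A" if "x \<in> X" for x
      using hat_letter[OF \<phi>, of x] W(1) that by (simp add: \<phi>_def)
    ultimately show ?thesis unfolding X_def P_def A_def by blast
  qed
qed

lemma decidable_imp_tame:
  assumes "decidable_pv V" shows "completely_tame V"
proof -
  have D: "decidable 1 (\<lambda>xs. hd xs \<in> exponents V)" using assms by (simp add: decidable_pv_iff)
  show ?thesis
    unfolding completely_tame_def completely_sigma_tame_def sigma_tame_def
    using ops_signature ops_reducible ops_word_problem[OF D] rec_enumerable[OF D] by blast
qed

end

theorem corollary2p8:
  fixes V :: "nat semigrp set"
  assumes "pseudovariety V"
    and "\<forall>S\<in>V. is_abelian_group S"
  shows "decidable_pv V \<longleftrightarrow> completely_tame V"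
proof -
  interpret abelian_pv V using assms by unfold_locales auto
  show ?thesis using decidable_imp_tame tame_imp_decidable by blast
qed

end
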